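(* Let $K$ be the symmetric subset of $\mathbb R$ such that $$K^+=\Big(\coprod_{n=0}^\infty I_n\Big)\cup\Big(\coprod_{n=0}^\infty J_n\Big),$$ where $$I_0=\left[\frac43,\frac32\right],\qquad I_n=\left[\frac{3\cdot2^{3n+2}}{2^{2n+3}-1},\frac{3\cdot2^{3n+1}}{2^{2n+2}-1}\right],\ n\ge1,$$ and $$J_0=\left[\frac15,\frac13\right],\qquad J_n=\left[\frac{3\cdot2^n}{2^{2n+4}-1},\frac{3\cdot2^{n-1}}{2^{2n+3}-1}\right],\ n\ge1.$$ Then $K$ is a symmetric wavelet set of $L^2(\mathbb R)$ having $0$ as accumulation point.
   Context: Fourier transform: $\widehat\psi(\xi)=\int_{\mathbb R}\psi(x)e^{-2\pi i x\xi}\,dx$. An orthonormal wavelet is a function $\psi\in L^2(\mathbb R)$ such that $\{2^{j/2}\psi(2^jx-k): j,k\in\mathbb Z\}$ is an orthonormal basis of $L^2(\mathbb R)$. A measurable set $K\subset\mathbb R$ is a wavelet set (of $L^2(\mathbb R)$) if there is an orthonormal wavelet $\psi$ with $|\widehat\psi|=\chi_K$ a.e. It is symmetric if $K\cap(-\infty,0]=-(K\cap[0,\infty))$; $K^+=K\cap[0,\infty)$. The symbol $\coprod$ denotes disjoint union. Equalities of sets are understood up to Lebesgue null sets. *)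

theory Defs
  imports "HOL-Analysis.Analysis"
begin

text \<open>
  Elements of \<open>L\<^sup>2(\<real>)\<close> are represented by Lebesgue measurable functions
  \<open>real \<Rightarrow> complex\<close>; all notions below are invariant under a.e. equality.
\<close>

definition in_L2 :: "(real \<Rightarrow> complex) \<Rightarrow> bool" where
  "in_L2 f \<longleftrightarrow> f \<in> borel_measurable lebesgue \<and> integrable lebesgue (\<lambda>x. (cmod (f x))\<^sup>2)"

definition L2_inner :: "(real \<Rightarrow> complex) \<Rightarrow> (real \<Rightarrow> complex) \<Rightarrow> complex" where
  "L2_inner f g = (LINT x|lebesgue. f x * cnj (g x))"

text \<open>
  The squared \<open>L\<^sup>2\<close> distance, as a nonnegative (possibly infinite) integral, so that a
  difference outside \<open>L\<^sup>2\<close> does not count as having distance 0.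
\<close>

definition L2_sqdist :: "(real \<Rightarrow> complex) \<Rightarrow> (real \<Rightarrow> complex) \<Rightarrow> ennreal" where
  "L2_sqdist f g = (\<integral>\<^sup>+ x. ennreal ((cmod (f x - g x))\<^sup>2) \<partial>lebesgue)"

definition orthonormal_basis_L2 :: "('i \<Rightarrow> real \<Rightarrow> complex) \<Rightarrow> bool" where
  "orthonormal_basis_L2 b \<longleftrightarrow>
     (\<forall>i. in_L2 (b i)) \<and>
     (\<forall>i j. L2_inner (b i) (b j) = (if i = j then 1 else 0)) \<and>
     (\<forall>f. in_L2 f \<longrightarrow> (\<forall>\<epsilon>::real. \<epsilon> > 0 \<longrightarrow>
        (\<exists>A c. finite A \<and> L2_sqdist f (\<lambda>x. \<Sum>i\<in>A. c i * b i x) < ennreal \<epsilon>)))"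

definition orthonormal_wavelet :: "(real \<Rightarrow> complex) \<Rightarrow> bool" where
  "orthonormal_wavelet \<psi> \<longleftrightarrow> in_L2 \<psi> \<and>
     orthonormal_basis_L2 (\<lambda>(j::int, k::int) x.
       complex_of_real (2 powr (real_of_int j / 2)) * \<psi> (2 powi j * x - real_of_int k))"

definition fourier_integral :: "(real \<Rightarrow> complex) \<Rightarrow> real \<Rightarrow> complex" where
  "fourier_integral f \<xi> = (LINT x|lebesgue. f x * exp (- 2 * pi * \<i> * x * \<xi>))"

text \<open>
  For \<open>f\<close> in \<open>L\<^sup>2\<close> the Fourier integral need not converge absolutely; as usual, the transform
  is the \<open>L\<^sup>2\<close> limit of the Fourier integrals of the truncations of \<open>f\<close>, which are integrable.
  It is unique only up to a.e. equality, hence a relation rather than a function.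
\<close>

definition has_fourier_transform :: "(real \<Rightarrow> complex) \<Rightarrow> (real \<Rightarrow> complex) \<Rightarrow> bool" where
  "has_fourier_transform f F \<longleftrightarrow> in_L2 f \<and> in_L2 F \<and>
     (\<lambda>n. L2_sqdist F (fourier_integral (\<lambda>x. indicator {- real n..real n} x * f x)))
       \<longlonglongrightarrow> 0"

definition wavelet_set :: "real set \<Rightarrow> bool" where
  "wavelet_set K \<longleftrightarrow> K \<in> sets lebesgue \<and>
     (\<exists>\<psi> F. orthonormal_wavelet \<psi> \<and> has_fourier_transform \<psi> F \<and>
        (AE \<xi> in lebesgue. cmod (F \<xi>) = indicator K \<xi>))"

definition ae_eq_set :: "real set \<Rightarrow> real set \<Rightarrow> bool" where
  "ae_eq_set A B \<longleftrightarrow> (AE x in lebesgue. x \<in> A \<longleftrightarrow> x \<in> B)"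

definition symmetric_set :: "real set \<Rightarrow> bool" where
  "symmetric_set K \<longleftrightarrow> ae_eq_set (K \<inter> {..0}) (uminus ` (K \<inter> {0..}))"

definition I_set :: "nat \<Rightarrow> real set" where
  "I_set n = (if n = 0 then {4/3..3/2}
     else {3 * 2 ^ (3*n + 2) / (2 ^ (2*n + 3) - 1)..3 * 2 ^ (3*n + 1) / (2 ^ (2*n + 2) - 1)})"

definition J_set :: "nat \<Rightarrow> real set" where
  "J_set n = (if n = 0 then {1/5..1/3}
     else {3 * 2 ^ n / (2 ^ (2*n + 4) - 1)..3 * 2 ^ (n - 1) / (2 ^ (2*n + 3) - 1)})"

text \<open>
  The two families are disjoint, so their unions are disjoint unions.
\<close>

lemma I_set_bounds: "I_set n \<subseteq> {2 ^ n..<2 ^ Suc n}"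
proof (cases "n = 0")
  case False
  define t :: real where "t = 2 ^ n"
  have "(2::real) ^ 1 \<le> 2 ^ n" using False by (intro power_increasing) auto
  then have t: "t \<ge> 2" by (simp add: t_def)
  have tt: "t * t \<ge> 4" using mult_mono[of 2 t 2 t] t by simp
  have p: "(2::real) ^ (n*3) = t * t * t" "(2::real) ^ (n*2) = t * t"
    by (simp_all only: t_def power_mult power3_eq_cube power2_eq_square)
  have "t \<le> 3 * (t * t * t * 4) / (t * t * 8 - 1)"
    using t tt by (simp add: pos_le_divide_eq algebra_simps)
  moreover have "3 * (t * t * t * 2) / (t * t * 4 - 1) < 2 * t"
  proof -
    have "t * 2 < t * (t * t * 2)" using t tt by simp
    then show ?thesis using t tt by (simp add: pos_divide_less_eq algebra_simps)
  qed
  ultimately show ?thesis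
    using False by (auto simp: I_set_def power_add p t_def[symmetric] mult_ac)
qed (auto simp: I_set_def)

lemma J_set_bounds: "J_set n \<subseteq> {3 / 2 ^ (n + 4)..<3 / 2 ^ (n + 3)}"
proof (cases "n = 0")
  case False
  then obtain m where n: "n = Suc m" by (cases n) auto
  define t :: real where "t = 2 ^ m"
  have t: "t \<ge> 1" by (simp add: t_def)
  have tt: "t * t \<ge> 1" using mult_mono[of 1 t 1 t] t by simp
  have p: "(2::real) ^ (m*2) = t * t"
    by (simp add: t_def power_add[symmetric] mult_2_right[symmetric])
  have "3 / (t * 32) \<le> 3 * (t * 2) / (t * t * 64 - 1)"
    using t tt by (simp add: divide_simps)
  moreover have "3 * t / (t * t * 32 - 1) < 3 / (t * 16)"
    using t tt by (simp add: divide_simps)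
  ultimately show ?thesis
    using False by (auto simp: n J_set_def power_add p t_def[symmetric] mult_ac)
qed (auto simp: J_set_def)

lemma disjoint_family_I_set: "disjoint_family I_set"
proof -
  have "I_set m \<inter> I_set n = {}" if "m < n" for m n
  proof -
    have "(2::real) ^ Suc m \<le> 2 ^ n" using that by (intro power_increasing) auto
    then show ?thesis using I_set_bounds[of m] I_set_bounds[of n] by fastforce
  qed
  then show ?thesis unfolding disjoint_family_on_def by (metis Int_commute nat_neq_iff)
qed

lemma disjoint_family_J_set: "disjoint_family J_set"
proof -
  have "J_set m \<inter> J_set n = {}" if "m < n" for m n
  proof -
    have "(2::real) ^ (m + 4) \<le> 2 ^ (n + 3)" using that by (intro power_increasing) auto
    then have "3 / (2::real) ^ (n + 3) \<le> 3 / 2 ^ (m + 4)" by (intro divide_left_mono) auto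
    then show ?thesis using J_set_bounds[of m] J_set_bounds[of n] by fastforce
  qed
  then show ?thesis unfolding disjoint_family_on_def by (metis Int_commute nat_neq_iff)
qed

end

theory Submission
  imports Defs
begin

text \<open>
  Let \<open>\<chi>\<close> be the indicator function of \<open>K\<close> and \<open>\<psi>\<close> its inverse Fourier transform. On the Fourier
  side the wavelet system of \<open>\<psi>\<close> consists of the functions
  \<open>2\<^bsup>-j/2\<^esup> exp (-2 \<pi> i k 2\<^bsup>-j\<^esup> \<xi>) \<chi> (2\<^bsup>-j\<^esup> \<xi>)\<close>. They form an orthonormal basis as soon as the
  integer translates of \<open>K\<close> and the dyadic dilates of \<open>K\<close> both partition the line up to null sets:
  by the first tiling \<open>K\<close> is, modulo \<open>1\<close>, a copy of the unit interval, so that the exponentials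
  restricted to \<open>K\<close> behave like the Fourier basis of the unit interval, and by the second one the
  rescaled copies of this basis fill up the whole space without overlap.

  To carry this back to \<open>\<psi>\<close> one needs that the Fourier transform preserves \<open>L\<^sup>2\<close> norms
  (\<open>plancherel\<close>). This is derived from Fourier series: if \<open>f\<close> is supported in the unit interval,
  then the values of its transform at the points \<open>t + k\<close> with \<open>k\<close> an integer are the Fourier
  coefficients of a modulation of \<open>f\<close>, so Parseval's identity, integrated over \<open>t\<close>, gives the
  claim; scaling and truncation reach every integrable square integrable function. The identity
  \<open>sqnorm_inverse_fourier_diff\<close>, which says that the distance of \<open>f\<close> to the inverse transform of \<open>g\<close>
  equals the distance of the transform of \<open>f\<close> to \<open>g\<close>, then transports both the density of
  the system and the convergence of truncated Fourier integrals. Density of trigonometric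
  polynomials comes from the Stone-Weierstrass theorem on the circle. The outcome is the criterion
  \<open>tiling_set.wavelet_set_if_ae_eq\<close>.

  It remains to see the two tilings. Write \<open>J\<^sub>n = [a\<^sub>n, b\<^sub>n]\<close>. A computation with the explicit
  endpoints shows \<open>I\<^sub>0 - 1 = [b\<^sub>0, 1/2]\<close> and \<open>I\<^bsub>n+1\<^esub> - 3 2\<^sup>n = [b\<^bsub>n+1\<^esub>, a\<^sub>n]\<close>. Hence the integer shifts
  \<open>I\<^sub>0 - 1, J\<^sub>0, I\<^sub>1 - 3, J\<^sub>1, I\<^sub>2 - 6, \<dots>\<close> are adjacent intervals that descend from \<open>1/2\<close> to \<open>0\<close>, and
  together with their mirror images they fill the period \<open>[-1/2, 1/2]\<close>. Likewise \<open>I\<^bsub>n+1\<^esub>\<close> divided by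
  \<open>2\<^bsup>n+2\<^esup>\<close> reaches from \<open>2\<^bsup>n+3\<^esup> b\<^bsub>n+1\<^esub>\<close> to \<open>2\<^bsup>n+2\<^esup> a\<^sub>n\<close>, so that the dyadic dilates
  \<open>I\<^sub>0, 4 J\<^sub>0, I\<^sub>1 / 4, 8 J\<^sub>1, I\<^sub>2 / 8, \<dots>\<close> are adjacent intervals that descend from \<open>3/2\<close> to \<open>3/4\<close>, a
  fundamental domain of dyadic dilation on the positive axis. The lemma \<open>AE_ex1_orbit\<close> treats both
  situations at once. Finally \<open>0\<close> is an accumulation point because the intervals \<open>J\<^sub>n\<close> have positive
  length and shrink to \<open>0\<close>.
\<close>

section \<open>Square norms and inner products on the line\<close>

definition sqnorm :: "(real \<Rightarrow> complex) \<Rightarrow> ennreal" where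
  "sqnorm f = (\<integral>\<^sup>+ x. ennreal ((cmod (f x))\<^sup>2) \<partial>lborel)"

definition square_integrable :: "(real \<Rightarrow> complex) \<Rightarrow> bool" where
  "square_integrable f \<longleftrightarrow> f \<in> borel_measurable borel \<and> sqnorm f < \<infinity>"

lemma square_integrable_measurable [measurable_dest]:
  "square_integrable f \<Longrightarrow> f \<in> borel_measurable borel"
  by (simp add: square_integrable_def)

lemma sqnorm_zero [simp]: "sqnorm (\<lambda>x. 0) = 0"
  by (simp add: sqnorm_def)

lemma sqnorm_cong_AE: "AE x in lborel. f x = g x \<Longrightarrow> sqnorm f = sqnorm g"
  unfolding sqnorm_def by (intro nn_integral_cong_AE) auto

lemma sqnorm_mono: "(\<And>x. cmod (f x) \<le> cmod (g x)) \<Longrightarrow> sqnorm f \<le> sqnorm g"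
  unfolding sqnorm_def by (intro nn_integral_mono ennreal_leI power_mono) auto

lemma sqnorm_cong_norm: "(\<And>x. cmod (f x) = cmod (g x)) \<Longrightarrow> sqnorm f = sqnorm g"
  by (simp add: sqnorm_def)

lemma sqnorm_minus_commute: "sqnorm (\<lambda>x. f x - g x) = sqnorm (\<lambda>x. g x - f x)"
  by (rule sqnorm_cong_norm) (simp add: norm_minus_commute)

lemma sqnorm_cmult:
  assumes [measurable]: "f \<in> borel_measurable borel"
  shows "sqnorm (\<lambda>x. c * f x) = ennreal ((cmod c)\<^sup>2) * sqnorm f"
  unfolding sqnorm_def
  by (subst nn_integral_cmult[symmetric]) (auto simp: norm_mult power_mult_distrib ennreal_mult)

text \<open>
  Squared norms obey no triangle inequality with constant \<open>1\<close>, but the constant of one summand can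
  be brought arbitrarily close to \<open>1\<close>. This suffices to pass to limits without taking square roots of
  possibly infinite integrals.
\<close>

lemma norm_add_sq_le:
  fixes a b :: complex
  assumes "\<delta> > 0"
  shows "(cmod (a + b))\<^sup>2 \<le> (1 + \<delta>) * (cmod a)\<^sup>2 + (1 + 1 / \<delta>) * (cmod b)\<^sup>2"
proof -
  have "(cmod (a + b))\<^sup>2 \<le> (cmod a + cmod b)\<^sup>2"
    by (intro power_mono norm_triangle_ineq) auto
  \<comment> \<open>the mixed term \<open>2 cmod a cmod b\<close> is absorbed into the two squares\<close>
  moreover have "0 \<le> (\<delta> * cmod a - cmod b)\<^sup>2 / \<delta>"
    using assms by simp
  moreover have "(\<delta> * cmod a - cmod b)\<^sup>2 / \<delta> = \<delta> * (cmod a)\<^sup>2 - 2 * cmod a * cmod b + (cmod b)\<^sup>2 / \<delta>"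
    using assms by (simp add: power2_eq_square field_simps)
  ultimately show ?thesis
    by (simp add: power2_eq_square algebra_simps)
qed

lemma sqnorm_add_le_weighted:
  assumes [measurable]: "f \<in> borel_measurable borel" "g \<in> borel_measurable borel" and "\<delta> > 0"
  shows "sqnorm (\<lambda>x. f x + g x) \<le> ennreal (1 + \<delta>) * sqnorm f + ennreal (1 + 1 / \<delta>) * sqnorm g"
proof -
  have "sqnorm (\<lambda>x. f x + g x) \<le> (\<integral>\<^sup>+ x. ennreal (1 + \<delta>) * ennreal ((cmod (f x))\<^sup>2)
      + ennreal (1 + 1 / \<delta>) * ennreal ((cmod (g x))\<^sup>2) \<partial>lborel)"
    unfolding sqnorm_def using \<open>\<delta> > 0\<close>
    by (intro nn_integral_mono)
      (simp add: ennreal_mult[symmetric] ennreal_plus[symmetric] norm_add_sq_le del: ennreal_plus)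
  also have "\<dots> = ennreal (1 + \<delta>) * sqnorm f + ennreal (1 + 1 / \<delta>) * sqnorm g"
    unfolding sqnorm_def by (subst nn_integral_add) (simp_all add: nn_integral_cmult)
  finally show ?thesis .
qed

lemma sqnorm_add_le:
  assumes "f \<in> borel_measurable borel" "g \<in> borel_measurable borel"
  shows "sqnorm (\<lambda>x. f x + g x) \<le> 2 * sqnorm f + 2 * sqnorm g"
  using sqnorm_add_le_weighted[OF assms, of 1] by simp

lemma square_integrable_add [intro]:
  assumes "square_integrable f" "square_integrable g"
  shows "square_integrable (\<lambda>x. f x + g x)"
proof -
  have [measurable]: "f \<in> borel_measurable borel" "g \<in> borel_measurable borel"
    using assms by auto
  have "2 * sqnorm f + 2 * sqnorm g < \<infinity>"
    using assms by (simp add: square_integrable_def ennreal_mult_less_top)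
  then show ?thesis
    unfolding square_integrable_def using sqnorm_add_le[of f g] by (auto intro: le_less_trans)
qed

lemma square_integrable_cmult [intro]:
  assumes "square_integrable f"
  shows "square_integrable (\<lambda>x. c * f x)"
  using assms by (auto simp: square_integrable_def sqnorm_cmult ennreal_mult_less_top)

lemma square_integrable_diff [intro]:
  assumes "square_integrable f" "square_integrable g"
  shows "square_integrable (\<lambda>x. f x - g x)"
  using square_integrable_add[OF assms(1) square_integrable_cmult[OF assms(2), of "-1"]] by simp

lemma square_integrable_zero [intro, simp]: "square_integrable (\<lambda>x. 0)"
  by (simp add: square_integrable_def)

lemma square_integrable_sum [intro]:
  "(\<And>i. i \<in> A \<Longrightarrow> square_integrable (f i)) \<Longrightarrow> square_integrable (\<lambda>x. \<Sum>i\<in>A. f i x)"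
  by (induction A rule: infinite_finite_induct) auto

lemma square_integrable_dominated:
  assumes "square_integrable g" "f \<in> borel_measurable borel" "\<And>x. cmod (f x) \<le> cmod (g x)"
  shows "square_integrable f"
  using sqnorm_mono[of f g] assms by (auto simp: square_integrable_def intro: le_less_trans)

lemma square_integrable_indicator_mult [intro]:
  assumes "square_integrable f" and [measurable]: "A \<in> sets borel"
  shows "square_integrable (\<lambda>x. indicator A x * f x)"
proof (rule square_integrable_dominated[OF assms(1)])
  have [measurable]: "f \<in> borel_measurable borel" using assms by auto
  show "(\<lambda>x. indicator A x * f x) \<in> borel_measurable borel" by measurable
qed (auto simp: indicator_def)

lemma sqnorm_indicator:
  assumes [measurable]: "A \<in> sets borel"
  shows "sqnorm (indicator A) = emeasure lborel A"
proof -
  have "sqnorm (indicator A) = (\<integral>\<^sup>+x. indicator A x \<partial>lborel)"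
    unfolding sqnorm_def by (intro nn_integral_cong) (auto simp: indicator_def)
  then show ?thesis by simp
qed

lemma square_integrable_indicator:
  assumes "A \<in> sets borel" "emeasure lborel A < \<infinity>"
  shows "square_integrable (indicator A)"
  using assms by (simp add: square_integrable_def sqnorm_indicator)

lemma sqnorm_tendsto_zero_dominated:
  assumes [measurable]: "\<And>n::nat. f n \<in> borel_measurable borel"
    and g: "square_integrable g" and bnd: "\<And>n x. cmod (f n x) \<le> cmod (g x)"
    and lim: "AE x in lborel. (\<lambda>n. f n x) \<longlonglongrightarrow> 0"
  shows "(\<lambda>n. sqnorm (f n)) \<longlonglongrightarrow> 0"
proof -
  have [measurable]: "g \<in> borel_measurable borel" using g by auto
  have "(\<lambda>n. \<integral>\<^sup>+x. ennreal ((cmod (f n x))\<^sup>2) \<partial>lborel) \<longlonglongrightarrow> (\<integral>\<^sup>+x. 0 \<partial>(lborel :: real measure))"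
  proof (rule nn_integral_dominated_convergence[where w="\<lambda>x. ennreal ((cmod (g x))\<^sup>2)"])
    show "AE x in lborel. ennreal ((cmod (f n x))\<^sup>2) \<le> ennreal ((cmod (g x))\<^sup>2)" for n
      using bnd by (intro AE_I2 ennreal_leI power_mono) auto
    show "(\<integral>\<^sup>+x. ennreal ((cmod (g x))\<^sup>2) \<partial>lborel) < \<infinity>"
      using g by (simp add: square_integrable_def sqnorm_def)
    show "AE x in lborel. (\<lambda>n. ennreal ((cmod (f n x))\<^sup>2)) \<longlonglongrightarrow> 0"
      using lim
    proof eventually_elim
      case (elim x)
      have "(\<lambda>n. (cmod (f n x))\<^sup>2) \<longlonglongrightarrow> (cmod 0)\<^sup>2"
        using elim by (intro tendsto_intros)
      then show ?case by (simp flip: ennreal_0 )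
    qed
  qed auto
  then show ?thesis by (simp add: sqnorm_def)
qed

text \<open>
  The weighted triangle inequality bounds \<open>sqnorm g\<close> from above and from below by \<open>c\<close>, up to a factor
  \<open>1 + \<delta>\<close> with \<open>\<delta>\<close> arbitrarily small.
\<close>

lemma sqnorm_continuous:
  assumes [measurable]: "\<And>n::nat. f n \<in> borel_measurable borel" "g \<in> borel_measurable borel"
    and lim: "(\<lambda>n. sqnorm (\<lambda>x. g x - f n x)) \<longlonglongrightarrow> 0"
    and c: "(\<lambda>n. sqnorm (f n)) \<longlonglongrightarrow> c" and fin: "c < \<infinity>"
  shows "sqnorm g = c"
proof (rule antisym)
  have part: "u \<le> ennreal (1 + \<delta>) * v" if "\<delta> > 0"
     and h: "\<And>n. u1 n \<le> ennreal (1 + \<delta>) * v1 n + ennreal (1 + 1 / \<delta>) * sqnorm (\<lambda>x. g x - f n x)"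
     and u: "u1 \<longlonglongrightarrow> u" and v: "v1 \<longlonglongrightarrow> v" for u v \<delta> u1 v1
  proof (rule LIMSEQ_le[OF u])
    have "(\<lambda>n. ennreal (1 + \<delta>) * v1 n + ennreal (1 + 1 / \<delta>) * sqnorm (\<lambda>x. g x - f n x)) \<longlonglongrightarrow>
        ennreal (1 + \<delta>) * v + ennreal (1 + 1 / \<delta>) * 0"
      by (intro tendsto_add ennreal_tendsto_cmult v lim) auto
    then show "(\<lambda>n. ennreal (1 + \<delta>) * v1 n + ennreal (1 + 1 / \<delta>) * sqnorm (\<lambda>x. g x - f n x)) \<longlonglongrightarrow>
        ennreal (1 + \<delta>) * v" by simp
  qed (use h in auto)
  have a: "sqnorm g \<le> ennreal (1 + \<delta>) * c" if "\<delta> > 0" for \<delta>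
  proof (rule part[OF that _ tendsto_const c])
    show "sqnorm g \<le> ennreal (1 + \<delta>) * sqnorm (f n) + ennreal (1 + 1 / \<delta>) * sqnorm (\<lambda>x. g x - f n x)" for n
      using sqnorm_add_le_weighted[of "f n" "\<lambda>x. g x - f n x" \<delta>] that by simp
  qed
  have b: "c \<le> ennreal (1 + \<delta>) * sqnorm g" if "\<delta> > 0" for \<delta>
  proof (rule part[OF that _ c tendsto_const])
    show "sqnorm (f n) \<le> ennreal (1 + \<delta>) * sqnorm g + ennreal (1 + 1 / \<delta>) * sqnorm (\<lambda>x. g x - f n x)" for n
      using sqnorm_add_le_weighted[of g "\<lambda>x. f n x - g x" \<delta>] that
      by (simp add: sqnorm_minus_commute[of "f n"])
  qed
  have lim1: "(\<lambda>n. ennreal (1 + 1 / real (Suc n)) * v) \<longlonglongrightarrow> v" if "v < \<infinity>" for v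
  proof -
    obtain r where r: "v = ennreal r" "r \<ge> 0" using \<open>v < \<infinity>\<close> by (cases v) auto
    have "(\<lambda>n. (1 + 1 / real (Suc n)) * r) \<longlonglongrightarrow> (1 + 0) * r"
      by (intro tendsto_intros LIMSEQ_Suc[OF lim_1_over_n])
    then show ?thesis unfolding r
      using r(2) by (subst ennreal_mult[symmetric]) (auto intro!: tendsto_ennrealI)
  qed
  show "sqnorm g \<le> c"
    by (rule LIMSEQ_le_const[OF lim1[OF fin]]) (use a in \<open>auto simp del: of_nat_Suc\<close>)
  have "sqnorm g < \<infinity>" using a[of 1] fin
    by (auto intro: le_less_trans simp: ennreal_mult_less_top)
  then show "c \<le> sqnorm g"
    by (intro LIMSEQ_le_const[OF lim1]) (use b in \<open>auto simp del: of_nat_Suc\<close>)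
qed

lemma square_integrable_integrable_norm:
  "square_integrable f \<Longrightarrow> integrable lborel (\<lambda>x. (cmod (f x))\<^sup>2)"
  by (intro integrableI_nonneg) (auto simp: square_integrable_def sqnorm_def)

lemma sqnorm_eq_integral:
  "square_integrable f \<Longrightarrow> sqnorm f = ennreal (LINT x|lborel. (cmod (f x))\<^sup>2)"
  unfolding sqnorm_def
  by (intro nn_integral_eq_integral square_integrable_integrable_norm) auto

lemma borel_measurable_cnj [measurable]:
  "f \<in> borel_measurable M \<Longrightarrow> (\<lambda>x. cnj (f x)) \<in> borel_measurable M"
  by (rule measurable_compose[OF _ borel_measurable_continuous_onI]) (auto intro: continuous_intros)

lemma integrable_mult_cnj:
  assumes f: "square_integrable f" and g: "square_integrable g"
  shows "integrable lborel (\<lambda>x. f x * cnj (g x))"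
proof (rule Bochner_Integration.integrable_bound)
  have [measurable]: "f \<in> borel_measurable borel" "g \<in> borel_measurable borel"
    using assms by auto
  show "integrable lborel (\<lambda>x. (cmod (f x))\<^sup>2 + (cmod (g x))\<^sup>2)"
    using assms by (intro Bochner_Integration.integrable_add square_integrable_integrable_norm)
  show "(\<lambda>x. f x * cnj (g x)) \<in> borel_measurable lborel"
    by measurable
  have "a * b \<le> a\<^sup>2 + b\<^sup>2" if "0 \<le> a" "0 \<le> b" for a b :: real
    using sum_squares_bound[of a b] that mult_nonneg_nonneg[OF that] by linarith
  then show "AE x in lborel. cmod (f x * cnj (g x)) \<le> norm ((cmod (f x))\<^sup>2 + (cmod (g x))\<^sup>2)"
    by (simp add: norm_mult)
qed

definition inner_product :: "(real \<Rightarrow> complex) \<Rightarrow> (real \<Rightarrow> complex) \<Rightarrow> complex" where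
  "inner_product f g = (LINT x|lborel. f x * cnj (g x))"

lemma enn2real_sqnorm:
  "square_integrable f \<Longrightarrow> enn2real (sqnorm f) = (LINT x|lborel. (cmod (f x))\<^sup>2)"
  by (simp add: sqnorm_eq_integral)

lemma enn2real_sqnorm_add:
  assumes f: "square_integrable f" and g: "square_integrable g"
  shows "enn2real (sqnorm (\<lambda>x. f x + g x)) =
    enn2real (sqnorm f) + enn2real (sqnorm g) + 2 * Re (inner_product f g)"
proof -
  have split: "(LINT x|lborel. u x + v x + 2 * Re (h x)) =
      (LINT x|lborel. u x) + (LINT x|lborel. v x) + 2 * Re (LINT x|lborel. h x)"
    if "integrable lborel u" "integrable lborel v" "integrable lborel h"
    for u v :: "real \<Rightarrow> real" and h :: "real \<Rightarrow> complex"
    using that integrable_Re[OF that(3)] integral_Re[OF that(3)] by simp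
  note i = square_integrable_integrable_norm[OF f] square_integrable_integrable_norm[OF g]
    integrable_mult_cnj[OF f g]
  have "(LINT x|lborel. (cmod (f x + g x))\<^sup>2) =
     (LINT x|lborel. (cmod (f x))\<^sup>2 + (cmod (g x))\<^sup>2 + 2 * Re (f x * cnj (g x)))"
    by (intro Bochner_Integration.integral_cong refl)
      (simp only: cmod_power2, simp add: power2_eq_square algebra_simps)
  also have "\<dots> = (LINT x|lborel. (cmod (f x))\<^sup>2) + (LINT x|lborel. (cmod (g x))\<^sup>2)
      + 2 * Re (inner_product f g)"
    unfolding inner_product_def using i by (rule split)
  finally show ?thesis
    by (simp add: enn2real_sqnorm square_integrable_add f g)
qed

lemma inner_product_cmult_left: "inner_product (\<lambda>x. c * f x) g = c * inner_product f g"
proof -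
  have "inner_product (\<lambda>x. c * f x) g = (LINT x|lborel. c * (f x * cnj (g x)))"
    by (simp add: inner_product_def mult_ac)
  then show ?thesis by (simp add: inner_product_def)
qed

lemma inner_product_cmult_right: "inner_product f (\<lambda>x. c * g x) = cnj c * inner_product f g"
proof -
  have "inner_product f (\<lambda>x. c * g x) = (LINT x|lborel. cnj c * (f x * cnj (g x)))"
    by (simp add: inner_product_def mult_ac)
  then show ?thesis by (simp add: inner_product_def)
qed

lemma enn2real_sqnorm_diff:
  assumes f: "square_integrable f" and g: "square_integrable g"
  shows "enn2real (sqnorm (\<lambda>x. f x - g x)) =
    enn2real (sqnorm f) + enn2real (sqnorm g) - 2 * Re (inner_product f g)"
proof -
  have "sqnorm (\<lambda>x. (-1) * g x) = sqnorm g" by (rule sqnorm_cong_norm) simp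
  then show ?thesis
    using enn2real_sqnorm_add[OF f square_integrable_cmult[OF g, of "-1"]]
    unfolding inner_product_cmult_right by simp
qed

text \<open>
  Polarization. Inner products are preserved by every correspondence that preserves the norms of all
  linear combinations; it turns each norm identity below into an orthogonality statement.
\<close>

lemma inner_product_eqI:
  assumes f: "square_integrable f" "square_integrable g"
    and f': "square_integrable f'" "square_integrable g'"
    and eq: "\<And>a b. sqnorm (\<lambda>x. a * f x + b * g x) = sqnorm (\<lambda>x. a * f' x + b * g' x)"
  shows "inner_product f g = inner_product f' g'"
proof -
  have re: "Re (cnj b * inner_product f g) = Re (cnj b * inner_product f' g')" for b
  proof -
    have "sqnorm f = sqnorm f'" "sqnorm (\<lambda>x. b * g x) = sqnorm (\<lambda>x. b * g' x)"
      "sqnorm (\<lambda>x. f x + b * g x) = sqnorm (\<lambda>x. f' x + b * g' x)"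
      using eq[of 1 0] eq[of 0 b] eq[of 1 b] by simp_all
    then show ?thesis
      using enn2real_sqnorm_add[OF f(1) square_integrable_cmult[OF f(2), of b]]
        enn2real_sqnorm_add[OF f'(1) square_integrable_cmult[OF f'(2), of b]]
      by (simp add: inner_product_cmult_right)
  qed
  show ?thesis
    using re[of 1] re[of \<i>] by (intro complex_eqI) auto
qed

lemma integrable_bounded_support:
  assumes f: "square_integrable f" and [measurable]: "A \<in> sets borel" "emeasure lborel A < \<infinity>"
  shows "integrable lborel (\<lambda>x. indicator A x * f x)"
proof -
  have "integrable lborel (\<lambda>x. f x * cnj (indicator A x))"
    using f by (intro integrable_mult_cnj square_integrable_indicator) (use assms in auto)
  moreover have "(\<lambda>x. f x * cnj (indicator A x)) = (\<lambda>x. indicator A x * f x)"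
    by (auto simp: fun_eq_iff indicator_def)
  ultimately show ?thesis by simp
qed

lemma sqnorm_truncate_tendsto:
  assumes f: "square_integrable f"
  shows "(\<lambda>n. sqnorm (\<lambda>x. f x - indicator {- real n..real n} x * f x)) \<longlonglongrightarrow> 0"
proof (rule sqnorm_tendsto_zero_dominated[OF _ f])
  have [measurable]: "f \<in> borel_measurable borel" using f by auto
  show "(\<lambda>x. f x - indicator {- real n..real n} x * f x) \<in> borel_measurable borel" for n by measurable
  show "AE x in lborel. (\<lambda>n. f x - indicator {- real n..real n} x * f x) \<longlonglongrightarrow> 0"
  proof (rule AE_I2)
    fix x
    obtain M :: nat where M: "real M > \<bar>x\<bar>" using reals_Archimedean2 by blast
    have "eventually (\<lambda>n. f x - indicator {- real n..real n} x * f x = 0) sequentially"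
      using M by (intro eventually_mono[OF eventually_ge_at_top[of M]]) (auto simp: indicator_def)
    then show "(\<lambda>n. f x - indicator {- real n..real n} x * f x) \<longlonglongrightarrow> 0"
      by (rule tendsto_eventually)
  qed
qed (auto simp: indicator_def)

section \<open>Closed spans and an induction principle for square integrable functions\<close>

definition finite_span :: "('i \<Rightarrow> 'x \<Rightarrow> complex) \<Rightarrow> ('x \<Rightarrow> complex) \<Rightarrow> bool" where
  "finite_span b f \<longleftrightarrow> (\<exists>A c. finite A \<and> f = (\<lambda>x. \<Sum>i\<in>A. c i * b i x))"

text \<open>
  The closure of the linear span, as an approximation property: the form in which totality of a
  system is to be established.
\<close>

definition closed_span :: "('i \<Rightarrow> real \<Rightarrow> complex) \<Rightarrow> (real \<Rightarrow> complex) \<Rightarrow> bool" where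
  "closed_span b f \<longleftrightarrow> (\<forall>\<epsilon>>0. \<exists>g. finite_span b g \<and> sqnorm (\<lambda>x. f x - g x) < ennreal \<epsilon>)"

lemma finite_span_base: "finite_span b (b i)"
  unfolding finite_span_def by (intro exI[of _ "{i}"] exI[of _ "\<lambda>_. 1"]) auto

lemma finite_span_zero: "finite_span b (\<lambda>x. 0)"
  unfolding finite_span_def by (intro exI[of _ "{}"]) auto

lemma finite_span_cmult:
  assumes "finite_span b f"
  shows "finite_span b (\<lambda>x. a * f x)"
proof -
  obtain A c where "finite A" "f = (\<lambda>x. \<Sum>i\<in>A. c i * b i x)"
    using assms by (auto simp: finite_span_def)
  then show ?thesis
    unfolding finite_span_def
    by (intro exI[of _ A] exI[of _ "\<lambda>i. a * c i"]) (auto simp: sum_distrib_left mult.assoc)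
qed

lemma finite_span_add:
  assumes "finite_span b f" "finite_span b g"
  shows "finite_span b (\<lambda>x. f x + g x)"
proof -
  obtain A c where A: "finite A" "f = (\<lambda>x. \<Sum>i\<in>A. c i * b i x)"
    using assms by (auto simp: finite_span_def)
  obtain B d where B: "finite B" "g = (\<lambda>x. \<Sum>i\<in>B. d i * b i x)"
    using assms by (auto simp: finite_span_def)
  define k where "k i = (if i \<in> A then c i else 0) + (if i \<in> B then d i else 0)" for i
  have "(\<Sum>i\<in>A \<union> B. k i * b i x) = f x + g x" for x
  proof -
    have "(\<Sum>i\<in>A \<union> B. k i * b i x) = (\<Sum>i\<in>A \<union> B. (if i \<in> A then c i * b i x else 0)) +
       (\<Sum>i\<in>A \<union> B. (if i \<in> B then d i * b i x else 0))"
      unfolding sum.distrib[symmetric] by (intro sum.cong) (auto simp: k_def distrib_right)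
    also have "(\<Sum>i\<in>A \<union> B. (if i \<in> A then c i * b i x else 0)) = f x"
      using A B by (subst sum.If_cases) (auto intro!: sum.cong)
    also have "(\<Sum>i\<in>A \<union> B. (if i \<in> B then d i * b i x else 0)) = g x"
      using A B by (subst sum.If_cases) (auto intro!: sum.cong)
    finally show ?thesis .
  qed
  then show ?thesis
    unfolding finite_span_def using A B
    by (intro exI[of _ "A \<union> B"] exI[of _ k]) (simp del: sum.union_inter)
qed

lemma finite_span_sum:
  "(\<And>i. i \<in> A \<Longrightarrow> finite_span b (f i)) \<Longrightarrow> finite_span b (\<lambda>x. \<Sum>i\<in>A. f i x)"
  by (induction A rule: infinite_finite_induct) (auto intro: finite_span_add finite_span_zero)

text \<open>
  For \<open>T\<close> linear. Taking \<open>T\<close> as a parameter of the rule covers multiplication by a fixed function,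
  dilation and the inverse Fourier transform alike.
\<close>

lemma finite_span_transfer:
  assumes "finite_span b f" and "\<And>i. finite_span b' (T (b i))"
    and "\<And>A c. finite A \<Longrightarrow> T (\<lambda>x. \<Sum>i\<in>A. c i * b i x) = (\<lambda>x. \<Sum>i\<in>A. c i * T (b i) x)"
  shows "finite_span b' (T f)"
  using assms(1) unfolding finite_span_def[of b]
  by (auto simp: assms(3) intro!: finite_span_sum finite_span_cmult assms(2))

lemma finite_span_square_integrable:
  assumes "finite_span b f" "\<And>i. square_integrable (b i)"
  shows "square_integrable f"
  using assms by (auto simp: finite_span_def intro!: square_integrable_sum square_integrable_cmult)

lemma closed_spanE:
  assumes "closed_span b f" "\<epsilon> > 0"
  obtains g where "finite_span b g" "sqnorm (\<lambda>x. f x - g x) < ennreal \<epsilon>"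
  using assms unfolding closed_span_def by meson

lemma closed_span_finite_span: "finite_span b f \<Longrightarrow> closed_span b f"
  unfolding closed_span_def by (intro allI impI exI[of _ f]) auto

lemma closed_span_cong_AE:
  assumes "AE x in lborel. f x = g x" "closed_span b f"
  shows "closed_span b g"
proof -
  have "sqnorm (\<lambda>x. f x - h x) = sqnorm (\<lambda>x. g x - h x)" for h
    using assms(1) by (intro sqnorm_cong_AE) auto
  then show ?thesis using assms(2) by (simp add: closed_span_def)
qed

locale square_integrable_family =
  fixes b :: "'i \<Rightarrow> real \<Rightarrow> complex"
  assumes square_integrable_family: "square_integrable (b i)"
begin

lemma measurable_finite_span [measurable_dest]: "finite_span b f \<Longrightarrow> f \<in> borel_measurable borel"
  using finite_span_square_integrable[of b f] square_integrable_family by auto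

lemma closed_span_limit:
  assumes [measurable]: "f \<in> borel_measurable borel"
    and "\<And>\<epsilon>. \<epsilon> > 0 \<Longrightarrow> \<exists>g. g \<in> borel_measurable borel \<and> closed_span b g \<and> sqnorm (\<lambda>x. f x - g x) < ennreal \<epsilon>"
  shows "closed_span b f"
  unfolding closed_span_def
proof (intro allI impI)
  fix \<epsilon> :: real assume e: "\<epsilon> > 0"
  then obtain g where [measurable]: "g \<in> borel_measurable borel" and g: "closed_span b g"
    and fg: "sqnorm (\<lambda>x. f x - g x) < ennreal (\<epsilon> / 4)"
    using assms(2)[of "\<epsilon> / 4"] by auto
  from e obtain h where h: "finite_span b h" and gh: "sqnorm (\<lambda>x. g x - h x) < ennreal (\<epsilon> / 4)"
    using closed_spanE[OF g, of "\<epsilon> / 4"] by auto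
  have [measurable]: "h \<in> borel_measurable borel" using h by measurable
  have "sqnorm (\<lambda>x. f x - h x) = sqnorm (\<lambda>x. (f x - g x) + (g x - h x))" by simp
  also have "\<dots> \<le> 2 * sqnorm (\<lambda>x. f x - g x) + 2 * sqnorm (\<lambda>x. g x - h x)"
    by (rule sqnorm_add_le) measurable
  also have "\<dots> < 2 * ennreal (\<epsilon> / 4) + 2 * ennreal (\<epsilon> / 4)"
    using fg gh by (intro add_strict_mono ennreal_mult_strict_left_mono) auto
  also have "\<dots> = ennreal \<epsilon>"
    using e by (simp add: ennreal_plus[symmetric] ennreal_numeral[symmetric] ennreal_mult[symmetric]
      del: ennreal_plus ennreal_numeral)
  finally show "\<exists>h. finite_span b h \<and> sqnorm (\<lambda>x. f x - h x) < ennreal \<epsilon>"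
    using h by blast
qed

lemma closed_span_LIMSEQ:
  assumes [measurable]: "f \<in> borel_measurable borel" "\<And>n::nat. g n \<in> borel_measurable borel"
    and g: "\<And>n. closed_span b (g n)" and lim: "(\<lambda>n. sqnorm (\<lambda>x. f x - g n x)) \<longlonglongrightarrow> 0"
  shows "closed_span b f"
proof (rule closed_span_limit)
  fix \<epsilon> :: real assume "\<epsilon> > 0"
  then have "eventually (\<lambda>n. sqnorm (\<lambda>x. f x - g n x) < ennreal \<epsilon>) sequentially"
    using order_tendstoD(2)[OF lim, of "ennreal \<epsilon>"] by simp
  then obtain n where "sqnorm (\<lambda>x. f x - g n x) < ennreal \<epsilon>"
    by (auto dest: eventually_happens)
  then show "\<exists>g. g \<in> borel_measurable borel \<and> closed_span b g \<and> sqnorm (\<lambda>x. f x - g x) < ennreal \<epsilon>"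
    using g[of n] by (intro exI[of _ "g n"]) auto
qed simp

lemma closed_span_cmult:
  assumes [measurable]: "f \<in> borel_measurable borel" and f: "closed_span b f"
  shows "closed_span b (\<lambda>x. a * f x)"
  unfolding closed_span_def
proof (intro allI impI)
  fix \<epsilon> :: real assume e: "\<epsilon> > 0"
  \<comment> \<open>the summand \<open>1\<close> takes care of \<open>a = 0\<close>\<close>
  define d where "d = \<epsilon> / ((cmod a)\<^sup>2 + 1)"
  have d: "d > 0" "(cmod a)\<^sup>2 * d < \<epsilon>"
    using e by (auto simp: d_def field_simps add_pos_nonneg add_nonneg_pos)
  obtain g where g: "finite_span b g" and fg: "sqnorm (\<lambda>x. f x - g x) < ennreal d"
    using closed_spanE[OF f d(1)] by auto
  have [measurable]: "g \<in> borel_measurable borel" using g by measurable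
  have "sqnorm (\<lambda>x. a * f x - a * g x) = sqnorm (\<lambda>x. a * (f x - g x))"
    by (simp add: algebra_simps)
  also have "\<dots> = ennreal ((cmod a)\<^sup>2) * sqnorm (\<lambda>x. f x - g x)"
    by (rule sqnorm_cmult) measurable
  also have "\<dots> \<le> ennreal ((cmod a)\<^sup>2) * ennreal d"
    using fg by (intro mult_left_mono) auto
  also have "\<dots> < ennreal \<epsilon>"
    using d e by (simp add: ennreal_mult[symmetric] ennreal_lessI)
  finally show "\<exists>h. finite_span b h \<and> sqnorm (\<lambda>x. a * f x - h x) < ennreal \<epsilon>"
    using finite_span_cmult[OF g] by blast
qed

lemma closed_span_add:
  assumes [measurable]: "f \<in> borel_measurable borel" "g \<in> borel_measurable borel"
    and f: "closed_span b f" and g: "closed_span b g"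
  shows "closed_span b (\<lambda>x. f x + g x)"
  unfolding closed_span_def
proof (intro allI impI)
  fix \<epsilon> :: real assume e: "\<epsilon> > 0"
  obtain f' where f': "finite_span b f'" and ff: "sqnorm (\<lambda>x. f x - f' x) < ennreal (\<epsilon> / 4)"
    using closed_spanE[OF f, of "\<epsilon> / 4"] e by auto
  obtain g' where g': "finite_span b g'" and gg: "sqnorm (\<lambda>x. g x - g' x) < ennreal (\<epsilon> / 4)"
    using closed_spanE[OF g, of "\<epsilon> / 4"] e by auto
  have [measurable]: "f' \<in> borel_measurable borel" "g' \<in> borel_measurable borel"
    using f' g' by measurable
  have "sqnorm (\<lambda>x. f x + g x - (f' x + g' x)) = sqnorm (\<lambda>x. (f x - f' x) + (g x - g' x))"
    by (simp add: algebra_simps)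
  also have "\<dots> \<le> 2 * sqnorm (\<lambda>x. f x - f' x) + 2 * sqnorm (\<lambda>x. g x - g' x)"
    by (rule sqnorm_add_le) measurable
  also have "\<dots> < 2 * ennreal (\<epsilon> / 4) + 2 * ennreal (\<epsilon> / 4)"
    using ff gg by (intro add_strict_mono ennreal_mult_strict_left_mono) auto
  also have "\<dots> = ennreal \<epsilon>"
    using e by (simp add: ennreal_plus[symmetric] ennreal_numeral[symmetric] ennreal_mult[symmetric]
      del: ennreal_plus ennreal_numeral)
  finally show "\<exists>h. finite_span b h \<and> sqnorm (\<lambda>x. f x + g x - h x) < ennreal \<epsilon>"
    using finite_span_add[OF f' g'] by blast
qed

end

text \<open>
  Intervals inside one unit cell generate everything: a Dynkin argument reaches the Borel subsets of
  the cell, countable limits reach sets of finite measure, and monotone approximation by simple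
  functions reaches nonnegative functions, from which real and imaginary parts are assembled.
\<close>

lemma square_integrable_induct [consumes 1, case_names interval add cmult limit]:
  fixes P :: "(real \<Rightarrow> complex) \<Rightarrow> bool"
  assumes f: "square_integrable f"
    and interval: "\<And>n::int. \<And>a b. of_int n \<le> a \<Longrightarrow> a \<le> b \<Longrightarrow> b \<le> of_int n + 1 \<Longrightarrow> P (indicator {a..<b})"
    and add: "\<And>f g. square_integrable f \<Longrightarrow> square_integrable g \<Longrightarrow> P f \<Longrightarrow> P g \<Longrightarrow> P (\<lambda>x. f x + g x)"
    and cmult: "\<And>f c. square_integrable f \<Longrightarrow> P f \<Longrightarrow> P (\<lambda>x. c * f x)"
    and limit: "\<And>f g. square_integrable f \<Longrightarrow> (\<And>n::nat. square_integrable (g n)) \<Longrightarrow> (\<And>n. P (g n)) \<Longrightarrow>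
       (\<lambda>n. sqnorm (\<lambda>x. f x - g n x)) \<longlonglongrightarrow> 0 \<Longrightarrow> P f"
  shows "P f"
proof -
  have zero: "P (\<lambda>x. 0)"
  proof -
    have "P (indicator {0..<0::real})" using interval[of 0 0 0] by simp
    moreover have "(indicator {0..<0::real} :: real \<Rightarrow> complex) = (\<lambda>x. 0)" by (auto simp: fun_eq_iff)
    ultimately show ?thesis by simp
  qed
  have psum: "P (\<lambda>x. \<Sum>i\<in>A. g i x) \<and> square_integrable (\<lambda>x. \<Sum>i\<in>A. g i x)"
    if "finite A" "\<And>i. i \<in> A \<Longrightarrow> P (g i)" "\<And>i. i \<in> A \<Longrightarrow> square_integrable (g i)"
    for A :: "'z set" and g
    using that by (induction A rule: finite_induct) (auto intro: add zero)
  have fin: "emeasure lborel (B \<inter> {a..<b}) < \<infinity>" for B and a b :: real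
  proof -
    have "emeasure lborel (B \<inter> {a..<b}) \<le> emeasure lborel {a..<b}" by (intro emeasure_mono) auto
    also have "\<dots> < \<infinity>" by (cases "a \<le> b") auto
    finally show ?thesis .
  qed
  have unit: "P (indicator (B \<inter> {of_int n..<of_int n + 1}))" if "B \<in> sets borel" for B and n :: int
  proof -
    define I where "I = {real_of_int n..<of_int n + 1}"
    have [measurable]: "I \<in> sets borel" by (simp add: I_def)
    have "sigma_sets UNIV (range lessThan) = sets (borel :: real measure)"
      by (subst borel_Iio) simp
    then have B: "B \<in> sigma_sets UNIV (range lessThan)" using that by simp
    have stable: "Int_stable (range lessThan :: real set set)"
    proof (rule Int_stableI)
      fix a b :: "real set" assume "a \<in> range lessThan" "b \<in> range (lessThan :: real \<Rightarrow> _)"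
      then obtain x y where "a = {..<x}" "b = {..<y}" by auto
      then have "a \<inter> b = {..<min x y}" by auto
      then show "a \<inter> b \<in> range lessThan" by blast
    qed
    have "(range lessThan :: real set set) \<subseteq> Pow UNIV" by simp
    from stable this B have "P (indicator (B \<inter> I)) \<and> B \<in> sets borel"
    proof (induction rule: sigma_sets_induct_disjoint)
      case (basic A)
      then obtain x where A: "A = {..<x}" by auto
      define c where "c = max (of_int n) (min x (of_int n + 1))"
      have "A \<inter> I = {of_int n..<c}" unfolding A I_def c_def by auto
      moreover have "P (indicator {of_int n..<c})" by (rule interval[of n]) (auto simp: c_def)
      ultimately show ?case using A by simp
    next
      case empty
      then show ?case using zero by (simp add: indicator_def)
    next
      case (compl A)
      have [measurable]: "A \<in> sets borel" using compl by simp
      have 1: "P (indicator I)" unfolding I_def by (rule interval[of n]) auto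
      have "P (\<lambda>x. indicator I x + (-1) * indicator (A \<inter> I) x)"
        using compl 1 fin[of UNIV] fin
        by (intro add cmult square_integrable_cmult square_integrable_indicator) (auto simp: I_def)
      moreover have "(\<lambda>x. indicator I x + (-1) * indicator (A \<inter> I) x) = (indicator ((UNIV - A) \<inter> I) :: real \<Rightarrow> complex)"
        by (auto simp: fun_eq_iff indicator_def)
      ultimately show ?case by (auto intro: borel_comp simp: Compl_eq_Diff_UNIV[symmetric])
    next
      case (union A)
      have [measurable]: "A i \<in> sets borel" for i using union by auto
      have s: "square_integrable (indicator (A i \<inter> I))" for i
        using fin[of "A i"] by (intro square_integrable_indicator) (auto simp: I_def)
      have u: "square_integrable (indicator ((\<Union>i. A i) \<inter> I))"
        using fin by (intro square_integrable_indicator) (auto simp: I_def)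
      have eq: "(\<Sum>i<m. indicator (A i \<inter> I) x) = (indicator ((\<Union>i<m. A i) \<inter> I) x :: complex)" for m x
      proof -
        have "disjoint_family_on (\<lambda>i. A i \<inter> I) {..<m}"
          using union by (auto simp: disjoint_family_on_def)
        then show ?thesis
          by (subst indicator_UN_disjoint[symmetric]) (auto simp: indicator_def)
      qed
      have ps: "P (\<lambda>x. \<Sum>i<m. indicator (A i \<inter> I) x) \<and> square_integrable (\<lambda>x. \<Sum>i<m. indicator (A i \<inter> I) x)" for m :: nat
        using union s by (intro psum) auto
      have "P (indicator ((\<Union>i. A i) \<inter> I))"
      proof (rule limit[OF u])
        show "(\<lambda>m. sqnorm (\<lambda>x. indicator ((\<Union>i. A i) \<inter> I) x - (\<Sum>i<m. indicator (A i \<inter> I) x))) \<longlonglongrightarrow> 0"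
        proof (rule sqnorm_tendsto_zero_dominated[OF _ u])
          show "AE x in lborel. (\<lambda>m. indicator ((\<Union>i. A i) \<inter> I) x - (\<Sum>i<m. indicator (A i \<inter> I) x)) \<longlonglongrightarrow> (0 :: complex)"
          proof (rule AE_I2)
            fix x
            have "eventually (\<lambda>m. indicator ((\<Union>i. A i) \<inter> I) x - (\<Sum>i<m. indicator (A i \<inter> I) x) = (0 :: complex)) sequentially"
            proof (cases "x \<in> (\<Union>i. A i) \<inter> I")
              case True
              then obtain i where "x \<in> A i" "x \<in> I" by auto
              then show ?thesis unfolding eq
                by (intro eventually_mono[OF eventually_gt_at_top[of i]]) (auto simp: indicator_def)
            qed (auto simp: eq indicator_def)
            then show "(\<lambda>m. indicator ((\<Union>i. A i) \<inter> I) x - (\<Sum>i<m. indicator (A i \<inter> I) x)) \<longlonglongrightarrow> (0 :: complex)"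
              by (rule tendsto_eventually)
          qed
        qed (unfold eq, auto simp: indicator_def)
      qed (use ps in auto)
      then show ?case by auto
    qed
    then show ?thesis by (simp add: I_def)
  qed
  have bset: "P (indicator B)" if B[measurable]: "B \<in> sets borel" and Bf: "emeasure lborel B < \<infinity>" for B
  proof (rule limit)
    have u: "square_integrable (indicator B)" using that by (rule square_integrable_indicator)
    then show "square_integrable (indicator B)" .
    let ?g = "\<lambda>N::nat. \<lambda>x. \<Sum>n\<in>{- int N..<int N}. indicator (B \<inter> {of_int n..<of_int n + 1}) x"
    have g: "P (?g N) \<and> square_integrable (?g N)" for N
      using fin by (intro psum unit square_integrable_indicator) auto
    then show "P (?g N)" "square_integrable (?g N)" for N by auto
    have eq: "?g N x = (indicator (B \<inter> {- real N..<real N}) x :: complex)" for N x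
    proof -
      have "?g N x = (\<Sum>n\<in>{- int N..<int N}. if n = \<lfloor>x\<rfloor> then indicator B x else (0 :: complex))"
      proof (intro sum.cong refl)
        fix n :: int
        have "x \<in> {of_int n..<of_int n + 1} \<longleftrightarrow> n = \<lfloor>x\<rfloor>"
          by (simp add: eq_commute[of n] floor_eq_iff)
        then show "indicator (B \<inter> {of_int n..<of_int n + 1}) x = (if n = \<lfloor>x\<rfloor> then indicator B x else 0 :: complex)"
          by (simp add: indicator_def)
      qed
      also have "\<dots> = indicator (B \<inter> {- real N..<real N}) x"
        by (auto simp: indicator_def le_floor_iff floor_less_iff)
      finally show ?thesis .
    qed
    show "(\<lambda>N. sqnorm (\<lambda>x. indicator B x - ?g N x)) \<longlonglongrightarrow> 0"
      unfolding eq
    proof (rule sqnorm_tendsto_zero_dominated[OF _ u])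
      show "AE x in lborel. (\<lambda>N. indicator B x - indicator (B \<inter> {- real N..<real N}) x) \<longlonglongrightarrow> (0 :: complex)"
      proof (rule AE_I2)
        fix x :: real
        obtain M :: nat where M: "real M > \<bar>x\<bar>" using reals_Archimedean2 by blast
        have "eventually (\<lambda>N. indicator B x - indicator (B \<inter> {- real N..<real N}) x = (0 :: complex)) sequentially"
          using M by (intro eventually_mono[OF eventually_ge_at_top[of M]]) (auto simp: indicator_def)
        then show "(\<lambda>N. indicator B x - indicator (B \<inter> {- real N..<real N}) x) \<longlonglongrightarrow> (0 :: complex)"
          by (rule tendsto_eventually)
      qed
    qed (auto simp: indicator_def)
  qed
  have nonneg: "sqnorm (\<lambda>x. complex_of_real (u x)) < \<infinity> \<longrightarrow> P (\<lambda>x. complex_of_real (u x))"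
    if "u \<in> borel_measurable borel" "\<And>x. 0 \<le> u x" for u :: "real \<Rightarrow> real"
    using that
  proof (induction rule: borel_measurable_induct_real)
    case (set A)
    have "(\<lambda>x. complex_of_real (indicator A x)) = indicator A" by (auto simp: indicator_def fun_eq_iff)
    then show ?case using bset[OF set] set by (auto simp: sqnorm_indicator)
  next
    case (mult u c)
    have [measurable]: "u \<in> borel_measurable borel" using mult by simp
    show ?case
    proof (cases "c = 0")
      case False
      show ?thesis
      proof
        assume "sqnorm (\<lambda>x. complex_of_real (c * u x)) < \<infinity>"
        then have "square_integrable (\<lambda>x. complex_of_real (c * u x))"
          by (simp add: square_integrable_def)
        then have "square_integrable (\<lambda>x. (1 / c) * complex_of_real (c * u x))"
          by (rule square_integrable_cmult)
        then have s: "square_integrable (\<lambda>x. complex_of_real (u x))"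
          using False by simp
        then have "P (\<lambda>x. complex_of_real (u x))"
          using mult by (simp add: square_integrable_def)
        then show "P (\<lambda>x. complex_of_real (c * u x))"
          using cmult[OF s, of c] by simp
      qed
    qed (use zero in simp)
  next
    case (add u v)
    have [measurable]: "u \<in> borel_measurable borel" "v \<in> borel_measurable borel" using add by simp_all
    show ?case
    proof
      assume "sqnorm (\<lambda>x. complex_of_real (v x + u x)) < \<infinity>"
      then have s: "square_integrable (\<lambda>x. complex_of_real (v x + u x))"
        by (simp add: square_integrable_def)
      have "cmod (complex_of_real (u x)) \<le> cmod (complex_of_real (v x + u x))"
        "cmod (complex_of_real (v x)) \<le> cmod (complex_of_real (v x + u x))" for x
      proof -
        have "0 \<le> u x" "0 \<le> v x" using add by auto
        then show "cmod (complex_of_real (u x)) \<le> cmod (complex_of_real (v x + u x))"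
          "cmod (complex_of_real (v x)) \<le> cmod (complex_of_real (v x + u x))"
          unfolding norm_of_real by simp_all
      qed
      then have su: "square_integrable (\<lambda>x. complex_of_real (u x))"
        and sv: "square_integrable (\<lambda>x. complex_of_real (v x))"
        by (intro square_integrable_dominated[OF s]; simp)+
      show "P (\<lambda>x. complex_of_real (v x + u x))"
        using assms(3)[OF sv su] add su sv by (simp add: square_integrable_def)
    qed
  next
    case (seq U)
    have [measurable]: "U i \<in> borel_measurable borel" for i using seq by simp
    have [measurable]: "u \<in> borel_measurable borel" by (rule that(1))
    show ?case
    proof
      assume "sqnorm (\<lambda>x. complex_of_real (u x)) < \<infinity>"
      then have s: "square_integrable (\<lambda>x. complex_of_real (u x))"
        by (simp add: square_integrable_def)
      have le: "U i x \<le> u x" for i x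
        using seq by (intro incseq_le[of "\<lambda>i. U i x"]) (auto simp: incseq_def le_fun_def)
      have sU: "square_integrable (\<lambda>x. complex_of_real (U i x))" for i
        using le[of i] seq(2)[of i] that(2) by (intro square_integrable_dominated[OF s]) auto
      show "P (\<lambda>x. complex_of_real (u x))"
      proof (rule limit[OF s sU])
        show "P (\<lambda>x. complex_of_real (U n x))" for n
          using seq sU[of n] by (simp add: square_integrable_def)
        show "(\<lambda>n. sqnorm (\<lambda>x. complex_of_real (u x) - complex_of_real (U n x))) \<longlonglongrightarrow> 0"
        proof (rule sqnorm_tendsto_zero_dominated[OF _ s])
          show "cmod (complex_of_real (u x) - complex_of_real (U n x)) \<le> cmod (complex_of_real (u x))" for n x
            using le[of n x] seq(2)[of n x] unfolding of_real_diff[symmetric] norm_of_real by simp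
          show "AE x in lborel. (\<lambda>n. complex_of_real (u x) - complex_of_real (U n x)) \<longlonglongrightarrow> 0"
          proof (rule AE_I2)
            fix x
            have "(\<lambda>n. U n x) \<longlonglongrightarrow> u x" using seq by simp
            then have "(\<lambda>n. complex_of_real (u x) - complex_of_real (U n x)) \<longlonglongrightarrow>
                complex_of_real (u x) - complex_of_real (u x)"
              by (intro tendsto_diff tendsto_const tendsto_of_real)
            then show "(\<lambda>n. complex_of_real (u x) - complex_of_real (U n x)) \<longlonglongrightarrow> 0" by simp
          qed
        qed measurable
      qed
    qed
  qed
  have [measurable]: "f \<in> borel_measurable borel" using f by auto
  have part: "P (\<lambda>x. complex_of_real (max 0 (u x)))" "square_integrable (\<lambda>x. complex_of_real (max 0 (u x)))"
    if [measurable]: "u \<in> borel_measurable borel" and u: "\<And>x. \<bar>u x\<bar> \<le> cmod (f x)" for u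
  proof -
    show *: "square_integrable (\<lambda>x. complex_of_real (max 0 (u x)))"
    proof (rule square_integrable_dominated[OF f])
      show "cmod (complex_of_real (max 0 (u x))) \<le> cmod (f x)" for x
        using u[of x] by (auto simp: norm_of_real max_def)
    qed measurable
    show "P (\<lambda>x. complex_of_real (max 0 (u x)))"
      using nonneg[of "\<lambda>x. max 0 (u x)"] * by (simp add: square_integrable_def)
  qed
  have real: "P (\<lambda>x. complex_of_real (u x)) \<and> square_integrable (\<lambda>x. complex_of_real (u x))"
    if [measurable]: "u \<in> borel_measurable borel" and u: "\<And>x. \<bar>u x\<bar> \<le> cmod (f x)" for u
  proof -
    have *: "(\<lambda>x. complex_of_real (max 0 (u x)) + (-1) * complex_of_real (max 0 (- u x))) = (\<lambda>x. complex_of_real (u x))"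
      by (auto simp: fun_eq_iff max_def)
    have "\<bar>- u x\<bar> \<le> cmod (f x)" for x using u[of x] by simp
    then have m: "P (\<lambda>x. complex_of_real (max 0 (- u x)))"
      "square_integrable (\<lambda>x. complex_of_real (max 0 (- u x)))"
      using part[of "\<lambda>x. - u x"] by simp_all
    note p = part[OF that]
    have "P (\<lambda>x. complex_of_real (max 0 (u x)) + (-1) * complex_of_real (max 0 (- u x)))"
      using p m by (intro add cmult square_integrable_cmult)
    moreover have "square_integrable (\<lambda>x. complex_of_real (max 0 (u x)) + (-1) * complex_of_real (max 0 (- u x)))"
      using p m by (intro square_integrable_add square_integrable_cmult)
    ultimately show ?thesis unfolding * by simp
  qed
  have "P (\<lambda>x. complex_of_real (Re (f x)) + \<i> * complex_of_real (Im (f x)))"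
    using real[of "\<lambda>x. Re (f x)"] real[of "\<lambda>x. Im (f x)"] abs_Re_le_cmod abs_Im_le_cmod
    by (intro add cmult square_integrable_cmult) auto
  moreover have "(\<lambda>x. complex_of_real (Re (f x)) + \<i> * complex_of_real (Im (f x))) = f"
    by (auto simp: fun_eq_iff complex_eq_iff)
  ultimately show ?thesis by simp
qed

lemma (in square_integrable_family) closed_span_sum:
  assumes "\<And>i. i \<in> A \<Longrightarrow> f i \<in> borel_measurable borel" "\<And>i. i \<in> A \<Longrightarrow> closed_span b (f i)"
  shows "closed_span b (\<lambda>x. \<Sum>i\<in>A. f i x)"
  using assms
proof (induction A rule: infinite_finite_induct)
  case (insert i A)
  have "closed_span b (\<lambda>x. f i x + (\<Sum>i\<in>A. f i x))"
    using insert.prems insert.IH by (intro closed_span_add borel_measurable_sum) auto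
  then show ?case using insert.hyps by simp
qed (simp_all add: closed_span_finite_span finite_span_zero)

lemma (in square_integrable_family) closed_span_restrict:
  assumes f: "square_integrable f" and S [measurable]: "S \<in> sets borel"
    and interval: "\<And>n::int. \<And>a c. of_int n \<le> a \<Longrightarrow> a \<le> c \<Longrightarrow> c \<le> of_int n + 1 \<Longrightarrow>
      closed_span b (\<lambda>x. indicator S x * indicator {a..<c} x)"
  shows "closed_span b (\<lambda>x. indicator S x * f x)"
  using f
proof (induction rule: square_integrable_induct)
  case (add f g)
  have [measurable]: "f \<in> borel_measurable borel" "g \<in> borel_measurable borel"
    using add by auto
  show ?case
    unfolding distrib_left using add by (intro closed_span_add) auto
next
  case (cmult f c)
  have [measurable]: "f \<in> borel_measurable borel" using cmult by auto
  show ?case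
    unfolding mult.left_commute[of _ c] using cmult by (intro closed_span_cmult) auto
next
  case (limit f g)
  have [measurable]: "f \<in> borel_measurable borel" "g n \<in> borel_measurable borel" for n
    using limit by auto
  have lim: "(\<lambda>n. sqnorm (\<lambda>x. f x - g n x)) \<longlonglongrightarrow> 0"
    and g: "\<And>n. closed_span b (\<lambda>x. indicator S x * g n x)"
    by fact+
  show ?case
  proof (rule closed_span_LIMSEQ[OF _ _ g])
    show "(\<lambda>n. sqnorm (\<lambda>x. indicator S x * f x - indicator S x * g n x)) \<longlonglongrightarrow> 0"
    proof (rule tendsto_sandwich[OF _ _ tendsto_const lim])
      show "\<forall>\<^sub>F n in sequentially. sqnorm (\<lambda>x. indicator S x * f x - indicator S x * g n x)
          \<le> sqnorm (\<lambda>x. f x - g n x)"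
        by (intro always_eventually allI sqnorm_mono) (simp add: indicator_def)
    qed simp
  qed measurable
qed (rule interval)

section \<open>Trigonometric polynomials are dense on the unit interval\<close>

definition unit_exp :: "real \<Rightarrow> complex" where
  "unit_exp t = cis (2 * pi * t)"

lemma unit_exp_add: "unit_exp (s + t) = unit_exp s * unit_exp t"
  by (simp add: unit_exp_def cis_mult algebra_simps)

lemma norm_unit_exp [simp]: "cmod (unit_exp t) = 1"
  by (simp add: unit_exp_def)

lemma cnj_unit_exp: "cnj (unit_exp t) = unit_exp (- t)"
  by (simp add: unit_exp_def cis_cnj)

lemma unit_exp_of_int [simp]: "unit_exp (of_int n) = 1"
  by (simp add: unit_exp_def)

lemma unit_exp_0 [simp]: "unit_exp 0 = 1"
  by (simp add: unit_exp_def)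

lemma continuous_on_unit_exp [continuous_intros]:
  "continuous_on A f \<Longrightarrow> continuous_on A (\<lambda>x. unit_exp (f x))"
  unfolding unit_exp_def by (intro continuous_intros)

lemma unit_exp_measurable [measurable]: "unit_exp \<in> borel_measurable borel"
  by (intro borel_measurable_continuous_onI continuous_intros)

lemma unit_exp_eq_iff: "unit_exp s = unit_exp t \<longleftrightarrow> (\<exists>n::int. s = t + of_int n)"
proof -
  have "unit_exp s = unit_exp t \<longleftrightarrow> (\<exists>n::int. \<i> * complex_of_real (2 * pi * s) = \<i> * complex_of_real (2 * pi * t) + of_int (2 * n) * pi * \<i>)"
    unfolding unit_exp_def cis_conv_exp exp_eq by simp
  also have "\<dots> \<longleftrightarrow> (\<exists>n::int. s = t + of_int n)"
  proof (intro ex_cong1)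
    fix n :: int
    have "\<i> * complex_of_real (2 * pi * s) = \<i> * complex_of_real (2 * pi * t) + of_int (2 * n) * pi * \<i> \<longleftrightarrow>
      \<i> * complex_of_real (2 * pi * s) = \<i> * complex_of_real (2 * pi * (t + of_int n))"
      by (simp add: algebra_simps)
    also have "\<dots> \<longleftrightarrow> s = t + of_int n"
      unfolding mult_cancel_left of_real_eq_iff by simp
    finally show "\<i> * complex_of_real (2 * pi * s) = \<i> * complex_of_real (2 * pi * t) + of_int (2 * n) * pi * \<i> \<longleftrightarrow>
      s = t + of_int n" .
  qed
  finally show ?thesis .
qed

definition harmonic :: "int \<Rightarrow> real \<Rightarrow> complex" where
  "harmonic k x = unit_exp (of_int k * x)"

lemma harmonic_measurable [measurable]: "harmonic k \<in> borel_measurable borel"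
  unfolding harmonic_def by measurable

lemma harmonic_periodic: "harmonic k (x + of_int n) = harmonic k x"
  using unit_exp_of_int[of "k * n"] by (simp add: harmonic_def unit_exp_add distrib_left del: unit_exp_of_int)

lemma norm_harmonic [simp]: "cmod (harmonic k x) = 1"
  by (simp add: harmonic_def)

lemma harmonic_mult: "harmonic j x * harmonic k x = harmonic (j + k) x"
  by (simp add: harmonic_def unit_exp_add distrib_right)

lemma harmonic_cnj: "cnj (harmonic k x) = harmonic (- k) x"
  by (simp add: harmonic_def cnj_unit_exp)

lemma finite_span_harmonic_mult:
  assumes f: "finite_span harmonic f" and g: "finite_span harmonic g"
  shows "finite_span harmonic (\<lambda>x. f x * g x)"
proof -
  have 1: "finite_span harmonic (\<lambda>x. harmonic j x * g x)" for j
  proof (rule finite_span_transfer[OF g, where T="\<lambda>h x. harmonic j x * h x"])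
    show "finite_span harmonic (\<lambda>x. harmonic j x * harmonic i x)" for i
      unfolding harmonic_mult by (rule finite_span_base)
  qed (auto simp: sum_distrib_left mult_ac)
  show ?thesis
    by (rule finite_span_transfer[OF f, where T="\<lambda>h x. h x * g x"])
      (auto simp: sum_distrib_left mult_ac intro: 1[unfolded mult.commute[of _ "g _"]])
qed

lemma finite_span_harmonic_const: "finite_span harmonic (\<lambda>x. c)"
proof -
  have "finite_span harmonic (\<lambda>x. c * harmonic 0 x)" by (intro finite_span_cmult finite_span_base)
  then show ?thesis by (simp add: harmonic_def)
qed

text \<open>
  The real and imaginary parts of \<open>exp (2 \<pi> i x)\<close> are combinations of the frequencies \<open>1\<close> and \<open>-1\<close>,
  and trigonometric polynomials are closed under products.
\<close>

lemma finite_span_harmonic_polynomial: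
  assumes "real_polynomial_function g"
  shows "finite_span harmonic (\<lambda>x. complex_of_real (g (unit_exp x)))"
  using assms
proof (induction rule: real_polynomial_function.induct)
  case (linear f)
  have re_im: "f z = Re z * f 1 + Im z * f \<i>" for z
  proof -
    have "z = Re z *\<^sub>R 1 + Im z *\<^sub>R \<i>" by (simp add: complex_eq_iff)
    then have "f z = f (Re z *\<^sub>R 1 + Im z *\<^sub>R \<i>)" by (rule arg_cong)
    also have "\<dots> = Re z * f 1 + Im z * f \<i>"
      using linear by (simp add: linear_simps)
    finally show ?thesis .
  qed
  have "complex_of_real (f (unit_exp x)) =
     ((f 1 - \<i> * f \<i>) / 2) * harmonic 1 x + ((f 1 + \<i> * f \<i>) / 2) * harmonic (-1) x" for x
    unfolding re_im[of "unit_exp x"]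
    by (simp add: complex_eq_iff harmonic_def unit_exp_def field_simps)
  then show ?case
    by (simp only:) (intro finite_span_add finite_span_cmult finite_span_base)
next
  case (mult f g)
  then show ?case unfolding of_real_mult by (intro finite_span_harmonic_mult)
next
  case (add f g)
  then show ?case unfolding of_real_add by (intro finite_span_add)
qed (rule finite_span_harmonic_const)

text \<open>
  The Fourier basis of the unit interval, extended by \<open>0\<close> so that all norms are norms over the line.
\<close>

definition unit_harmonic :: "int \<Rightarrow> real \<Rightarrow> complex" where
  "unit_harmonic k x = indicator {0..<1} x * harmonic k x"

lemma finite_span_unit_harmonic:
  assumes "finite_span harmonic p"
  shows "finite_span unit_harmonic (\<lambda>x. indicator {0..<1} x * p x)"
proof (rule finite_span_transfer[OF assms, where T="\<lambda>p x. indicator {0..<1} x * p x"])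
  show "finite_span unit_harmonic (\<lambda>x. indicator {0..<1} x * harmonic i x)" for i
    using finite_span_base[of unit_harmonic i] by (simp add: unit_harmonic_def[abs_def])
qed (auto simp: sum_distrib_left mult_ac)

lemma square_integrable_bounded_unit:
  assumes [measurable]: "f \<in> borel_measurable borel" and "\<And>x. cmod (f x) \<le> C"
  shows "square_integrable (\<lambda>x. indicator {0..<1} x * f x)"
proof (rule square_integrable_dominated)
  show "square_integrable (\<lambda>x. complex_of_real C * indicator {0..<1::real} x)"
    by (intro square_integrable_cmult square_integrable_indicator) auto
  have "0 \<le> C" using assms(2)[of 0] norm_ge_zero order_trans by blast
  then show "cmod (indicator {0..<1} x * f x) \<le> cmod (complex_of_real C * indicator {0..<1} x)" for x
    using assms(2)[of x] by (auto simp: indicator_def)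
qed measurable

lemma square_integrable_unit_harmonic: "square_integrable (unit_harmonic k)"
  unfolding unit_harmonic_def[abs_def] by (rule square_integrable_bounded_unit[of _ 1]) auto

interpretation unit_harmonic: square_integrable_family unit_harmonic
  by unfold_locales (rule square_integrable_unit_harmonic)

lemma closed_span_unit_continuous:
  fixes \<phi> :: "complex \<Rightarrow> real"
  assumes \<phi>: "continuous_on (sphere 0 1) \<phi>"
  shows "closed_span unit_harmonic (\<lambda>x. indicator {0..<1} x * complex_of_real (\<phi> (unit_exp x)))"
  unfolding closed_span_def
proof (intro allI impI)
  fix \<epsilon> :: real assume e: "\<epsilon> > 0"
  obtain g where g: "real_polynomial_function g" and
    appr: "\<And>z. z \<in> sphere 0 1 \<Longrightarrow> \<bar>\<phi> z - g z\<bar> < sqrt (\<epsilon> / 2)"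
    using Stone_Weierstrass_real_polynomial_function[OF compact_sphere \<phi>, of "sqrt (\<epsilon> / 2)"] e by auto
  let ?h = "\<lambda>x. indicator {0..<1} x * complex_of_real (g (unit_exp x))"
  have "sqnorm (\<lambda>x. indicator {0..<1} x * complex_of_real (\<phi> (unit_exp x)) - ?h x)
      \<le> (\<integral>\<^sup>+x. ennreal (\<epsilon> / 2) * indicator {0..<1} x \<partial>(lborel :: real measure))"
    unfolding sqnorm_def
  proof (intro nn_integral_mono)
    fix x :: real
    have "\<bar>\<phi> (unit_exp x) - g (unit_exp x)\<bar>\<^sup>2 \<le> (sqrt (\<epsilon> / 2))\<^sup>2"
      using appr[of "unit_exp x"] by (intro power_mono) auto
    then have *: "(cmod (complex_of_real (\<phi> (unit_exp x)) - complex_of_real (g (unit_exp x))))\<^sup>2 \<le> \<epsilon> / 2"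
      using e unfolding of_real_diff[symmetric] norm_of_real by simp
    show "ennreal ((cmod (indicator {0..<1} x * complex_of_real (\<phi> (unit_exp x)) - ?h x))\<^sup>2)
        \<le> ennreal (\<epsilon> / 2) * indicator {0..<1} x"
      using ennreal_leI[OF *] by (cases "x \<in> {0..<1}") simp_all
  qed
  also have "\<dots> = ennreal (\<epsilon> / 2)" by (subst nn_integral_cmult_indicator) auto
  also have "\<dots> < ennreal \<epsilon>" using e by (simp add: ennreal_lessI)
  finally show "\<exists>h. finite_span unit_harmonic h \<and>
      sqnorm (\<lambda>x. indicator {0..<1} x * complex_of_real (\<phi> (unit_exp x)) - h x) < ennreal \<epsilon>"
    using finite_span_unit_harmonic[OF finite_span_harmonic_polynomial[OF g]] by blast
qed

text \<open>
  The arc \<open>A\<close> over the interval is a closed subset of the circle, so the continuous functions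
  \<open>max 0 (1 - n d(z, A))\<close> decrease to its indicator function. Working on the circle builds in
  periodicity; the hypothesis \<open>b < 1\<close> keeps the end points \<open>0\<close> and \<open>1\<close>, which the circle identifies,
  from interfering.
\<close>

lemma closed_span_unit_Icc:
  assumes ab: "0 \<le> a" "a \<le> b" "b < 1"
  shows "closed_span unit_harmonic (indicator {a..b})"
proof -
  define A where "A = unit_exp ` {a..b}"
  have "continuous_on {a..b} unit_exp"
    by (rule continuous_on_unit_exp[OF continuous_on_id])
  then have "closed A"
    unfolding A_def by (intro compact_imp_closed compact_continuous_image compact_Icc)
  moreover have "A \<noteq> {}" using ab by (simp add: A_def)
  ultimately have A: "closed A" "A \<noteq> {}" by blast+
  have A_iff: "unit_exp x \<in> A \<longleftrightarrow> x \<in> {a..b}" if "0 \<le> x" "x < 1" for x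
  proof
    assume "unit_exp x \<in> A"
    then obtain y n where y: "y \<in> {a..b}" "x = y + of_int n"
      by (auto simp: A_def unit_exp_eq_iff)
    then have "real_of_int n < 1" "real_of_int n > -1"
      using that ab by auto
    then have "n = 0" by linarith
    then show "x \<in> {a..b}" using y by simp
  qed (auto simp: A_def)
  define \<phi> :: "nat \<Rightarrow> complex \<Rightarrow> real" where "\<phi> n z = max 0 (1 - real n * infdist z A)" for n z
  have cont: "continuous_on S (\<phi> n)" for n S
    unfolding \<phi>_def by (intro continuous_intros)
  have [measurable]: "\<phi> n \<in> borel_measurable borel" for n
    by (rule borel_measurable_continuous_onI[OF cont])
  have \<phi>_bounds: "0 \<le> \<phi> n z" "\<phi> n z \<le> 1" for n z
    by (auto simp: \<phi>_def infdist_nonneg)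
  have lim: "(\<lambda>n. \<phi> n z) \<longlonglongrightarrow> indicator A z" for z
  proof (cases "z \<in> A")
    case False
    then have d: "infdist z A > 0" using infdist_pos_not_in_closed[OF A] by simp
    obtain N :: nat where N: "1 / infdist z A < real N" using reals_Archimedean2 by blast
    have "\<phi> n z = 0" if "n \<ge> N" for n
    proof -
      have "1 < real N * infdist z A" using N d by (simp add: field_simps)
      also have "\<dots> \<le> real n * infdist z A" using that d by (intro mult_right_mono) auto
      finally show ?thesis by (simp add: \<phi>_def)
    qed
    then have "eventually (\<lambda>n. \<phi> n z = indicator A z) sequentially"
      using False by (auto simp: eventually_sequentially)
    then show ?thesis by (rule tendsto_eventually)
  qed (simp add: \<phi>_def)
  show ?thesis
  proof (rule unit_harmonic.closed_span_LIMSEQ)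
    show "closed_span unit_harmonic (\<lambda>x. indicator {0..<1} x * complex_of_real (\<phi> n (unit_exp x)))" for n
      by (rule closed_span_unit_continuous[OF cont])
    show "(\<lambda>n. sqnorm (\<lambda>x. indicator {a..b} x - indicator {0..<1} x * complex_of_real (\<phi> n (unit_exp x)))) \<longlonglongrightarrow> 0"
    proof (rule sqnorm_tendsto_zero_dominated)
      show "square_integrable (indicator {0..<1})" by (rule square_integrable_indicator) auto
      show "cmod (indicator {a..b} x - indicator {0..<1} x * complex_of_real (\<phi> n (unit_exp x))) \<le> cmod (indicator {0..<1} x)" for n x
      proof (cases "x \<in> {0..<1}")
        case True
        have "complex_of_real 1 - complex_of_real (\<phi> n (unit_exp x)) = complex_of_real (1 - \<phi> n (unit_exp x))" by simp
        then have "cmod (1 - complex_of_real (\<phi> n (unit_exp x))) = \<bar>1 - \<phi> n (unit_exp x)\<bar>"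
          by (metis norm_of_real of_real_1)
        then show ?thesis
          using True \<phi>_bounds[of n "unit_exp x"] by (auto simp: indicator_def)
      qed (use ab in \<open>auto simp: indicator_def\<close>)
      show "AE x in lborel. (\<lambda>n. indicator {a..b} x - indicator {0..<1} x * complex_of_real (\<phi> n (unit_exp x))) \<longlonglongrightarrow> 0"
      proof (rule AE_I2)
        fix x
        have "(\<lambda>n. indicator {a..b} x - indicator {0..<1} x * complex_of_real (\<phi> n (unit_exp x)))
           \<longlonglongrightarrow> indicator {a..b} x - indicator {0..<1} x * complex_of_real (indicator A (unit_exp x))"
          by (intro tendsto_intros lim)
        moreover have "indicator {a..b} x - indicator {0..<1} x * complex_of_real (indicator A (unit_exp x)) = 0"
          using A_iff[of x] ab by (auto simp: indicator_def)
        ultimately show "(\<lambda>n. indicator {a..b} x - indicator {0..<1} x * complex_of_real (\<phi> n (unit_exp x))) \<longlonglongrightarrow> 0"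
          by simp
      qed
    qed measurable
  qed measurable
qed

text \<open>
  Half open intervals are limits of closed ones, and by the induction principle these suffice.
  Cells other than \<open>[0, 1)\<close> contribute nothing.
\<close>

theorem closed_span_unit_harmonic:
  assumes "square_integrable f"
  shows "closed_span unit_harmonic (\<lambda>x. indicator {0..<1} x * f x)"
proof (rule unit_harmonic.closed_span_restrict[OF assms])
  fix n :: int and a b :: real
  assume interval: "of_int n \<le> a" "a \<le> b" "b \<le> of_int n + 1"
  show "closed_span unit_harmonic (\<lambda>x. indicator {0..<1} x * indicator {a..<b} x)"
  proof (cases "n = 0 \<and> a < b")
    case True
    \<comment> \<open>closed intervals with the same left end point that increase to \<open>[a, b)\<close>\<close>
    let ?g = "\<lambda>m. indicator {a..b - (b - a) / real (Suc m)} :: real \<Rightarrow> complex"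
    have bm: "a \<le> b - (b - a) / real (Suc m)" "b - (b - a) / real (Suc m) < b" for m
    proof -
      have "(b - a) / real (Suc m) \<le> (b - a) / 1"
        using True by (intro divide_left_mono) auto
      then show "a \<le> b - (b - a) / real (Suc m)" by simp
      show "b - (b - a) / real (Suc m) < b" using True by simp
    qed
    have "closed_span unit_harmonic (indicator {a..<b})"
    proof (rule unit_harmonic.closed_span_LIMSEQ)
      have "b - (b - a) / real (Suc m) < 1" for m
        by (rule less_le_trans[OF bm(2)]) (use interval True in simp)
      then show "closed_span unit_harmonic (?g m)" for m
        using bm(1)[of m] interval True by (intro closed_span_unit_Icc) auto
      show "(\<lambda>m. sqnorm (\<lambda>x. indicator {a..<b} x - ?g m x)) \<longlonglongrightarrow> 0"
      proof (rule sqnorm_tendsto_zero_dominated)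
        show "square_integrable (indicator {a..<b})"
          using True by (intro square_integrable_indicator) auto
        show "cmod (indicator {a..<b} x - ?g m x) \<le> cmod (indicator {a..<b} x)" for m x
          using bm[of m] by (auto simp: indicator_def)
        show "AE x in lborel. (\<lambda>m. indicator {a..<b} x - ?g m x) \<longlonglongrightarrow> 0"
        proof (rule AE_I2)
          fix x
          show "(\<lambda>m. indicator {a..<b} x - ?g m x) \<longlonglongrightarrow> 0"
          proof (cases "x \<in> {a..<b}")
            case x: True
            have "(\<lambda>m. b - (b - a) * (1 / real (Suc m))) \<longlonglongrightarrow> b - (b - a) * 0"
              by (intro tendsto_intros LIMSEQ_Suc[OF lim_1_over_n])
            then have "eventually (\<lambda>m. x < b - (b - a) * (1 / real (Suc m))) sequentially"
              using x by (intro order_tendstoD) auto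
            then have "eventually (\<lambda>m. indicator {a..<b} x - ?g m x = 0) sequentially"
              by eventually_elim (use x in \<open>auto simp: indicator_def\<close>)
            then show ?thesis by (rule tendsto_eventually)
          next
            case x: False
            then have "indicator {a..<b} x - ?g m x = 0" for m
              using bm[of m] by (auto simp: indicator_def)
            then show ?thesis by simp
          qed
        qed
      qed measurable
    qed measurable
    moreover have "(\<lambda>x. indicator {0..<1} x * indicator {a..<b} x) = (indicator {a..<b} :: real \<Rightarrow> complex)"
      using interval True by (auto simp: indicator_def fun_eq_iff)
    ultimately show ?thesis by simp
  next
    case False
    have "n \<ge> 1 \<or> n \<le> - 1 \<or> a = b" using False interval by linarith
    then have "real_of_int n \<ge> 1 \<or> real_of_int n \<le> - 1 \<or> a = b" by linarith
    then have "(\<lambda>x. indicator {0..<1} x * indicator {a..<b} x) = (\<lambda>x. 0 :: complex)"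
      using interval by (auto simp: indicator_def fun_eq_iff)
    then show ?thesis by (simp add: closed_span_finite_span finite_span_zero)
  qed
qed simp

section \<open>Parseval and periodization\<close>

text \<open>
  Sums over the integers are taken as integrals against counting measure, so that they can be
  interchanged with integrals over the line.
\<close>

lemma nn_integral_count_space_int_le:
  fixes f :: "int \<Rightarrow> ennreal"
  assumes "\<And>A. finite A \<Longrightarrow> sum f A \<le> C"
  shows "(\<integral>\<^sup>+k. f k \<partial>count_space UNIV) \<le> C"
proof -
  have "(\<integral>\<^sup>+k. f k \<partial>count_space UNIV) = (\<Sum>n. f (int_decode n))"
    by (simp add: nn_integral_bij_count_space[symmetric, OF bij_int_decode] nn_integral_count_space_nat)
  also have "\<dots> \<le> C"
  proof (rule suminf_le_const)
    fix n
    have "(\<Sum>i<n. f (int_decode i)) = sum f (int_decode ` {..<n})"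
      by (subst sum.reindex) (auto intro: inj_int_decode)
    then show "(\<Sum>i<n. f (int_decode i)) \<le> C"
      using assms[of "int_decode ` {..<n}"] by simp
  qed simp
  finally show ?thesis .
qed

lemma sum_le_nn_integral_count_space:
  fixes f :: "'i \<Rightarrow> ennreal"
  assumes "finite A"
  shows "sum f A \<le> (\<integral>\<^sup>+k. f k \<partial>count_space UNIV)"
proof -
  have "sum f A = (\<integral>\<^sup>+k. f k \<partial>count_space A)"
    using assms by (simp add: nn_integral_count_space_finite)
  also have "\<dots> \<le> (\<integral>\<^sup>+k. f k \<partial>count_space UNIV)"
    by (subst nn_integral_count_space_indicator) (auto intro!: nn_integral_mono simp: indicator_def)
  finally show ?thesis .
qed

locale orthonormal_family = square_integrable_family b for b :: "'i \<Rightarrow> real \<Rightarrow> complex" +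
  assumes orthonormal: "inner_product (b i) (b j) = (if i = j then 1 else 0)"
begin

lemma inner_product_diff_left:
  assumes "square_integrable f" "square_integrable g" "square_integrable h"
  shows "inner_product (\<lambda>x. f x - g x) h = inner_product f h - inner_product g h"
  using integrable_mult_cnj[OF assms(1,3)] integrable_mult_cnj[OF assms(2,3)]
  by (simp add: inner_product_def left_diff_distrib)

lemma sqnorm_base: "sqnorm (b i) = 1"
proof -
  have "complex_of_real (LINT x|lborel. (cmod (b i x))\<^sup>2) = inner_product (b i) (b i)"
    unfolding inner_product_def integral_complex_of_real[symmetric] complex_norm_square ..
  then have "(LINT x|lborel. (cmod (b i x))\<^sup>2) = 1" by (simp add: orthonormal)
  then show ?thesis by (simp add: sqnorm_eq_integral[OF square_integrable_family])
qed

text \<open>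
  Expanding the square; induction on \<open>A\<close> removes one basis vector at a time, and orthogonality leaves
  the other coefficients unchanged.
\<close>

lemma enn2real_sqnorm_diff_combination:
  assumes "finite A" "square_integrable f"
  shows "enn2real (sqnorm (\<lambda>x. f x - (\<Sum>i\<in>A. c i * b i x))) =
    enn2real (sqnorm f) + (\<Sum>i\<in>A. (cmod (c i))\<^sup>2 - 2 * Re (cnj (c i) * inner_product f (b i)))"
  using assms
proof (induction A arbitrary: f rule: finite_induct)
  case (insert i A)
  have s: "square_integrable (\<lambda>x. c i * b i x)"
    by (intro square_integrable_cmult square_integrable_family)
  let ?f = "\<lambda>x. f x - c i * b i x"
  have f: "square_integrable ?f" using insert.prems s by (rule square_integrable_diff)
  have ip: "inner_product ?f (b k) = inner_product f (b k)" if "k \<in> A" for k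
  proof -
    have "i \<noteq> k" using insert.hyps that by auto
    then show ?thesis
      by (simp add: inner_product_diff_left[OF insert.prems s square_integrable_family]
          inner_product_cmult_left orthonormal)
  qed
  have n: "enn2real (sqnorm (\<lambda>x. c i * b i x)) = (cmod (c i))\<^sup>2"
    using square_integrable_measurable[OF square_integrable_family]
    by (subst sqnorm_cmult) (auto simp: sqnorm_base)
  have "enn2real (sqnorm (\<lambda>x. f x - (\<Sum>i\<in>insert i A. c i * b i x))) =
     enn2real (sqnorm (\<lambda>x. ?f x - (\<Sum>i\<in>A. c i * b i x)))"
    using insert.hyps by (simp add: algebra_simps)
  also have "\<dots> = enn2real (sqnorm ?f) + (\<Sum>i\<in>A. (cmod (c i))\<^sup>2 - 2 * Re (cnj (c i) * inner_product f (b i)))"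
    unfolding insert.IH[OF f] by (simp add: ip)
  also have "enn2real (sqnorm ?f) = enn2real (sqnorm f) + ((cmod (c i))\<^sup>2 - 2 * Re (cnj (c i) * inner_product f (b i)))"
    unfolding enn2real_sqnorm_diff[OF insert.prems s] n inner_product_cmult_right by simp
  finally show ?case using insert.hyps by simp
qed simp

text \<open>
  Best approximation: among all combinations over \<open>A\<close>, the one with the Fourier coefficients is the
  closest to \<open>f\<close>.
\<close>

lemma sum_coefficients_le:
  assumes A: "finite A" and f: "square_integrable f"
  shows "enn2real (sqnorm f) - (\<Sum>i\<in>A. (cmod (inner_product f (b i)))\<^sup>2) \<le>
    enn2real (sqnorm (\<lambda>x. f x - (\<Sum>i\<in>A. c i * b i x)))"
proof -
  have "- (cmod a)\<^sup>2 \<le> (cmod d)\<^sup>2 - 2 * Re (cnj d * a)" for a d :: complex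
  proof -
    have "(cmod (a - d))\<^sup>2 = (cmod a)\<^sup>2 + (cmod d)\<^sup>2 - 2 * Re (cnj d * a)"
      by (simp only: cmod_power2, simp add: power2_eq_square algebra_simps)
    then show ?thesis using zero_le_power2[of "cmod (a - d)"] by linarith
  qed
  then have "- (\<Sum>i\<in>A. (cmod (inner_product f (b i)))\<^sup>2) \<le>
      (\<Sum>i\<in>A. (cmod (c i))\<^sup>2 - 2 * Re (cnj (c i) * inner_product f (b i)))"
    unfolding sum_negf[symmetric] by (intro sum_mono)
  then show ?thesis unfolding enn2real_sqnorm_diff_combination[OF A f] by simp
qed

lemma bessel_inequality:
  assumes A: "finite A" and f: "square_integrable f"
  shows "(\<Sum>i\<in>A. (cmod (inner_product f (b i)))\<^sup>2) \<le> enn2real (sqnorm f)"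
proof -
  have eq: "(cmod a)\<^sup>2 - 2 * Re (cnj a * a) = - (cmod a)\<^sup>2" for a :: complex
    by (simp only: cmod_power2, simp add: power2_eq_square algebra_simps)
  have "enn2real (sqnorm (\<lambda>x. f x - (\<Sum>i\<in>A. inner_product f (b i) * b i x))) =
      enn2real (sqnorm f) - (\<Sum>i\<in>A. (cmod (inner_product f (b i)))\<^sup>2)"
    unfolding enn2real_sqnorm_diff_combination[OF A f] eq sum_negf by simp
  then show ?thesis
    using enn2real_nonneg[of "sqnorm (\<lambda>x. f x - (\<Sum>i\<in>A. inner_product f (b i) * b i x))"] by linarith
qed

end

text \<open>
  Approximating \<open>f\<close> by a finite combination up to \<open>\<epsilon>\<close> shows that finitely many coefficients already carry the
  norm of \<open>f\<close> up to \<open>\<epsilon>\<close>.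
\<close>

lemma (in orthonormal_family) parseval_le:
  assumes f: "square_integrable f" and span: "closed_span b f"
  shows "sqnorm f \<le> (\<integral>\<^sup>+i. ennreal ((cmod (inner_product f (b i)))\<^sup>2) \<partial>count_space UNIV)"
    (is "_ \<le> ?S")
proof (rule ennreal_le_epsilon)
  fix \<epsilon> :: real assume e: "\<epsilon> > 0"
  obtain g where "finite_span b g" and g: "sqnorm (\<lambda>x. f x - g x) < ennreal \<epsilon>"
    using closed_spanE[OF span e] by auto
  then obtain A c where A: "finite A" and "g = (\<lambda>x. \<Sum>i\<in>A. c i * b i x)"
    by (auto simp: finite_span_def)
  with g have less: "sqnorm (\<lambda>x. f x - (\<Sum>i\<in>A. c i * b i x)) < ennreal \<epsilon>"
    by simp
  have "enn2real (sqnorm (\<lambda>x. f x - (\<Sum>i\<in>A. c i * b i x))) \<le> \<epsilon>"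
    using less e by (intro enn2real_leI) auto
  then have "enn2real (sqnorm f) \<le> (\<Sum>i\<in>A. (cmod (inner_product f (b i)))\<^sup>2) + \<epsilon>"
    using sum_coefficients_le[OF A f, of c] by linarith
  then have "ennreal (enn2real (sqnorm f)) \<le> ennreal (\<Sum>i\<in>A. (cmod (inner_product f (b i)))\<^sup>2) + ennreal \<epsilon>"
    using e by (subst ennreal_plus[symmetric]) (auto intro: ennreal_leI sum_nonneg)
  also have "ennreal (\<Sum>i\<in>A. (cmod (inner_product f (b i)))\<^sup>2) \<le> ?S"
    unfolding sum_ennreal[symmetric, OF zero_le_power2] using A by (rule sum_le_nn_integral_count_space)
  finally show "sqnorm f \<le> ?S + ennreal \<epsilon>"
    using f by (simp add: square_integrable_def)
qed

lemma parseval_int: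
  fixes b :: "int \<Rightarrow> real \<Rightarrow> complex"
  assumes "orthonormal_family b" and f: "square_integrable f" and span: "closed_span b f"
  shows "(\<integral>\<^sup>+i. ennreal ((cmod (inner_product f (b i)))\<^sup>2) \<partial>count_space UNIV) = sqnorm f"
proof (rule antisym)
  interpret orthonormal_family b by fact
  show "(\<integral>\<^sup>+i. ennreal ((cmod (inner_product f (b i)))\<^sup>2) \<partial>count_space UNIV) \<le> sqnorm f"
  proof (rule nn_integral_count_space_int_le)
    fix A :: "int set" assume "finite A"
    then have "ennreal (\<Sum>i\<in>A. (cmod (inner_product f (b i)))\<^sup>2) \<le> ennreal (enn2real (sqnorm f))"
      using bessel_inequality f by (intro ennreal_leI)
    also have "ennreal (enn2real (sqnorm f)) = sqnorm f"
      using f by (simp add: square_integrable_def)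
    finally show "(\<Sum>i\<in>A. ennreal ((cmod (inner_product f (b i)))\<^sup>2)) \<le> sqnorm f"
      by (subst sum_ennreal) auto
  qed
qed (rule orthonormal_family.parseval_le[OF assms])

lemma inner_product_unit_harmonic:
  "inner_product (unit_harmonic j) (unit_harmonic k) = (if j = k then 1 else 0)"
proof -
  let ?m = "j - k"
  have "inner_product (unit_harmonic j) (unit_harmonic k) = (LINT x|lborel. indicator {0..<1} x * harmonic ?m x)"
    unfolding inner_product_def unit_harmonic_def
    by (intro Bochner_Integration.integral_cong refl)
      (simp add: indicator_def harmonic_cnj harmonic_mult)
  also have "\<dots> = (LINT x|lborel. indicator {0..1} x *\<^sub>R harmonic ?m x)"
  proof (rule integral_cong_AE)
    have "AE x in lborel. x \<noteq> (1::real)" by (rule AE_lborel_singleton)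
    then show "AE x in lborel. indicator {0..<1} x * harmonic ?m x = indicator {0..1} x *\<^sub>R harmonic ?m x"
      by eventually_elim (auto simp: indicator_def)
  qed measurable
  also have "\<dots> = (if j = k then 1 else 0)"
  proof (cases "j = k")
    case False
    define w :: complex where "w = 2 * pi * \<i> * of_int ?m"
    have w: "w \<noteq> 0" using False by (simp add: w_def)
    have h: "harmonic ?m x = exp (w * of_real x)" for x
      by (simp add: harmonic_def unit_exp_def cis_conv_exp w_def mult_ac)
    have "(LINT x|lborel. indicator {0..1} x *\<^sub>R harmonic ?m x) =
        exp (w * of_real 1) / w - exp (w * of_real 0) / w"
      unfolding h
    proof (rule integral_FTC_Icc)
      fix x :: real
      show "((\<lambda>x. exp (w * of_real x) / w) has_vector_derivative exp (w * of_real x)) (at x within {0..1})"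
        by (rule has_vector_derivative_real_field)
          (use w in \<open>auto intro!: derivative_eq_intros\<close>)
    qed (auto intro!: continuous_intros)
    also have "exp (w * of_real 1) = harmonic ?m 1" unfolding h ..
    also have "harmonic ?m 1 = 1" unfolding harmonic_def mult_1_right by (rule unit_exp_of_int)
    finally show ?thesis using False by simp
  qed (simp add: harmonic_def)
  finally show ?thesis .
qed

interpretation unit_harmonic: orthonormal_family unit_harmonic
  by unfold_locales (rule inner_product_unit_harmonic)

lemma parseval_unit:
  assumes "square_integrable f" "\<And>x. x \<notin> {0..<1} \<Longrightarrow> f x = 0"
  shows "(\<integral>\<^sup>+k. ennreal ((cmod (inner_product f (unit_harmonic k)))\<^sup>2) \<partial>count_space UNIV) = sqnorm f"
proof (rule parseval_int)
  have "(\<lambda>x. indicator {0..<1} x * f x) = f"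
    using assms(2) by (auto simp: fun_eq_iff indicator_def)
  then show "closed_span unit_harmonic f"
    using closed_span_unit_harmonic[OF assms(1)] by simp
qed (fact | rule unit_harmonic.orthonormal_family_axioms)+

text \<open>
  The line is cut into unit cells, and every cell is shifted onto \<open>[0, 1)\<close>.
\<close>

lemma nn_integral_periodize:
  fixes q :: "real \<Rightarrow> ennreal"
  assumes [measurable]: "q \<in> borel_measurable borel"
  shows "(\<integral>\<^sup>+x. q x \<partial>lborel) =
    (\<integral>\<^sup>+x. indicator {0..<1} x * (\<integral>\<^sup>+k. q (x + of_int k) \<partial>count_space UNIV) \<partial>lborel)"
proof -
  let ?I = "\<lambda>k::int. {real_of_int k..<real_of_int k + 1}"
  have "(\<integral>\<^sup>+x. q x \<partial>lborel) = (\<integral>\<^sup>+x. \<integral>\<^sup>+k. q x * indicator (?I k) x \<partial>count_space UNIV \<partial>lborel)"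
  proof (rule nn_integral_cong)
    fix x
    have "x \<in> ?I k \<longleftrightarrow> k = \<lfloor>x\<rfloor>" for k by (simp add: eq_commute[of k] floor_eq_iff)
    then have "(\<integral>\<^sup>+k. q x * indicator (?I k) x \<partial>count_space UNIV) =
        (\<integral>\<^sup>+k. q x * indicator {\<lfloor>x\<rfloor>} k \<partial>count_space UNIV)"
      by (intro nn_integral_cong) (simp add: indicator_def)
    also have "\<dots> = q x" by (subst nn_integral_cmult_indicator) auto
    finally show "q x = (\<integral>\<^sup>+k. q x * indicator (?I k) x \<partial>count_space UNIV)" ..
  qed
  also have "\<dots> = (\<integral>\<^sup>+k. \<integral>\<^sup>+x. q x * indicator (?I k) x \<partial>lborel \<partial>count_space UNIV)"
    by (rule nn_integral_count_space_nn_integral) auto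
  also have "\<dots> = (\<integral>\<^sup>+k. \<integral>\<^sup>+x. indicator {0..<1} x * q (x + of_int k) \<partial>lborel \<partial>count_space UNIV)"
  proof (rule nn_integral_cong)
    fix k :: int
    show "(\<integral>\<^sup>+x. q x * indicator (?I k) x \<partial>lborel) = (\<integral>\<^sup>+x. indicator {0..<1} x * q (x + of_int k) \<partial>lborel)"
      by (subst nn_integral_real_affine[where c=1 and t="of_int k"])
        (auto simp: add.commute indicator_def intro!: nn_integral_cong)
  qed
  also have "\<dots> = (\<integral>\<^sup>+x. \<integral>\<^sup>+k. indicator {0..<1} x * q (x + of_int k) \<partial>count_space UNIV \<partial>lborel)"
    by (rule nn_integral_count_space_nn_integral[symmetric]) auto
  also have "\<dots> = (\<integral>\<^sup>+x. indicator {0..<1} x * (\<integral>\<^sup>+k. q (x + of_int k) \<partial>count_space UNIV) \<partial>lborel)"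
    by (intro nn_integral_cong nn_integral_cmult) simp
  finally show ?thesis .
qed

section \<open>The Plancherel theorem\<close>

lemma sqnorm_affine:
  assumes [measurable]: "f \<in> borel_measurable borel" and c: "c \<noteq> 0"
  shows "sqnorm f = ennreal \<bar>c\<bar> * sqnorm (\<lambda>x. f (t + c * x))"
  unfolding sqnorm_def by (rule nn_integral_real_affine) (use c in auto)

text \<open>
  For Borel functions the Lebesgue and the Borel version of the integral agree; working with Borel
  functions makes the product measurability for Fubini's theorem automatic.
\<close>

lemma fourier_integral_eq:
  assumes [measurable]: "f \<in> borel_measurable borel"
  shows "fourier_integral f \<xi> = (LINT x|lborel. f x * unit_exp (- (x * \<xi>)))"
proof -
  have eq: "exp (- 2 * pi * \<i> * x * \<xi>) = unit_exp (- (x * \<xi>))" for x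
    by (simp add: unit_exp_def cis_conv_exp mult_ac)
  show ?thesis
    unfolding fourier_integral_def eq by (rule integral_completion) measurable
qed

lemma fourier_integral_measurable [measurable]:
  assumes [measurable]: "f \<in> borel_measurable borel"
  shows "fourier_integral f \<in> borel_measurable borel"
proof -
  have "(\<lambda>\<xi>. LINT x|lborel. f x * unit_exp (- (x * \<xi>))) \<in> borel_measurable borel"
    by measurable
  then show ?thesis
    using fourier_integral_eq[OF assms] by (simp add: fun_eq_iff cong: measurable_cong)
qed

lemma integrable_mult_unit_exp:
  assumes "integrable lborel f" and [measurable]: "g \<in> borel_measurable borel"
  shows "integrable lborel (\<lambda>x. f x * unit_exp (g x))"
proof (rule Bochner_Integration.integrable_bound[OF assms(1)])
  have [measurable]: "f \<in> borel_measurable borel" using assms(1) by auto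
  show "(\<lambda>x. f x * unit_exp (g x)) \<in> borel_measurable lborel" by measurable
qed (simp add: norm_mult)

lemma fourier_integral_add:
  assumes "integrable lborel f" "integrable lborel g"
  shows "fourier_integral (\<lambda>x. f x + g x) \<xi> = fourier_integral f \<xi> + fourier_integral g \<xi>"
proof -
  have [measurable]: "f \<in> borel_measurable borel" "g \<in> borel_measurable borel" using assms by auto
  show ?thesis
    using integrable_mult_unit_exp[OF assms(1), of "\<lambda>x. - (x * \<xi>)"]
      integrable_mult_unit_exp[OF assms(2), of "\<lambda>x. - (x * \<xi>)"]
    by (simp add: fourier_integral_eq distrib_right)
qed

lemma fourier_integral_cmult:
  assumes [measurable]: "f \<in> borel_measurable borel"
  shows "fourier_integral (\<lambda>x. c * f x) \<xi> = c * fourier_integral f \<xi>"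
  by (simp add: fourier_integral_eq mult.assoc)

lemma fourier_integral_diff:
  assumes "integrable lborel f" "integrable lborel g"
  shows "fourier_integral (\<lambda>x. f x - g x) \<xi> = fourier_integral f \<xi> - fourier_integral g \<xi>"
proof -
  have [measurable]: "g \<in> borel_measurable borel" using assms by auto
  show ?thesis
    using fourier_integral_add[OF assms(1) integrable_mult_right[of "-1", OF assms(2)]]
      fourier_integral_cmult[of g "-1"] by simp
qed

text \<open>
  The numbers \<open>fourier_integral f (t + k)\<close>, for \<open>k\<close> an integer, are the Fourier coefficients of
  \<open>f x exp (- 2 \<pi> i x t)\<close>, a function with the same norm as \<open>f\<close>. By Parseval their squares sum to this
  norm for every \<open>t\<close>, and integration over \<open>t\<close> in \<open>[0, 1)\<close> yields the norm of the transform.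
\<close>

lemma sqnorm_fourier_integral_unit:
  assumes f: "square_integrable f" and supp: "\<And>x. x \<notin> {0..<1} \<Longrightarrow> f x = 0"
  shows "sqnorm (fourier_integral f) = sqnorm f"
proof -
  have [measurable]: "f \<in> borel_measurable borel" using f by auto
  have coeff: "fourier_integral f (t + of_int k) = inner_product (\<lambda>x. f x * unit_exp (- (x * t))) (unit_harmonic k)" for t k
    unfolding fourier_integral_eq[OF \<open>f \<in> borel_measurable borel\<close>] inner_product_def
  proof (intro Bochner_Integration.integral_cong refl)
    fix x
    have "unit_exp (- (x * (t + of_int k))) = unit_exp (- (x * t)) * unit_exp (- (of_int k * x))"
      by (simp add: unit_exp_add[symmetric] algebra_simps)
    then show "f x * unit_exp (- (x * (t + of_int k))) = f x * unit_exp (- (x * t)) * cnj (unit_harmonic k x)"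
      using supp[of x] by (cases "x \<in> {0..<1}") (auto simp: unit_harmonic_def harmonic_def cnj_unit_exp)
  qed
  have "sqnorm (fourier_integral f) =
     (\<integral>\<^sup>+t. indicator {0..<1} t * (\<integral>\<^sup>+k. ennreal ((cmod (fourier_integral f (t + of_int k)))\<^sup>2) \<partial>count_space UNIV) \<partial>lborel)"
    unfolding sqnorm_def by (rule nn_integral_periodize) measurable
  also have "\<dots> = (\<integral>\<^sup>+t. indicator {0..<1} t * sqnorm f \<partial>(lborel :: real measure))"
  proof (rule nn_integral_cong)
    fix t :: real
    have s: "square_integrable (\<lambda>x. f x * unit_exp (- (x * t)))"
      by (rule square_integrable_dominated[OF f]) (auto simp: norm_mult)
    have "(\<integral>\<^sup>+k. ennreal ((cmod (fourier_integral f (t + of_int k)))\<^sup>2) \<partial>count_space UNIV) =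
        sqnorm (\<lambda>x. f x * unit_exp (- (x * t)))"
      unfolding coeff by (rule parseval_unit[OF s]) (use supp in simp)
    also have "\<dots> = sqnorm f" by (rule sqnorm_cong_norm) (simp add: norm_mult)
    finally show "indicator {0..<1} t * (\<integral>\<^sup>+k. ennreal ((cmod (fourier_integral f (t + of_int k)))\<^sup>2) \<partial>count_space UNIV) = indicator {0..<1} t * sqnorm f"
      by simp
  qed
  also have "\<dots> = sqnorm f" by (simp add: nn_integral_multc)
  finally show ?thesis .
qed

lemma fourier_integral_affine:
  assumes [measurable]: "f \<in> borel_measurable borel" and s: "s > 0"
  shows "fourier_integral (\<lambda>x. f (t + s * x)) \<xi> = of_real (1 / s) * unit_exp (t * \<xi> / s) * fourier_integral f (\<xi> / s)"
proof -
  have "fourier_integral f (\<xi> / s) = s *\<^sub>R (LINT x|lborel. f (t + s * x) * unit_exp (- ((t + s * x) * (\<xi> / s))))"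
    using s by (subst fourier_integral_eq, simp, subst lborel_integral_real_affine[where c=s and t=t]) auto
  also have "(LINT x|lborel. f (t + s * x) * unit_exp (- ((t + s * x) * (\<xi> / s)))) =
      (LINT x|lborel. unit_exp (- (t * \<xi> / s)) * (f (t + s * x) * unit_exp (- (x * \<xi>))))"
  proof (intro Bochner_Integration.integral_cong refl)
    fix x
    have "unit_exp (- ((t + s * x) * (\<xi> / s))) = unit_exp (- (t * \<xi> / s) + - (x * \<xi>))"
      using s by (intro arg_cong[where f=unit_exp]) (simp add: field_simps)
    then show "f (t + s * x) * unit_exp (- ((t + s * x) * (\<xi> / s))) =
        unit_exp (- (t * \<xi> / s)) * (f (t + s * x) * unit_exp (- (x * \<xi>)))"
      by (simp only: unit_exp_add mult_ac)
  qed
  also have "\<dots> = unit_exp (- (t * \<xi> / s)) * fourier_integral (\<lambda>x. f (t + s * x)) \<xi>"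
    by (simp add: fourier_integral_eq)
  finally have eq: "fourier_integral f (\<xi> / s) = s *\<^sub>R (unit_exp (- (t * \<xi> / s)) * fourier_integral (\<lambda>x. f (t + s * x)) \<xi>)" .
  have "unit_exp (t * \<xi> / s) * unit_exp (- (t * \<xi> / s)) = 1"
    unfolding unit_exp_add[symmetric] by simp
  then have "unit_exp (t * \<xi> / s) * (unit_exp (- (t * \<xi> / s)) * z) = z" for z
    by (simp add: mult.assoc[symmetric])
  then show ?thesis unfolding eq using s by (simp add: scaleR_conv_of_real)
qed

text \<open>
  An affine substitution moves the support into the unit interval; it multiplies the squared norms
  of a function and of its transform by the same factor.
\<close>

lemma sqnorm_fourier_integral_bounded:
  assumes f: "square_integrable f" and supp: "\<And>x. R < \<bar>x\<bar> \<Longrightarrow> f x = 0"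
  shows "sqnorm (fourier_integral f) = sqnorm f"
proof -
  have [measurable]: "f \<in> borel_measurable borel" using f by auto
  \<comment> \<open>\<open>x \<mapsto> 1/2 + s x\<close> maps \<open>[-R, R]\<close> into the open unit interval\<close>
  define s where "s = 1 / (2 * (\<bar>R\<bar> + 1))"
  have s: "s > 0" by (simp add: s_def add_nonneg_pos)
  define h where "h y = f ((y - 1 / 2) / s)" for y
  have [measurable]: "h \<in> borel_measurable borel" unfolding h_def by measurable
  have fh: "f = (\<lambda>x. h (1 / 2 + s * x))" using s by (simp add: h_def)
  have nh: "sqnorm h = ennreal s * sqnorm f"
    unfolding fh using s by (subst sqnorm_affine[where c=s and t="1/2"]) auto
  have h: "square_integrable h"
    using f by (simp add: square_integrable_def nh ennreal_mult_less_top)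
  have supp_h: "h y = 0" if "y \<notin> {0..<1}" for y
  proof -
    have "\<bar>y - 1 / 2\<bar> \<ge> 1 / 2" using that by (auto simp: abs_if)
    then have "(1 / 2) / s \<le> \<bar>y - 1 / 2\<bar> / s" using s by (intro divide_right_mono) auto
    moreover have "(1 / 2) / s = \<bar>R\<bar> + 1" by (simp add: s_def)
    ultimately have "R < \<bar>(y - 1 / 2) / s\<bar>" using s by (simp add: abs_divide)
    then show ?thesis unfolding h_def by (rule supp)
  qed
  have "fourier_integral f \<xi> = of_real (1 / s) * (unit_exp (1 / 2 * \<xi> / s) * fourier_integral h (\<xi> / s))" for \<xi>
    using fourier_integral_affine[of h s "1/2" \<xi>] s by (simp add: fh[symmetric] mult.assoc)
  then have "sqnorm (fourier_integral f) =
      sqnorm (\<lambda>\<xi>. of_real (1 / s) * (unit_exp (1 / 2 * \<xi> / s) * fourier_integral h (\<xi> / s)))"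
    by (intro sqnorm_cong_AE AE_I2) simp
  also have "\<dots> = sqnorm (\<lambda>\<xi>. of_real (1 / s) * fourier_integral h (\<xi> / s))"
    by (rule sqnorm_cong_norm) (simp add: norm_mult norm_divide)
  also have "\<dots> = ennreal ((1 / s)\<^sup>2) * sqnorm (\<lambda>\<xi>. fourier_integral h (\<xi> / s))"
    using s by (subst sqnorm_cmult) (auto simp: norm_divide)
  also have "sqnorm (\<lambda>\<xi>. fourier_integral h (\<xi> / s)) = ennreal s * sqnorm (fourier_integral h)"
    using s by (subst sqnorm_affine[where c=s and t=0]) auto
  also have "sqnorm (fourier_integral h) = ennreal s * sqnorm f"
    unfolding nh[symmetric] by (rule sqnorm_fourier_integral_unit[OF h supp_h])
  also have "ennreal ((1 / s)\<^sup>2) * (ennreal s * (ennreal s * sqnorm f)) = ennreal ((1 / s)\<^sup>2 * (s * s)) * sqnorm f"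
    using s by (simp add: ennreal_mult mult.assoc)
  also have "(1 / s)\<^sup>2 * (s * s) = 1" using s by (simp add: power2_eq_square)
  finally show ?thesis by simp
qed

text \<open>
  The transforms of the truncations of \<open>f\<close> converge pointwise because \<open>f\<close> is integrable. Applied to
  differences of truncations, the case of bounded support and Fatou's lemma upgrade this to convergence
  in norm.
\<close>

theorem plancherel:
  assumes int: "integrable lborel f" and f: "square_integrable f"
  shows "sqnorm (fourier_integral f) = sqnorm f"
proof -
  have [measurable]: "f \<in> borel_measurable borel" using f by auto
  define g where "g n x = indicator {- real n..real n} x * f x" for n :: nat and x
  have [measurable]: "g n \<in> borel_measurable borel" for n unfolding g_def by measurable
  have sq: "square_integrable (g n)" for n
    unfolding g_def using f by (intro square_integrable_indicator_mult) auto
  have ig: "integrable lborel (g n)" for n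
    by (rule Bochner_Integration.integrable_bound[OF int]) (auto simp: g_def indicator_def)
  have g_lim: "(\<lambda>n. g n x) \<longlonglongrightarrow> f x" for x
  proof -
    obtain M :: nat where M: "real M > \<bar>x\<bar>" using reals_Archimedean2 by blast
    have "eventually (\<lambda>n. g n x = f x) sequentially"
      using M by (intro eventually_mono[OF eventually_ge_at_top[of M]]) (auto simp: g_def indicator_def)
    then show ?thesis by (rule tendsto_eventually)
  qed
  have F_lim: "(\<lambda>n. fourier_integral (g n) \<xi>) \<longlonglongrightarrow> fourier_integral f \<xi>" for \<xi>
    unfolding fourier_integral_eq[OF \<open>f \<in> borel_measurable borel\<close>] fourier_integral_eq[OF \<open>g _ \<in> borel_measurable borel\<close>]
  proof (rule integral_dominated_convergence[where w="\<lambda>x. cmod (f x)"])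
    show "integrable lborel (\<lambda>x. cmod (f x))" using int by simp
    show "AE x in lborel. (\<lambda>n. g n x * unit_exp (- (x * \<xi>))) \<longlonglongrightarrow> f x * unit_exp (- (x * \<xi>))"
      by (intro AE_I2 tendsto_intros g_lim)
    show "AE x in lborel. cmod (g n x * unit_exp (- (x * \<xi>))) \<le> cmod (f x)" for n
      by (auto simp: g_def norm_mult indicator_def)
  qed measurable
  have diff0: "(\<lambda>n. sqnorm (\<lambda>x. f x - g n x)) \<longlonglongrightarrow> 0"
    unfolding g_def by (rule sqnorm_truncate_tendsto[OF f])
  have plancherel_diff: "sqnorm (\<lambda>\<xi>. fourier_integral (g m) \<xi> - fourier_integral (g n) \<xi>) \<le> sqnorm (\<lambda>x. f x - g n x)"
    if "n \<le> m" for m n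
  proof -
    have "sqnorm (\<lambda>\<xi>. fourier_integral (g m) \<xi> - fourier_integral (g n) \<xi>) = sqnorm (fourier_integral (\<lambda>x. g m x - g n x))"
      using fourier_integral_diff[OF ig ig] by (intro sqnorm_cong_norm) simp
    also have "\<dots> = sqnorm (\<lambda>x. g m x - g n x)"
    proof (rule sqnorm_fourier_integral_bounded[of _ "real m"])
      show "square_integrable (\<lambda>x. g m x - g n x)" using sq by auto
    qed (use that in \<open>auto simp: g_def indicator_def\<close>)
    also have "\<dots> \<le> sqnorm (\<lambda>x. f x - g n x)"
      using that by (intro sqnorm_mono) (auto simp: g_def indicator_def)
    finally show ?thesis .
  qed
  have F_diff: "sqnorm (\<lambda>\<xi>. fourier_integral f \<xi> - fourier_integral (g n) \<xi>) \<le> sqnorm (\<lambda>x. f x - g n x)" for n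
  proof -
    let ?u = "\<lambda>m \<xi>. ennreal ((cmod (fourier_integral (g m) \<xi> - fourier_integral (g n) \<xi>))\<^sup>2)"
    have "liminf (\<lambda>m. ?u m \<xi>) = ennreal ((cmod (fourier_integral f \<xi> - fourier_integral (g n) \<xi>))\<^sup>2)" for \<xi>
      by (intro lim_imp_Liminf tendsto_ennrealI tendsto_intros F_lim) simp
    then have "sqnorm (\<lambda>\<xi>. fourier_integral f \<xi> - fourier_integral (g n) \<xi>) = (\<integral>\<^sup>+\<xi>. liminf (\<lambda>m. ?u m \<xi>) \<partial>lborel)"
      by (simp add: sqnorm_def)
    also have "\<dots> \<le> liminf (\<lambda>m. \<integral>\<^sup>+\<xi>. ?u m \<xi> \<partial>lborel)"
      by (rule nn_integral_liminf) measurable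
    also have "\<dots> \<le> liminf (\<lambda>m::nat. sqnorm (\<lambda>x. f x - g n x))"
      using plancherel_diff[of n] unfolding sqnorm_def
      by (intro Liminf_mono eventually_mono[OF eventually_ge_at_top[of n]]) auto
    also have "\<dots> = sqnorm (\<lambda>x. f x - g n x)" by (rule Liminf_const) simp
    finally show ?thesis .
  qed
  show ?thesis
  proof (rule sqnorm_continuous)
    show "(\<lambda>n. sqnorm (\<lambda>\<xi>. fourier_integral f \<xi> - fourier_integral (g n) \<xi>)) \<longlonglongrightarrow> 0"
      by (rule tendsto_sandwich[OF _ _ tendsto_const diff0]) (use F_diff in auto)
    have "sqnorm (fourier_integral (g n)) = sqnorm (g n)" for n
      by (rule sqnorm_fourier_integral_bounded[OF sq, of "real n"]) (auto simp: g_def indicator_def)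
    moreover have "(\<lambda>n. sqnorm (g n)) \<longlonglongrightarrow> sqnorm f"
      unfolding sqnorm_def
    proof (rule nn_integral_dominated_convergence[where w="\<lambda>x. ennreal ((cmod (f x))\<^sup>2)"])
      show "AE x in lborel. ennreal ((cmod (g n x))\<^sup>2) \<le> ennreal ((cmod (f x))\<^sup>2)" for n
        by (intro AE_I2) (auto simp: g_def indicator_def)
      show "(\<integral>\<^sup>+x. ennreal ((cmod (f x))\<^sup>2) \<partial>lborel) < \<infinity>"
        using f by (simp add: square_integrable_def sqnorm_def)
      show "AE x in lborel. (\<lambda>n. ennreal ((cmod (g n x))\<^sup>2)) \<longlonglongrightarrow> ennreal ((cmod (f x))\<^sup>2)"
        by (intro AE_I2 tendsto_ennrealI tendsto_intros g_lim)
    qed measurable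
    ultimately show "(\<lambda>n. sqnorm (fourier_integral (g n))) \<longlonglongrightarrow> sqnorm f" by simp
    show "sqnorm f < \<infinity>" using f by (simp add: square_integrable_def)
  qed measurable
qed

lemma square_integrable_fourier_integral:
  assumes "integrable lborel f" "square_integrable f"
  shows "square_integrable (fourier_integral f)"
  using assms by (auto simp: square_integrable_def plancherel)

lemma sqnorm_reflect:
  assumes "f \<in> borel_measurable borel"
  shows "sqnorm (\<lambda>x. f (- x)) = sqnorm f"
  using sqnorm_affine[OF assms, of "-1" 0] by simp

definition inverse_fourier :: "(real \<Rightarrow> complex) \<Rightarrow> real \<Rightarrow> complex" where
  "inverse_fourier f x = fourier_integral f (- x)"

lemma inverse_fourier_eq:
  assumes [measurable]: "f \<in> borel_measurable borel"
  shows "inverse_fourier f x = (LINT \<xi>|lborel. f \<xi> * unit_exp (x * \<xi>))"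
  by (simp add: inverse_fourier_def fourier_integral_eq mult.commute)

lemma inverse_fourier_measurable [measurable]:
  assumes [measurable]: "f \<in> borel_measurable borel"
  shows "inverse_fourier f \<in> borel_measurable borel"
  unfolding inverse_fourier_def[abs_def] by measurable

lemma sqnorm_inverse_fourier:
  assumes "integrable lborel f" "square_integrable f"
  shows "sqnorm (inverse_fourier f) = sqnorm f"
  using assms plancherel[OF assms] unfolding inverse_fourier_def[abs_def]
  by (subst sqnorm_reflect) auto

lemma square_integrable_inverse_fourier:
  assumes "integrable lborel f" "square_integrable f"
  shows "square_integrable (inverse_fourier f)"
  using assms by (auto simp: square_integrable_def sqnorm_inverse_fourier)

text \<open>
  Fubini's theorem for the kernel \<open>exp (2 \<pi> i x \<xi>)\<close>.
\<close>

lemma inner_product_inverse_fourier: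
  assumes g: "integrable lborel g" and f: "integrable lborel f"
  shows "inner_product (inverse_fourier g) f = inner_product g (fourier_integral f)"
proof -
  have [measurable]: "f \<in> borel_measurable borel" "g \<in> borel_measurable borel" using assms by auto
  let ?h = "\<lambda>x \<xi>. g \<xi> * unit_exp (x * \<xi>) * cnj (f x)"
  have nn: "norm (?h x \<xi>) = cmod (g \<xi>) * cmod (f x)" for x \<xi>
    by (simp add: norm_mult)
  have ih: "integrable (lborel \<Otimes>\<^sub>M lborel) (case_prod ?h)"
  proof (rule lborel_pair.Fubini_integrable)
    show "case_prod ?h \<in> borel_measurable (lborel \<Otimes>\<^sub>M lborel)" by measurable
    show "integrable lborel (\<lambda>x. LINT \<xi>|lborel. norm (case (x, \<xi>) of (x, \<xi>) \<Rightarrow> ?h x \<xi>))"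
      using f by (simp add: nn)
    show "AE x in lborel. integrable lborel (\<lambda>\<xi>. case (x, \<xi>) of (x, \<xi>) \<Rightarrow> ?h x \<xi>)"
      using integrable_mult_unit_exp[OF g] by (intro AE_I2) simp
  qed
  have "inner_product (inverse_fourier g) f = (LINT x|lborel. LINT \<xi>|lborel. ?h x \<xi>)"
    unfolding inner_product_def by (simp add: inverse_fourier_eq)
  also have "\<dots> = (LINT \<xi>|lborel. LINT x|lborel. ?h x \<xi>)"
    by (rule lborel_pair.Fubini_integral[OF ih, symmetric])
  also have "\<dots> = (LINT \<xi>|lborel. g \<xi> * cnj (LINT x|lborel. f x * unit_exp (- (x * \<xi>))))"
  proof (intro Bochner_Integration.integral_cong refl)
    fix \<xi>
    have "(LINT x|lborel. ?h x \<xi>) = (LINT x|lborel. g \<xi> * cnj (f x * unit_exp (- (x * \<xi>))))"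
      by (simp add: cnj_unit_exp mult_ac)
    then show "(LINT x|lborel. ?h x \<xi>) = g \<xi> * cnj (LINT x|lborel. f x * unit_exp (- (x * \<xi>)))"
      by (simp del: complex_cnj_mult)
  qed
  also have "\<dots> = inner_product g (fourier_integral f)"
    by (simp add: inner_product_def fourier_integral_eq)
  finally show ?thesis .
qed

text \<open>
  A form of Fourier inversion that avoids inverting the transform: both squared distances expand into
  the same norms, by Plancherel, and the same inner product, by Fubini. If \<open>g\<close> is close to the
  transform of \<open>f\<close>, then the inverse transform of \<open>g\<close> is close to \<open>f\<close>.
\<close>

lemma sqnorm_inverse_fourier_diff:
  assumes g: "integrable lborel g" "square_integrable g"
    and f: "integrable lborel f" "square_integrable f"
  shows "sqnorm (\<lambda>x. inverse_fourier g x - f x) = sqnorm (\<lambda>\<xi>. g \<xi> - fourier_integral f \<xi>)"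
proof -
  note s = square_integrable_inverse_fourier[OF g] square_integrable_fourier_integral[OF f]
  have "enn2real (sqnorm (\<lambda>x. inverse_fourier g x - f x)) = enn2real (sqnorm (\<lambda>\<xi>. g \<xi> - fourier_integral f \<xi>))"
    unfolding enn2real_sqnorm_diff[OF s(1) f(2)] enn2real_sqnorm_diff[OF g(2) s(2)]
      sqnorm_inverse_fourier[OF g] plancherel[OF f] inner_product_inverse_fourier[OF g(1) f(1)] ..
  moreover have "sqnorm (\<lambda>x. inverse_fourier g x - f x) < \<infinity>" "sqnorm (\<lambda>\<xi>. g \<xi> - fourier_integral f \<xi>) < \<infinity>"
    using square_integrable_diff[OF s(1) f(2)] square_integrable_diff[OF g(2) s(2)]
    by (simp_all add: square_integrable_def)
  ultimately show ?thesis by (metis ennreal_enn2real infinity_ennreal_def)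
qed

section \<open>Sets that tile by translations and dilations\<close>

definition dilate :: "int \<Rightarrow> (real \<Rightarrow> complex) \<Rightarrow> real \<Rightarrow> complex" where
  "dilate j f x = complex_of_real (2 powr (real_of_int j / 2)) * f (2 powi j * x)"

lemma powr_half_sq: "(2 powr (real_of_int j / 2))\<^sup>2 = 2 powi j"
proof -
  have "(2 powr (real_of_int j / 2))\<^sup>2 = 2 powr real_of_int j"
    by (simp add: power2_eq_square powr_add[symmetric])
  then show ?thesis by (simp add: powr_real_of_int')
qed

lemma powr_half_uminus: "2 powr (real_of_int (- j) / 2) = 2 powi (- j) * 2 powr (real_of_int j / 2)"
proof -
  have "u = v * w" if "u * w = 1" "v * w\<^sup>2 = 1" for u v w :: real
  proof -
    have "u = u * (v * w\<^sup>2)" using that by simp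
    also have "\<dots> = (u * w) * (v * w)" by (simp add: power2_eq_square)
    finally show ?thesis using that by simp
  qed
  then show ?thesis
    by this (simp_all add: powr_half_sq power_int_minus powr_add[symmetric])
qed

lemma dilate_measurable [measurable]:
  assumes [measurable]: "f \<in> borel_measurable borel"
  shows "dilate j f \<in> borel_measurable borel"
  unfolding dilate_def[abs_def] by measurable

lemma sqnorm_dilate:
  assumes [measurable]: "f \<in> borel_measurable borel"
  shows "sqnorm (dilate j f) = sqnorm f"
proof -
  have "sqnorm (dilate j f) = ennreal (2 powi j) * sqnorm (\<lambda>x. f (2 powi j * x))"
    unfolding dilate_def[abs_def] by (subst sqnorm_cmult) (auto simp: powr_half_sq)
  also have "\<dots> = sqnorm f"
    by (subst sqnorm_affine[of f "2 powi j" 0]) auto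
  finally show ?thesis .
qed

lemma square_integrable_dilate:
  assumes "square_integrable f"
  shows "square_integrable (dilate j f)"
  using assms by (auto simp: square_integrable_def sqnorm_dilate)

lemma integrable_dilate:
  assumes "integrable lborel f"
  shows "integrable lborel (dilate j f)"
  unfolding dilate_def[abs_def]
  using lborel_integrable_real_affine[OF assms, of "2 powi j" 0] by (intro integrable_mult_right) auto

lemma dilate_dilate_uminus: "dilate j (dilate (- j) f) = f"
proof
  fix x
  have 1: "2 powi (- j) * (2 powi j * x) = x" for x :: real
    by (simp add: power_int_minus)
  have 2: "complex_of_real (2 powr (real_of_int j / 2)) * complex_of_real (2 powr (real_of_int (- j) / 2)) = 1"
    unfolding of_real_mult[symmetric] by (simp add: powr_add[symmetric])
  show "dilate j (dilate (- j) f) x = f x"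
    unfolding dilate_def 1 unfolding mult.assoc[symmetric] 2 by simp
qed

lemma dilate_sum: "dilate j (\<lambda>x. \<Sum>i\<in>A. c i * f i x) = (\<lambda>x. \<Sum>i\<in>A. c i * dilate j (f i) x)"
  by (simp add: fun_eq_iff dilate_def sum_distrib_left mult.left_commute)

text \<open>
  The transform turns dilation by \<open>2\<^sup>j\<close> into dilation by \<open>2\<^bsup>-j\<^esup>\<close>, and the \<open>L\<^sup>2\<close> normalization in
  \<open>dilate\<close> absorbs the Jacobian.
\<close>

lemma inverse_fourier_dilate:
  assumes [measurable]: "f \<in> borel_measurable borel"
  shows "inverse_fourier (dilate (- j) f) = dilate j (inverse_fourier f)"
proof
  fix x
  let ?s = "2 powi (- j) :: real"
  have s: "?s > 0" by simp
  have "dilate (- j) f = (\<lambda>x. complex_of_real (2 powr (real_of_int (- j) / 2)) * f (0 + ?s * x))"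
    by (simp add: fun_eq_iff dilate_def)
  then have "inverse_fourier (dilate (- j) f) x =
      fourier_integral (\<lambda>x. complex_of_real (2 powr (real_of_int (- j) / 2)) * f (0 + ?s * x)) (- x)"
    by (simp only: inverse_fourier_def)
  also have "\<dots> = complex_of_real (2 powr (real_of_int (- j) / 2)) * fourier_integral (\<lambda>x. f (0 + ?s * x)) (- x)"
    by (rule fourier_integral_cmult) measurable
  also have "fourier_integral (\<lambda>x. f (0 + ?s * x)) (- x) = of_real (2 powi j) * fourier_integral f (- (2 powi j * x))"
    by (subst fourier_integral_affine[OF _ s]) (auto simp: power_int_minus field_simps)
  also have "complex_of_real (2 powr (real_of_int (- j) / 2)) * (of_real (2 powi j) * fourier_integral f (- (2 powi j * x)))
     = complex_of_real (2 powr (real_of_int (- j) / 2) * 2 powi j) * fourier_integral f (- (2 powi j * x))"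
    by (simp only: of_real_mult mult.assoc)
  also have "2 powr (real_of_int (- j) / 2) * 2 powi j = 2 powr (real_of_int j / 2)"
    unfolding powr_half_uminus by (simp add: power_int_minus)
  finally show "inverse_fourier (dilate (- j) f) x = dilate j (inverse_fourier f) x"
    by (simp only: dilate_def[of j "inverse_fourier f"] inverse_fourier_def)
qed

lemma integrable_sum_cmult:
  fixes f :: "'i \<Rightarrow> real \<Rightarrow> complex"
  assumes "\<And>i. i \<in> A \<Longrightarrow> integrable lborel (f i)"
  shows "integrable lborel (\<lambda>x. \<Sum>i\<in>A. c i * f i x)"
  using assms by (intro Bochner_Integration.integrable_sum integrable_mult_right)

lemma inverse_fourier_sum:
  assumes "finite A" "\<And>i. i \<in> A \<Longrightarrow> integrable lborel (f i)"
  shows "inverse_fourier (\<lambda>x. \<Sum>i\<in>A. c i * f i x) = (\<lambda>x. \<Sum>i\<in>A. c i * inverse_fourier (f i) x)"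
  using assms
proof (induction A rule: finite_induct)
  case empty
  show ?case by (simp add: fun_eq_iff inverse_fourier_eq)
next
  case (insert i A)
  have [measurable]: "f i \<in> borel_measurable borel" using insert.prems[of i] by auto
  show ?case
  proof
    fix x
    have "inverse_fourier (\<lambda>x. c i * f i x + (\<Sum>i\<in>A. c i * f i x)) x =
        fourier_integral (\<lambda>x. c i * f i x) (- x) + inverse_fourier (\<lambda>x. \<Sum>i\<in>A. c i * f i x) x"
      unfolding inverse_fourier_def using insert.prems
      by (intro fourier_integral_add integrable_sum_cmult integrable_mult_right) auto
    also have "fourier_integral (\<lambda>x. c i * f i x) (- x) = c i * inverse_fourier (f i) x"
      unfolding inverse_fourier_def by (rule fourier_integral_cmult) measurable
    finally show "inverse_fourier (\<lambda>x. \<Sum>i\<in>insert i A. c i * f i x) x = (\<Sum>i\<in>insert i A. c i * inverse_fourier (f i) x)"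
      using insert by simp
  qed
qed

lemma inner_product_inverse_fourier_both:
  assumes f: "integrable lborel f" "square_integrable f" and g: "integrable lborel g" "square_integrable g"
  shows "inner_product (inverse_fourier f) (inverse_fourier g) = inner_product f g"
proof (rule inner_product_eqI)
  fix a b
  have [measurable]: "f \<in> borel_measurable borel" "g \<in> borel_measurable borel" using assms by auto
  have "(\<lambda>x. a * inverse_fourier f x + b * inverse_fourier g x) = inverse_fourier (\<lambda>x. a * f x + b * g x)"
    using f g by (simp add: fun_eq_iff inverse_fourier_def fourier_integral_add fourier_integral_cmult)
  then show "sqnorm (\<lambda>x. a * inverse_fourier f x + b * inverse_fourier g x) = sqnorm (\<lambda>x. a * f x + b * g x)"
    using f g by (simp add: sqnorm_inverse_fourier square_integrable_add square_integrable_cmult)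
qed (use f g in \<open>auto intro: square_integrable_inverse_fourier\<close>)

lemma inner_product_dilate:
  assumes "square_integrable f" "square_integrable g"
  shows "inner_product (dilate j f) (dilate j g) = inner_product f g"
proof (rule inner_product_eqI)
  fix a b
  have [measurable]: "f \<in> borel_measurable borel" "g \<in> borel_measurable borel" using assms by auto
  have "(\<lambda>x. a * dilate j f x + b * dilate j g x) = dilate j (\<lambda>x. a * f x + b * g x)"
    by (simp add: fun_eq_iff dilate_def algebra_simps)
  then show "sqnorm (\<lambda>x. a * dilate j f x + b * dilate j g x) = sqnorm (\<lambda>x. a * f x + b * g x)"
    by (simp add: sqnorm_dilate)
qed (use assms in \<open>auto intro: square_integrable_dilate\<close>)

text \<open>
  Uniqueness of the integers means that the translates \<open>K - n\<close>, respectively the dilates \<open>2\<^bsup>-j\<^esup> K\<close>,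
  are disjoint, existence that they cover; both only up to null sets.
\<close>

locale tiling_set =
  fixes K :: "real set"
  assumes K_borel [measurable]: "K \<in> sets borel"
    and translation_tiling: "AE x in lborel. \<exists>!n::int. x + of_int n \<in> K"
    and dilation_tiling: "AE x in lborel. \<exists>!j::int. 2 powi j * x \<in> K"
begin

lemma nn_integral_periodic:
  fixes q :: "real \<Rightarrow> ennreal"
  assumes [measurable]: "q \<in> borel_measurable borel" and per: "\<And>x n. q (x + of_int n) = q x"
  shows "(\<integral>\<^sup>+x. indicator K x * q x \<partial>lborel) = (\<integral>\<^sup>+x. indicator {0..<1} x * q x \<partial>lborel)"
proof -
  have "(\<integral>\<^sup>+x. indicator K x * q x \<partial>lborel) =
      (\<integral>\<^sup>+x. indicator {0..<1} x * (\<integral>\<^sup>+k. indicator K (x + of_int k) * q (x + of_int k) \<partial>count_space UNIV) \<partial>lborel)"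
    by (rule nn_integral_periodize) measurable
  also have "\<dots> = (\<integral>\<^sup>+x. indicator {0..<1} x * q x \<partial>lborel)"
  proof (rule nn_integral_cong_AE)
    show "AE x in lborel. indicator {0..<1} x * (\<integral>\<^sup>+k. indicator K (x + of_int k) * q (x + of_int k) \<partial>count_space UNIV)
        = indicator {0..<1} x * q x"
      using translation_tiling
    proof eventually_elim
      case (elim x)
      then obtain n :: int where n: "x + of_int m \<in> K \<longleftrightarrow> m = n" for m by metis
      have "(\<integral>\<^sup>+k. indicator K (x + of_int k) * q (x + of_int k) \<partial>count_space UNIV) =
          (\<integral>\<^sup>+k. q x * indicator {n} k \<partial>count_space UNIV)"
        unfolding per by (intro nn_integral_cong) (auto simp: indicator_def n)
      also have "\<dots> = q x" by (subst nn_integral_cmult_indicator) auto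
      finally show ?case by simp
    qed
  qed
  finally show ?thesis .
qed

text \<open>
  The first tiling makes \<open>K\<close> a fundamental domain of translation by integers, so a periodic function has the
  same norm over \<open>K\<close> as over \<open>[0, 1)\<close>.
\<close>

lemma sqnorm_periodic:
  assumes [measurable]: "p \<in> borel_measurable borel" and per: "\<And>x n. p (x + of_int n) = p x"
  shows "sqnorm (\<lambda>x. indicator K x * p x) = sqnorm (\<lambda>x. indicator {0..<1} x * p x)"
proof -
  have "sqnorm (\<lambda>x. indicator A x * p x) = (\<integral>\<^sup>+x. indicator A x * ennreal ((cmod (p x))\<^sup>2) \<partial>lborel)"
    for A :: "real set"
    unfolding sqnorm_def by (intro nn_integral_cong) (auto simp: indicator_def)
  then show ?thesis
    using nn_integral_periodic[of "\<lambda>x. ennreal ((cmod (p x))\<^sup>2)"] per by simp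
qed

lemma emeasure_K: "emeasure lborel K = 1"
proof -
  have "emeasure lborel K = sqnorm (\<lambda>x. indicator K x * 1)"
    by (simp add: sqnorm_indicator[symmetric])
  also have "\<dots> = sqnorm (\<lambda>x. indicator {0..<1} x * 1)" by (rule sqnorm_periodic) auto
  also have "\<dots> = 1" using sqnorm_indicator[of "{0..<1::real}"] by simp
  finally show ?thesis .
qed

lemma square_integrable_indicator_K: "square_integrable (indicator K)"
  by (rule square_integrable_indicator) (auto simp: emeasure_K)

definition K_harmonic :: "int \<Rightarrow> real \<Rightarrow> complex" where
  "K_harmonic k x = indicator K x * harmonic k x"

lemma square_integrable_K_harmonic: "square_integrable (K_harmonic k)"
  unfolding K_harmonic_def[abs_def]
  by (rule square_integrable_dominated[OF square_integrable_indicator_K]) (auto simp: norm_mult)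

lemma integrable_K_harmonic: "integrable lborel (K_harmonic k)"
proof -
  have "integrable lborel (\<lambda>x. indicator K x * K_harmonic k x)"
    by (rule integrable_bounded_support[OF square_integrable_K_harmonic]) (auto simp: emeasure_K)
  moreover have "(\<lambda>x. indicator K x * K_harmonic k x) = K_harmonic k"
    by (auto simp: fun_eq_iff K_harmonic_def indicator_def)
  ultimately show ?thesis by simp
qed

lemma inner_product_K_harmonic:
  "inner_product (K_harmonic j) (K_harmonic k) = (if j = k then 1 else 0)"
proof -
  have "inner_product (K_harmonic j) (K_harmonic k) = inner_product (unit_harmonic j) (unit_harmonic k)"
  proof (rule inner_product_eqI)
    fix a b
    have "(\<lambda>x. a * K_harmonic j x + b * K_harmonic k x) = (\<lambda>x. indicator K x * (a * harmonic j x + b * harmonic k x))"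
      "(\<lambda>x. a * unit_harmonic j x + b * unit_harmonic k x) = (\<lambda>x. indicator {0..<1} x * (a * harmonic j x + b * harmonic k x))"
      by (simp_all add: fun_eq_iff K_harmonic_def unit_harmonic_def algebra_simps)
    then show "sqnorm (\<lambda>x. a * K_harmonic j x + b * K_harmonic k x) = sqnorm (\<lambda>x. a * unit_harmonic j x + b * unit_harmonic k x)"
      by (simp add: sqnorm_periodic harmonic_periodic)
  qed (rule square_integrable_K_harmonic square_integrable_unit_harmonic)+
  then show ?thesis by (simp add: inner_product_unit_harmonic)
qed

sublocale K_harmonic: square_integrable_family K_harmonic
  by unfold_locales (rule square_integrable_K_harmonic)

text \<open>
  On \<open>K\<close> the set \<open>E\<close> coincides with its periodic hull \<open>P\<close> up to a null set, since almost no point of \<open>K\<close>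
  differs from another one by an integer. A trigonometric polynomial close to the indicator function of \<open>P\<close> on \<open>[0, 1)\<close> is equally
  close to it on \<open>K\<close>.
\<close>

lemma closed_span_K_subset:
  assumes E [measurable]: "E \<in> sets borel" and sub: "E \<subseteq> K"
  shows "closed_span K_harmonic (indicator E)"
proof -
  define P where "P = {x. \<exists>n::int. x + of_int n \<in> E}"
  have "{x \<in> space borel. \<exists>n::int. x + of_int n \<in> E} \<in> sets borel" by measurable
  then have [measurable]: "P \<in> sets borel" by (simp add: P_def)
  have per: "x + of_int n \<in> P \<longleftrightarrow> x \<in> P" for x and n :: int
  proof
    assume "x + of_int n \<in> P"
    then obtain m :: int where "x + of_int n + of_int m \<in> E" by (auto simp: P_def)
    then have "x + of_int (n + m) \<in> E" by (simp add: add.assoc)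
    then show "x \<in> P" unfolding P_def by blast
  next
    assume "x \<in> P"
    then obtain m :: int where "x + of_int m \<in> E" by (auto simp: P_def)
    then have "x + of_int n + of_int (m - n) \<in> E" by simp
    then show "x + of_int n \<in> P" unfolding P_def by blast
  qed
  have iP: "indicator P (x + of_int n) = (indicator P x :: complex)" for x and n :: int
    using per[of x n] by (simp add: indicator_def)
  have "square_integrable (\<lambda>x. indicator {0..<1} x * indicator P x)"
    by (rule square_integrable_bounded_unit[of _ 1]) (auto simp: indicator_def)
  then have "closed_span unit_harmonic (\<lambda>x. indicator {0..<1} x * (indicator {0..<1} x * indicator P x))"
    by (rule closed_span_unit_harmonic)
  moreover have "(\<lambda>x. indicator {0..<1} x * (indicator {0..<1} x * indicator P x)) = (\<lambda>x. indicator {0..<1} x * indicator P x :: complex)"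
    by (auto simp: fun_eq_iff indicator_def)
  ultimately have unit: "closed_span unit_harmonic (\<lambda>x. indicator {0..<1} x * indicator P x)"
    by simp
  have "closed_span K_harmonic (\<lambda>x. indicator K x * indicator P x)"
    unfolding closed_span_def
  proof (intro allI impI)
    fix \<epsilon> :: real assume "\<epsilon> > 0"
    then obtain g where g: "finite_span unit_harmonic g"
      and less: "sqnorm (\<lambda>x. indicator {0..<1} x * indicator P x - g x) < ennreal \<epsilon>"
      using closed_spanE[OF unit] by auto
    then obtain A c where A: "finite A" "g = (\<lambda>x. \<Sum>k\<in>A. c k * unit_harmonic k x)"
      by (auto simp: finite_span_def)
    define p where "p x = (\<Sum>k\<in>A. c k * harmonic k x)" for x
    have [measurable]: "p \<in> borel_measurable borel" unfolding p_def by measurable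
    have p_per: "p (x + of_int n) = p x" for x n by (simp add: p_def harmonic_periodic)
    have gp: "g x = indicator {0..<1} x * p x" for x
      by (simp add: A p_def unit_harmonic_def sum_distrib_left mult_ac)
    have "sqnorm (\<lambda>x. indicator K x * (indicator P x - p x)) = sqnorm (\<lambda>x. indicator {0..<1} x * (indicator P x - p x))"
      by (rule sqnorm_periodic) (auto simp: p_per iP)
    also have "\<dots> < ennreal \<epsilon>" using less by (simp add: gp right_diff_distrib)
    finally have "sqnorm (\<lambda>x. indicator K x * indicator P x - indicator K x * p x) < ennreal \<epsilon>"
      by (simp add: right_diff_distrib)
    moreover have "(\<lambda>x. indicator K x * p x) = (\<lambda>x. \<Sum>k\<in>A. c k * K_harmonic k x)"
      by (simp add: p_def K_harmonic_def sum_distrib_left mult_ac)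
    then have "finite_span K_harmonic (\<lambda>x. indicator K x * p x)"
      using A unfolding finite_span_def by blast
    ultimately show "\<exists>h. finite_span K_harmonic h \<and> sqnorm (\<lambda>x. indicator K x * indicator P x - h x) < ennreal \<epsilon>"
      by blast
  qed
  moreover have "AE x in lborel. indicator K x * indicator P x = (indicator E x :: complex)"
    using translation_tiling
  proof eventually_elim
    case (elim x)
    have "x \<in> E" if "x \<in> K" "x \<in> P"
    proof -
      obtain n :: int where n: "x + of_int n \<in> E" using \<open>x \<in> P\<close> by (auto simp: P_def)
      then have "n = 0" using elim sub that(1) by (metis add_0_right of_int_0 subsetD)
      then show ?thesis using n by simp
    qed
    moreover have "x \<in> K \<and> x \<in> P" if "x \<in> E"
      using that sub by (auto simp: P_def intro: exI[of _ 0])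
    ultimately show ?case by (auto simp: indicator_def)
  qed
  ultimately show ?thesis by (rule closed_span_cong_AE[rotated])
qed

lemma closed_span_K_harmonic:
  assumes "square_integrable f"
  shows "closed_span K_harmonic (\<lambda>x. indicator K x * f x)"
proof (rule K_harmonic.closed_span_restrict[OF assms])
  fix a c :: real
  have "(\<lambda>x. indicator K x * indicator {a..<c} x) = (indicator (K \<inter> {a..<c}) :: real \<Rightarrow> complex)"
    by (auto simp: fun_eq_iff indicator_def)
  then show "closed_span K_harmonic (\<lambda>x. indicator K x * indicator {a..<c} x)"
    using closed_span_K_subset[of "K \<inter> {a..<c}"] by simp
qed simp

text \<open>
  The Fourier transforms of the wavelet system.
\<close>

definition wave_hat :: "int \<times> int \<Rightarrow> real \<Rightarrow> complex" where
  "wave_hat = (\<lambda>(j, k). dilate (- j) (K_harmonic (- k)))"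

lemma square_integrable_wave_hat: "square_integrable (wave_hat i)"
  by (auto simp: wave_hat_def split: prod.splits intro: square_integrable_dilate square_integrable_K_harmonic)

lemma integrable_wave_hat: "integrable lborel (wave_hat i)"
  by (auto simp: wave_hat_def split: prod.splits intro: integrable_dilate integrable_K_harmonic)

sublocale wave_hat: square_integrable_family wave_hat
  by unfold_locales (rule square_integrable_wave_hat)

text \<open>
  At equal scales this is orthonormality of the exponentials on \<open>K\<close>; at different scales the supports
  are almost disjoint by the second tiling.
\<close>

lemma inner_product_wave_hat:
  "inner_product (wave_hat i) (wave_hat i') = (if i = i' then 1 else 0)"
proof -
  obtain j k j' k' where i: "i = (j, k)" "i' = (j', k')" by (cases i, cases i')
  show ?thesis
  proof (cases "j = j'")
    case True
    then show ?thesis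
      by (simp add: i wave_hat_def inner_product_dilate square_integrable_K_harmonic inner_product_K_harmonic)
  next
    case False
    have "inner_product (wave_hat i) (wave_hat i') = (LINT x|(lborel :: real measure). 0)"
      unfolding inner_product_def
    proof (rule integral_cong_AE)
      show "AE x in lborel. wave_hat i x * cnj (wave_hat i' x) = 0"
        using dilation_tiling
      proof eventually_elim
        case (elim x)
        then have "\<not> (2 powi (- j) * x \<in> K \<and> 2 powi (- j') * x \<in> K)"
          using False by (metis neg_equal_iff_equal)
        then show ?case
          by (auto simp: i wave_hat_def dilate_def K_harmonic_def indicator_def)
      qed
      have [measurable]: "wave_hat i \<in> borel_measurable borel" for i
        using square_integrable_wave_hat by auto
      show "(\<lambda>x. wave_hat i x * cnj (wave_hat i' x)) \<in> borel_measurable lborel" by measurable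
    qed simp
    then show ?thesis using False i by simp
  qed
qed

text \<open>
  Rescaling \<open>f\<close> moves its part over the dilate \<open>2\<^sup>j K\<close> to \<open>K\<close>, where the exponentials span.
\<close>

lemma closed_span_wave_hat_scale:
  assumes f: "square_integrable f"
  shows "closed_span wave_hat (\<lambda>x. indicator K (2 powi (- j) * x) * f x)"
  unfolding closed_span_def
proof (intro allI impI)
  fix \<epsilon> :: real assume "\<epsilon> > 0"
  have [measurable]: "f \<in> borel_measurable borel" using f by auto
  obtain g where g: "finite_span K_harmonic g"
    and less: "sqnorm (\<lambda>x. indicator K x * dilate j f x - g x) < ennreal \<epsilon>"
    using closed_spanE[OF closed_span_K_harmonic[OF square_integrable_dilate[OF f]] \<open>\<epsilon> > 0\<close>] by auto
  have [measurable]: "g \<in> borel_measurable borel" using g by (rule K_harmonic.measurable_finite_span)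
  have "finite_span wave_hat (dilate (- j) g)"
  proof (rule finite_span_transfer[OF g])
    show "finite_span wave_hat (dilate (- j) (K_harmonic k))" for k
      using finite_span_base[of wave_hat "(j, - k)"] by (simp add: wave_hat_def)
  qed (rule dilate_sum)
  moreover have "sqnorm (\<lambda>x. indicator K (2 powi (- j) * x) * f x - dilate (- j) g x) < ennreal \<epsilon>"
  proof -
    have f_eq: "f x = dilate (- j) (dilate j f) x" for x
      using dilate_dilate_uminus[of "- j" f] by simp
    have "(\<lambda>x. indicator K (2 powi (- j) * x) * f x - dilate (- j) g x) =
        dilate (- j) (\<lambda>x. indicator K x * dilate j f x - g x)"
    proof
      fix x
      show "indicator K (2 powi (- j) * x) * f x - dilate (- j) g x =
          dilate (- j) (\<lambda>x. indicator K x * dilate j f x - g x) x"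
        unfolding f_eq[of x] by (simp only: dilate_def[of "- j"] right_diff_distrib mult.left_commute)
    qed
    then show ?thesis using less by (simp add: sqnorm_dilate)
  qed
  ultimately show "\<exists>h. finite_span wave_hat h \<and> sqnorm (\<lambda>x. indicator K (2 powi (- j) * x) * f x - h x) < ennreal \<epsilon>"
    by blast
qed

text \<open>
  The dilates with \<open>\<bar>j\<bar> \<le> N\<close> cover almost every point once \<open>N\<close> is large, so the restrictions of \<open>f\<close> to
  their unions \<open>S N\<close> converge to \<open>f\<close>.
\<close>

lemma closed_span_wave_hat:
  assumes f: "square_integrable f"
  shows "closed_span wave_hat f"
proof -
  have [measurable]: "f \<in> borel_measurable borel" using f by auto
  define S where "S N = (\<Union>j\<in>{- int N..int N}. {x. 2 powi (- j) * x \<in> K})" for N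
  have "{x \<in> space borel. 2 powi (- j) * x \<in> K} \<in> sets borel" for j :: int by measurable
  then have [measurable]: "S N \<in> sets borel" for N unfolding S_def by (intro sets.finite_UN) auto
  show ?thesis
  proof (rule wave_hat.closed_span_LIMSEQ)
    fix N
    have "closed_span wave_hat (\<lambda>x. \<Sum>j\<in>{- int N..int N}. indicator K (2 powi (- j) * x) * f x)"
      by (rule wave_hat.closed_span_sum) (auto intro: closed_span_wave_hat_scale[OF f])
    moreover have "AE x in lborel. (\<Sum>j\<in>{- int N..int N}. indicator K (2 powi (- j) * x) * f x) = indicator (S N) x * f x"
      using dilation_tiling
    proof eventually_elim
      case (elim x)
      then obtain m where m: "2 powi j * x \<in> K \<longleftrightarrow> j = m" for j :: int by metis
      have "(\<Sum>j\<in>{- int N..int N}. indicator K (2 powi (- j) * x) * f x) =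
          (\<Sum>j\<in>{- int N..int N}. if j = - m then f x else 0)"
        by (intro sum.cong) (auto simp: indicator_def m)
      also have "\<dots> = indicator (S N) x * f x"
      proof -
        have "x \<in> S N \<longleftrightarrow> (\<exists>j\<in>{- int N..int N}. - j = m)" unfolding S_def by (simp add: m)
        also have "\<dots> \<longleftrightarrow> - m \<in> {- int N..int N}" by (metis minus_minus)
        finally have "x \<in> S N \<longleftrightarrow> - m \<in> {- int N..int N}" .
        then show ?thesis by (simp add: indicator_def)
      qed
      finally show ?case .
    qed
    ultimately show "closed_span wave_hat (\<lambda>x. indicator (S N) x * f x)"
      by (rule closed_span_cong_AE[rotated])
  next
    show "(\<lambda>N. sqnorm (\<lambda>x. f x - indicator (S N) x * f x)) \<longlonglongrightarrow> 0"
    proof (rule sqnorm_tendsto_zero_dominated[OF _ f])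
      show "AE x in lborel. (\<lambda>N. f x - indicator (S N) x * f x) \<longlonglongrightarrow> 0"
        using dilation_tiling
      proof eventually_elim
        case (elim x)
        then obtain m :: int where m: "2 powi m * x \<in> K" by blast
        have "x \<in> S N" if "N \<ge> nat \<bar>m\<bar>" for N
          unfolding S_def using that m by (intro UN_I[of "- m"]) auto
        then have "eventually (\<lambda>N. f x - indicator (S N) x * f x = 0) sequentially"
          by (intro eventually_mono[OF eventually_ge_at_top[of "nat \<bar>m\<bar>"]]) auto
        then show ?case by (rule tendsto_eventually)
      qed
    qed (auto simp: indicator_def)
  qed measurable
qed

definition wavelet :: "real \<Rightarrow> complex" where
  "wavelet = inverse_fourier (indicator K)"

lemma integrable_indicator_K: "integrable lborel (indicator K :: real \<Rightarrow> complex)"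
  using integrable_K_harmonic[of 0] by (simp add: K_harmonic_def[abs_def] harmonic_def)

lemma square_integrable_wavelet: "square_integrable wavelet"
  unfolding wavelet_def
  by (rule square_integrable_inverse_fourier[OF integrable_indicator_K square_integrable_indicator_K])

definition wave :: "int \<times> int \<Rightarrow> real \<Rightarrow> complex" where
  "wave = (\<lambda>(j, k) x. complex_of_real (2 powr (real_of_int j / 2)) * wavelet (2 powi j * x - real_of_int k))"

lemma wave_eq: "wave i = inverse_fourier (wave_hat i)"
proof -
  obtain j k where i: "i = (j, k)" by (cases i)
  have [measurable]: "K_harmonic k \<in> borel_measurable borel" for k
    using square_integrable_K_harmonic by auto
  have "inverse_fourier (K_harmonic (- k)) x = wavelet (x - of_int k)" for x
  proof -
    have "K_harmonic (- k) \<xi> * unit_exp (x * \<xi>) = indicator K \<xi> * unit_exp ((x - of_int k) * \<xi>)" for \<xi>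
    proof -
      have "unit_exp ((x - of_int k) * \<xi>) = unit_exp (of_int (- k) * \<xi> + x * \<xi>)"
        by (intro arg_cong[where f=unit_exp]) (simp add: algebra_simps)
      then show ?thesis by (simp only: K_harmonic_def harmonic_def unit_exp_add mult.assoc)
    qed
    then show ?thesis by (simp add: wavelet_def inverse_fourier_eq)
  qed
  then show ?thesis
    unfolding i wave_hat_def wave_def
    by (simp add: fun_eq_iff inverse_fourier_dilate dilate_def)
qed

lemma square_integrable_wave: "square_integrable (wave i)"
  unfolding wave_eq by (intro square_integrable_inverse_fourier integrable_wave_hat square_integrable_wave_hat)

sublocale wave: orthonormal_family wave
proof
  show "inner_product (wave i) (wave i') = (if i = i' then 1 else 0)" for i i'
    unfolding wave_eq
    by (simp add: inner_product_inverse_fourier_both integrable_wave_hat square_integrable_wave_hat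
        inner_product_wave_hat)
qed (rule square_integrable_wave)

text \<open>
  By the norm identity for inverse transforms it is enough to approximate, on the Fourier side, the
  transform of a truncation of \<open>f\<close>; truncation makes \<open>f\<close> integrable, so that its transform is given by
  an integral.
\<close>

lemma closed_span_wave:
  assumes f: "square_integrable f"
  shows "closed_span wave f"
proof (rule wave.closed_span_LIMSEQ)
  have [measurable]: "f \<in> borel_measurable borel" using f by auto
  let ?g = "\<lambda>n::nat. \<lambda>x. indicator {- real n..real n} x * f x"
  show "f \<in> borel_measurable borel" "?g n \<in> borel_measurable borel" for n by measurable
  show "(\<lambda>n. sqnorm (\<lambda>x. f x - ?g n x)) \<longlonglongrightarrow> 0" by (rule sqnorm_truncate_tendsto[OF f])
  show "closed_span wave (?g n)" for n
    unfolding closed_span_def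
  proof (intro allI impI)
    fix \<epsilon> :: real assume "\<epsilon> > 0"
    have g: "integrable lborel (?g n)" "square_integrable (?g n)"
      using f by (intro integrable_bounded_support square_integrable_indicator_mult; simp)+
    obtain h where h: "finite_span wave_hat h"
      and less: "sqnorm (\<lambda>\<xi>. fourier_integral (?g n) \<xi> - h \<xi>) < ennreal \<epsilon>"
      using closed_spanE[OF closed_span_wave_hat[OF square_integrable_fourier_integral[OF g]] \<open>\<epsilon> > 0\<close>] by auto
    have h': "integrable lborel h" "square_integrable h"
      using h integrable_wave_hat square_integrable_wave_hat
      by (auto simp: finite_span_def intro!: integrable_sum_cmult square_integrable_sum square_integrable_cmult)
    have "sqnorm (\<lambda>x. ?g n x - inverse_fourier h x) = sqnorm (\<lambda>\<xi>. fourier_integral (?g n) \<xi> - h \<xi>)"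
      using sqnorm_inverse_fourier_diff[OF h' g]
        sqnorm_minus_commute[of "?g n" "inverse_fourier h"] sqnorm_minus_commute[of "fourier_integral (?g n)" h]
      by simp
    moreover have "finite_span wave (inverse_fourier h)"
    proof (rule finite_span_transfer[OF h])
      show "finite_span wave (inverse_fourier (wave_hat i))" for i
        unfolding wave_eq[symmetric] by (rule finite_span_base)
    qed (rule inverse_fourier_sum[OF _ integrable_wave_hat])
    ultimately show "\<exists>u. finite_span wave u \<and> sqnorm (\<lambda>x. ?g n x - u x) < ennreal \<epsilon>"
      using less by auto
  qed
qed

end

section \<open>Tiling sets are wavelet sets\<close>

lemma L2_sqdist_eq: "L2_sqdist f g = sqnorm (\<lambda>x. f x - g x)"
  by (simp add: L2_sqdist_def sqnorm_def nn_integral_completion)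

lemma square_integrable_in_L2:
  assumes "square_integrable f"
  shows "in_L2 f"
proof -
  have [measurable]: "f \<in> borel_measurable borel" using assms by auto
  have "f \<in> borel_measurable lebesgue" by (rule measurable_completion) measurable
  moreover have "integrable lebesgue (\<lambda>x. (cmod (f x))\<^sup>2)"
    using square_integrable_integrable_norm[OF assms] by (subst integrable_completion) auto
  ultimately show ?thesis by (simp add: in_L2_def)
qed

lemma L2_inner_eq:
  assumes "square_integrable f" "square_integrable g"
  shows "L2_inner f g = inner_product f g"
proof -
  have [measurable]: "f \<in> borel_measurable borel" "g \<in> borel_measurable borel" using assms by auto
  show ?thesis
    unfolding L2_inner_def inner_product_def by (rule integral_completion) measurable
qed

lemma in_L2_borel_representative:
  assumes "in_L2 f"
  obtains g where "square_integrable g" "AE x in lborel. f x = g x"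
proof -
  have [measurable]: "f \<in> borel_measurable lebesgue" using assms by (simp add: in_L2_def)
  have "(\<lambda>x. Re (f x)) \<in> borel_measurable lebesgue" "(\<lambda>x. Im (f x)) \<in> borel_measurable lebesgue"
    by measurable
  then obtain u v where [measurable]: "u \<in> borel_measurable borel" "v \<in> borel_measurable borel"
    and uv: "AE x in lborel. Re (f x) = u x" "AE x in lborel. Im (f x) = v x"
    using completion_ex_borel_measurable_real[of "\<lambda>x. Re (f x)" lborel]
      completion_ex_borel_measurable_real[of "\<lambda>x. Im (f x)" lborel] by auto
  let ?g = "\<lambda>x. complex_of_real (u x) + \<i> * complex_of_real (v x)"
  have eq: "AE x in lborel. f x = ?g x"
    using uv by eventually_elim (simp add: complex_eq_iff)
  have "(\<integral>\<^sup>+x. ennreal ((cmod (f x))\<^sup>2) \<partial>lebesgue) < \<infinity>"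
    using assms integrableD(2)[of lebesgue "\<lambda>x. (cmod (f x))\<^sup>2"]
    by (simp add: in_L2_def top.not_eq_extremum)
  then have "sqnorm f < \<infinity>" by (simp add: sqnorm_def nn_integral_completion)
  then have "square_integrable ?g"
    using sqnorm_cong_AE[OF eq] by (simp add: square_integrable_def)
  then show ?thesis using eq by (rule that)
qed

lemma AE_eq_sets_lebesgue:
  assumes "A \<in> sets lebesgue" and "AE x in lebesgue. x \<in> B \<longleftrightarrow> x \<in> A"
  shows "B \<in> sets lebesgue"
proof -
  define D where "D = {x. \<not> (x \<in> B \<longleftrightarrow> x \<in> A)}"
  obtain N where N: "\<And>x. x \<in> space lebesgue - N \<Longrightarrow> x \<in> B \<longleftrightarrow> x \<in> A" "N \<in> null_sets lebesgue"
    using assms(2) by (rule AE_E3) blast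
  have "D \<subseteq> N" unfolding D_def using N(1) by (simp add: subset_iff) blast
  then have "D \<in> null_sets lebesgue" using N(2) by (rule completion.complete2)
  then have "D \<in> sets lebesgue" by (rule null_setsD2)
  then have "(A - D) \<union> (D - A) \<in> sets lebesgue" using assms(1) by (intro sets.Un sets.Diff)
  moreover have "B = (A - D) \<union> (D - A)" by (auto simp: D_def)
  ultimately show ?thesis by (simp only:)
qed

context tiling_set
begin

lemma orthonormal_wavelet_wavelet: "orthonormal_wavelet wavelet"
proof -
  have "orthonormal_basis_L2 wave"
    unfolding orthonormal_basis_L2_def
  proof (intro conjI allI impI)
    show "in_L2 (wave i)" for i
      by (rule square_integrable_in_L2[OF square_integrable_wave])
    show "L2_inner (wave i) (wave i') = (if i = i' then 1 else 0)" for i i'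
      by (simp add: L2_inner_eq square_integrable_wave wave.orthonormal)
    fix f and \<epsilon> :: real assume "in_L2 f" "\<epsilon> > 0"
    obtain g where g: "square_integrable g" and fg: "AE x in lborel. f x = g x"
      using in_L2_borel_representative[OF \<open>in_L2 f\<close>] .
    have "closed_span wave f"
      by (rule closed_span_cong_AE[OF _ closed_span_wave[OF g]]) (use fg in \<open>auto simp: eq_commute\<close>)
    then obtain h where "finite_span wave h" "sqnorm (\<lambda>x. f x - h x) < ennreal \<epsilon>"
      using \<open>\<epsilon> > 0\<close> by (rule closed_spanE)
    then show "\<exists>A c. finite A \<and> L2_sqdist f (\<lambda>x. \<Sum>i\<in>A. c i * wave i x) < ennreal \<epsilon>"
      unfolding L2_sqdist_eq finite_span_def by blast
  qed
  then show ?thesis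
    unfolding orthonormal_wavelet_def wave_def
    using square_integrable_in_L2[OF square_integrable_wavelet] by blast
qed

text \<open>
  The distance of \<open>indicator K\<close> to the transform of a truncation of the wavelet equals the distance of the
  wavelet to its truncation.
\<close>

lemma has_fourier_transform_wavelet: "has_fourier_transform wavelet (indicator K)"
proof -
  let ?f = "\<lambda>n::nat. \<lambda>x. indicator {- real n..real n} x * wavelet x"
  have "L2_sqdist (indicator K) (fourier_integral (?f n)) = sqnorm (\<lambda>x. wavelet x - ?f n x)" for n
  proof -
    have "integrable lborel (?f n)" "square_integrable (?f n)"
      by (intro integrable_bounded_support square_integrable_indicator_mult square_integrable_wavelet; simp)+
    from sqnorm_inverse_fourier_diff[OF integrable_indicator_K square_integrable_indicator_K this]
    show ?thesis unfolding L2_sqdist_eq wavelet_def[symmetric] by (rule sym)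
  qed
  then show ?thesis
    using sqnorm_truncate_tendsto[OF square_integrable_wavelet]
    by (simp add: has_fourier_transform_def square_integrable_in_L2 square_integrable_wavelet
        square_integrable_indicator_K)
qed

theorem wavelet_set_if_ae_eq:
  assumes "ae_eq_set K' K"
  shows "wavelet_set K'"
proof -
  have ae: "AE x in lebesgue. x \<in> K' \<longleftrightarrow> x \<in> K" using assms by (simp add: ae_eq_set_def)
  have "K \<in> sets lebesgue" using K_borel by (simp add: sets_completionI_sets)
  then have "K' \<in> sets lebesgue" using ae by (rule AE_eq_sets_lebesgue)
  moreover have "AE \<xi> in lebesgue. cmod (indicator K \<xi>) = indicator K' \<xi>"
    using ae by eventually_elim (simp add: indicator_def)
  ultimately show ?thesis
    unfolding wavelet_set_def using orthonormal_wavelet_wavelet has_fourier_transform_wavelet by blast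
qed

end

section \<open>The endpoints of the intervals and the two tilings\<close>

text \<open>
  The breakpoints themselves are excluded because an inner one lies in two adjacent closed intervals.
\<close>

lemma ex1_decreasing_interval:
  fixes u :: "nat \<Rightarrow> real"
  assumes dec: "\<And>i. u (Suc i) < u i" and lim: "\<And>y. L < y \<Longrightarrow> \<exists>i. u i < y"
    and x: "L < x" "x < u 0" "x \<notin> range u"
  shows "\<exists>!i. u (Suc i) \<le> x \<and> x \<le> u i"
proof -
  have "\<exists>i. u i < x" using lim x by blast
  define k where "k = (LEAST i. u i < x)"
  have k: "u k < x" unfolding k_def using \<open>\<exists>i. u i < x\<close> by (rule LeastI_ex)
  then have "k \<noteq> 0" using x by (cases k) auto
  then obtain i where i: "k = Suc i" by (cases k) auto
  have "\<not> u i < x" using not_less_Least[of i "\<lambda>i. u i < x"] i by (simp add: k_def)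
  then have xi: "u (Suc i) \<le> x \<and> x \<le> u i" using k i by auto
  have anti: "u n \<le> u m" if "m \<le> n" for m n
    using that by (rule lift_Suc_antimono_le[rotated]) (use dec in \<open>auto intro: less_imp_le\<close>)
  have ne: "x \<noteq> u n" for n using x(3) by auto
  show ?thesis
  proof (rule ex1I[where a=i], rule xi, rule ccontr)
    fix j assume j: "u (Suc j) \<le> x \<and> x \<le> u j" and "j \<noteq> i"
    then consider "Suc j \<le> i" | "Suc i \<le> j" by linarith
    then show False
    proof cases
      case 1
      then have "u i \<le> u (Suc j)" by (rule anti)
      then show False using j xi ne[of i] by auto
    next
      case 2
      then have "u j \<le> u (Suc i)" by (rule anti)
      then show False using j xi ne[of j] by auto
    qed
  qed
qed

definition signed :: "bool \<Rightarrow> real \<Rightarrow> real" where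
  "signed b x = (if b then x else - x)"

text \<open>
  A common principle behind the two tilings. The integers act on the line by \<open>A\<close>, and the set of points
  whose absolute value lies strictly between \<open>L\<close> and \<open>u 0\<close> is a fundamental domain up to its
  boundary (\<open>reach\<close>, \<open>sep\<close>). This domain is cut, on both sides of the origin, into the cells between
  consecutive breakpoints, and \<open>P\<close> arises by moving every cell with a group element of its own. Outside the
  countably many orbits of boundary points each orbit then meets the union of the moved cells exactly once.
\<close>

lemma AE_ex1_orbit:
  fixes A :: "int \<Rightarrow> real \<Rightarrow> real" and u :: "nat \<Rightarrow> real" and P :: "bool \<times> nat \<Rightarrow> real set"
  assumes A_0: "\<And>x. A 0 x = x" and A_add: "\<And>i j x. A (i + j) x = A i (A j x)"
    and dec: "\<And>i. u (Suc i) < u i" and L: "0 \<le> L" and above: "\<And>i. L < u i"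
    and lim: "\<And>y. L < y \<Longrightarrow> \<exists>i. u i < y"
    and reach: "\<And>x. x \<noteq> 0 \<Longrightarrow> \<exists>n. L \<le> \<bar>A n x\<bar> \<and> \<bar>A n x\<bar> \<le> u 0"
    and sep: "\<And>x i. L < \<bar>x\<bar> \<Longrightarrow> \<bar>x\<bar> < u 0 \<Longrightarrow> L < \<bar>A i x\<bar> \<Longrightarrow> \<bar>A i x\<bar> \<le> u 0 \<Longrightarrow> i = 0"
    and piece: "\<And>b i y. y \<in> P (b, i) \<longleftrightarrow> signed b (A (m (b, i)) y) \<in> {u (Suc i)..u i}"
  shows "AE x in lborel. \<exists>!n. A n x \<in> (\<Union>c. P c)"
proof -
  \<comment> \<open>boundary points of cells, and the point \<open>0\<close>, which may be fixed by \<open>A\<close>\<close>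
  define C where "C = (\<Union>y\<in>insert 0 (insert L (range u)). {y, - y})"
  have u_le: "u i \<le> u 0" for i
    by (rule lift_Suc_antimono_le[of u 0 i]) (use dec in \<open>auto intro: less_imp_le\<close>)
  have A_inv: "A (- n) (A n x) = x" for n x
    using A_add[of "- n" n x] A_0 by simp
  have "countable (\<Union>n. A (- n) ` C)" unfolding C_def by (intro countable_UN countable_image) auto
  then have "AE x in lborel. x \<notin> (\<Union>n. A (- n) ` C)"
    by (intro AE_not_in countable_imp_null_set_lborel)
  then show ?thesis
  proof eventually_elim
    case (elim x)
    have good: "A n x \<notin> C" for n
    proof
      assume "A n x \<in> C"
      then have "A (- n) (A n x) \<in> A (- n) ` C" by (rule imageI)
      then show False using elim unfolding A_inv by blast
    qed
    have "x \<noteq> 0" using good[of 0] by (auto simp: A_0 C_def)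
    then obtain k where k: "L \<le> \<bar>A k x\<bar>" "\<bar>A k x\<bar> \<le> u 0" using reach by blast
    define y where "y = A k x"
    have "\<bar>y\<bar> \<notin> insert 0 (insert L (range u))"
    proof
      assume "\<bar>y\<bar> \<in> insert 0 (insert L (range u))"
      moreover have "y \<in> {\<bar>y\<bar>, - \<bar>y\<bar>}" by (simp add: abs_if)
      ultimately have "y \<in> C" unfolding C_def by blast
      then show False using good[of k] by (simp add: y_def)
    qed
    then have abs_ne: "\<bar>y\<bar> \<noteq> L" "\<bar>y\<bar> \<notin> range u" "y \<noteq> 0"
      by auto
    have y: "L < \<bar>y\<bar>" "\<bar>y\<bar> < u 0"
      using k abs_ne unfolding y_def by (auto simp: less_le)
    obtain i where i: "\<bar>y\<bar> \<in> {u (Suc i)..u i}" and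
      i_unique: "\<And>j. \<bar>y\<bar> \<in> {u (Suc j)..u j} \<Longrightarrow> j = i"
      using ex1_decreasing_interval[OF dec lim y abs_ne(2)] by auto
    define b where "b = (y > 0)"
    have sb: "signed b y = \<bar>y\<bar>" by (auto simp: signed_def b_def)
    have cell: "c = b \<and> j = i" if "signed c y \<in> {u (Suc j)..u j}" for c j
    proof -
      have "signed c y > 0" using that above[of "Suc j"] L by auto
      then have "c = b" "signed c y = \<bar>y\<bar>" by (auto simp: signed_def b_def split: if_splits)
      then show ?thesis using i_unique that by auto
    qed
    have "\<exists>!n. A n y \<in> (\<Union>c. P c)"
    proof
      have "A (- m (b, i)) y \<in> P (b, i)"
        unfolding piece A_add[symmetric] using i by (simp add: A_0 sb)
      then show "A (- m (b, i)) y \<in> (\<Union>c. P c)" by blast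
      fix n assume "A n y \<in> (\<Union>c. P c)"
      then obtain c j where cj: "A n y \<in> P (c, j)" by auto
      then have *: "signed c (A (m (c, j) + n) y) \<in> {u (Suc j)..u j}"
        unfolding piece A_add .
      then have "signed c (A (m (c, j) + n) y) > 0" using above[of "Suc j"] L by auto
      then have "signed c (A (m (c, j) + n) y) = \<bar>A (m (c, j) + n) y\<bar>"
        by (auto simp: signed_def split: if_splits)
      then have "L < \<bar>A (m (c, j) + n) y\<bar>" "\<bar>A (m (c, j) + n) y\<bar> \<le> u 0"
        using * above[of "Suc j"] u_le[of j] by auto
      then have 0: "m (c, j) + n = 0" by (rule sep[OF y])
      then have "c = b \<and> j = i" using * by (intro cell) (simp add: A_0)
      then show "n = - m (b, i)" using 0 by simp
    qed
    then show "\<exists>!n. A n x \<in> (\<Union>c. P c)"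
      unfolding y_def A_add[symmetric] by (metis diff_add_cancel)
  qed
qed

text \<open>
  The endpoints of the intervals \<open>J\<^sub>n\<close>. The endpoints of the \<open>I\<^bsub>n+1\<^esub>\<close> are translates as well as dilates
  of them, so all computations reduce to these two sequences.
\<close>

definition J_lower :: "nat \<Rightarrow> real" where
  "J_lower n = 3 * 2 ^ n / (2 ^ (2 * n + 4) - 1)"

definition J_upper :: "nat \<Rightarrow> real" where
  "J_upper n = (if n = 0 then 1 / 3 else 3 * 2 ^ (n - 1) / (2 ^ (2 * n + 3) - 1))"

lemma J_lower_eq: "J_lower n = 3 * 2 ^ n / (16 * (2 ^ n)\<^sup>2 - 1)"
  by (simp add: J_lower_def power_add power_mult power2_eq_square power_mult_distrib[symmetric])

lemma J_upper_0: "J_upper 0 = 1 / 3"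
  by (simp add: J_upper_def)

lemma J_upper_Suc: "J_upper (Suc n) = 3 * 2 ^ n / (32 * (2 ^ n)\<^sup>2 - 1)"
  by (simp add: J_upper_def power_add power_mult power2_eq_square power_mult_distrib[symmetric])

lemma J_set_eq: "J_set n = {J_lower n..J_upper n}"
  by (simp add: J_set_def J_lower_def J_upper_def)

lemma two_power_facts: "(1::real) \<le> 2 ^ n" "(1::real) \<le> (2 ^ n)\<^sup>2"
  by (simp_all add: power_mult[symmetric])

text \<open>
  The set \<open>I\<^bsub>n+1\<^esub>\<close> fills, after a shift by an integer, exactly the gap between \<open>J\<^bsub>n+1\<^esub>\<close> and \<open>J\<^sub>n\<close>.
\<close>

lemma I_set_Suc_translate: "I_set (Suc n) = {J_upper (Suc n) + 3 * 2 ^ n..J_lower n + 3 * 2 ^ n}"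
proof -
  define t :: real where "t = 2 ^ n"
  have t: "t \<ge> 1" "16 * t\<^sup>2 - 1 > 0" "32 * t\<^sup>2 - 1 > 0"
    unfolding t_def using two_power_facts[of n] by linarith+
  have "3 * 2 ^ (3 * Suc n + 2) / (2 ^ (2 * Suc n + 3) - 1) = 3 * (32 * t ^ 3) / (32 * t\<^sup>2 - 1)"
    "3 * 2 ^ (3 * Suc n + 1) / (2 ^ (2 * Suc n + 2) - 1) = 3 * (16 * t ^ 3) / (16 * t\<^sup>2 - 1)"
    by (simp_all add: t_def power_add power_mult power2_eq_square power3_eq_cube power_mult_distrib[symmetric])
  moreover have "3 * (32 * t ^ 3) / (32 * t\<^sup>2 - 1) = J_upper (Suc n) + 3 * t"
    using t unfolding J_upper_Suc t_def[symmetric] by (simp add: field_simps power2_eq_square power3_eq_cube)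
  moreover have "3 * (16 * t ^ 3) / (16 * t\<^sup>2 - 1) = J_lower n + 3 * t"
    using t unfolding J_lower_eq t_def[symmetric] by (simp add: field_simps power2_eq_square power3_eq_cube)
  ultimately show ?thesis by (simp add: I_set_def t_def)
qed

text \<open>
  The point of the construction: for the endpoints, the shift by \<open>3 2\<^sup>n\<close> is also a dyadic dilation. This
  identity and the next one convert the description of \<open>I\<^bsub>n+1\<^esub>\<close> by translation into one by dilation.
\<close>

lemma shifted_J_lower_eq: "J_lower n + 3 * 2 ^ n = 2 ^ (2 * n + 4) * J_lower n"
proof -
  define t :: real where "t = 2 ^ n"
  have t: "t \<ge> 1" "16 * t\<^sup>2 - 1 > 0" "32 * t\<^sup>2 - 1 > 0"
    unfolding t_def using two_power_facts[of n] by linarith+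
  have "J_lower n + 3 * t = 16 * t\<^sup>2 * J_lower n"
    using t unfolding J_lower_eq t_def[symmetric] by (simp add: field_simps power2_eq_square power3_eq_cube)
  moreover have "(2::real) ^ (2 * n + 4) = 16 * t\<^sup>2"
    by (simp add: t_def power_add power_mult power2_eq_square power_mult_distrib[symmetric])
  ultimately show ?thesis by (simp add: t_def)
qed

lemma shifted_J_upper_eq: "J_upper (Suc n) + 3 * 2 ^ n = 2 ^ (2 * n + 5) * J_upper (Suc n)"
proof -
  define t :: real where "t = 2 ^ n"
  have t: "t \<ge> 1" "16 * t\<^sup>2 - 1 > 0" "32 * t\<^sup>2 - 1 > 0"
    unfolding t_def using two_power_facts[of n] by linarith+
  have "J_upper (Suc n) + 3 * t = 32 * t\<^sup>2 * J_upper (Suc n)"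
    using t unfolding J_upper_Suc t_def[symmetric] by (simp add: field_simps power2_eq_square power3_eq_cube)
  moreover have "(2::real) ^ (2 * n + 5) = 32 * t\<^sup>2"
    by (simp add: t_def power_add power_mult power2_eq_square power_mult_distrib[symmetric])
  ultimately show ?thesis by (simp add: t_def)
qed


text \<open>
  The sequence \<open>c, f 0, g 0, f 1, g 1, \<dots>\<close>. It lists the breakpoints, the pieces, and the shifts and scales
  attached to the pieces in descending order of position in the fundamental domain.
\<close>

definition interleave :: "'a \<Rightarrow> (nat \<Rightarrow> 'a) \<Rightarrow> (nat \<Rightarrow> 'a) \<Rightarrow> nat \<Rightarrow> 'a" where
  "interleave c f g k = (case k of 0 \<Rightarrow> c | Suc i \<Rightarrow> if even i then f (i div 2) else g (i div 2))"

lemma interleave_simps [simp]: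
  "interleave c f g 0 = c"
  "interleave c f g (Suc 0) = f 0"
  "interleave c f g (Suc (2 * n)) = f n"
  "interleave c f g (Suc (Suc (2 * n))) = g n"
  "interleave c f g (Suc (Suc (Suc (2 * n)))) = f (Suc n)"
  by (simp_all add: interleave_def)

lemma interleave_cases [case_names first odd even]:
  obtains "k = 0" | n where "k = Suc (2 * n)" | n where "k = Suc (Suc (2 * n))"
proof (cases k)
  case (Suc i)
  show ?thesis
  proof (cases "even i")
    case True
    then show ?thesis using that(2)[of "i div 2"] Suc by simp
  next
    case False
    then show ?thesis using that(3)[of "i div 2"] Suc by (simp add: odd_two_times_div_two_succ)
  qed
qed (rule that(1))

lemma range_interleave_union:
  "(\<Union>k. interleave (I 0) J (\<lambda>n. I (Suc n)) k) = (\<Union>n. I n) \<union> (\<Union>n. J n)"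
proof (intro equalityI subsetI)
  fix x assume "x \<in> (\<Union>k. interleave (I 0) J (\<lambda>n. I (Suc n)) k)"
  then obtain k where "x \<in> interleave (I 0) J (\<lambda>n. I (Suc n)) k" by auto
  then show "x \<in> (\<Union>n. I n) \<union> (\<Union>n. J n)"
    by (cases k rule: interleave_cases) auto
next
  fix x assume "x \<in> (\<Union>n. I n) \<union> (\<Union>n. J n)"
  then consider n where "x \<in> I n" | n where "x \<in> J n" by auto
  then show "x \<in> (\<Union>k. interleave (I 0) J (\<lambda>n. I (Suc n)) k)"
  proof cases
    case (1 n)
    show ?thesis
    proof (cases n)
      case 0
      then show ?thesis using 1 by (auto intro!: exI[of _ "0::nat"])
    next
      case (Suc m)
      then show ?thesis using 1 by (auto intro!: exI[of _ "Suc (Suc (2 * m))"])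
    qed
  next
    case (2 n)
    then show ?thesis by (auto intro!: exI[of _ "Suc (2 * n)"])
  qed
qed

definition piece :: "nat \<Rightarrow> real set" where
  "piece = interleave (I_set 0) J_set (\<lambda>n. I_set (Suc n))"

definition signed_piece :: "bool \<times> nat \<Rightarrow> real set" where
  "signed_piece = (\<lambda>(b, i). {x. signed b x \<in> piece i})"

definition wavelet_tile :: "real set" where
  "wavelet_tile = (\<Union>c. signed_piece c)"

lemma wavelet_tile_eq:
  "wavelet_tile = ((\<Union>n. I_set n) \<union> (\<Union>n. J_set n)) \<union> uminus ` ((\<Union>n. I_set n) \<union> (\<Union>n. J_set n))"
proof -
  have "wavelet_tile = (\<Union>i. piece i) \<union> {x. - x \<in> (\<Union>i. piece i)}"
    by (auto simp: wavelet_tile_def signed_piece_def signed_def split: if_splits)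
  also have "{x. - x \<in> (\<Union>i. piece i)} = uminus ` (\<Union>i. piece i)"
    by (force simp: image_iff)
  finally show ?thesis
    unfolding piece_def range_interleave_union .
qed

lemma J_lower_bounds: "0 < J_lower n" "J_lower n < 1 / 2 ^ n" "J_lower n < J_upper n" "J_upper (Suc n) < J_lower n"
proof -
  define t :: real where "t = 2 ^ n"
  have t: "t \<ge> 1" "16 * t\<^sup>2 - 1 > 0" "32 * t\<^sup>2 - 1 > 0"
    unfolding t_def using two_power_facts[of n] by linarith+
  show "0 < J_lower n" using t unfolding J_lower_eq t_def[symmetric] by simp
  have "1 * 1 \<le> t * t" using t by (intro mult_mono) auto
  then show "J_lower n < 1 / 2 ^ n"
    using t unfolding J_lower_eq t_def[symmetric] by (simp add: field_simps power2_eq_square)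
  have "3 * t / (32 * t\<^sup>2 - 1) < 3 * t / (16 * t\<^sup>2 - 1)"
    using t by (intro divide_strict_left_mono mult_pos_pos) auto
  then show "J_upper (Suc n) < J_lower n" unfolding J_lower_eq J_upper_Suc t_def .
  show "J_lower n < J_upper n"
  proof (cases n)
    case (Suc m)
    define s :: real where "s = 2 ^ m"
    have s: "s \<ge> 1" "64 * s\<^sup>2 - 1 > 0" "32 * s\<^sup>2 - 1 > 0"
      unfolding s_def using two_power_facts[of m] by linarith+
    have "3 * (2 * s) / (16 * (2 * s)\<^sup>2 - 1) < 3 * s / (32 * s\<^sup>2 - 1)"
      using s by (simp add: field_simps power2_eq_square)
    then show ?thesis unfolding Suc J_upper_Suc J_lower_eq by (simp add: s_def)
  qed (simp add: J_lower_eq J_upper_0)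
qed

text \<open>
  After scaling, the endpoints still interlace and now decrease to \<open>3/4\<close>.
\<close>

lemma dilated_bounds:
  "3 / 4 < 2 ^ (n + 2) * J_lower n" "2 ^ (n + 2) * J_lower n < 3 / 4 + 1 / 2 ^ n"
  "2 ^ (n + 2) * J_lower n < 2 ^ (n + 2) * J_upper n"
  "2 ^ (Suc n + 2) * J_upper (Suc n) < 2 ^ (n + 2) * J_lower n"
proof -
  define t :: real where "t = 2 ^ n"
  have t: "t \<ge> 1" "16 * t\<^sup>2 - 1 > 0" "32 * t\<^sup>2 - 1 > 0"
    unfolding t_def using two_power_facts[of n] by linarith+
  have l: "2 ^ (n + 2) * J_lower n = 12 * t\<^sup>2 / (16 * t\<^sup>2 - 1)"
    unfolding J_lower_eq by (simp add: t_def power_add power2_eq_square)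
  have u: "2 ^ (Suc n + 2) * J_upper (Suc n) = 24 * t\<^sup>2 / (32 * t\<^sup>2 - 1)"
    unfolding J_upper_Suc by (simp add: t_def power_add power2_eq_square)
  show "3 / 4 < 2 ^ (n + 2) * J_lower n" unfolding l using t by (simp add: field_simps)
  show "2 ^ (Suc n + 2) * J_upper (Suc n) < 2 ^ (n + 2) * J_lower n"
    unfolding l u using t by (simp add: field_simps)
  show "2 ^ (n + 2) * J_lower n < 2 ^ (n + 2) * J_upper n"
    using J_lower_bounds(3)[of n] by simp
  have "t \<le> t\<^sup>2" using t by (simp add: power2_eq_square)
  then have "(3 / 4) * t < 16 * t\<^sup>2 - 1" using t by linarith
  have "12 * t\<^sup>2 / (16 * t\<^sup>2 - 1) = 3 / 4 + (3 / 4) / (16 * t\<^sup>2 - 1)"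
    using t by (simp add: field_simps)
  also have "(3 / 4) / (16 * t\<^sup>2 - 1) < 1 / t"
    using t \<open>(3 / 4) * t < 16 * t\<^sup>2 - 1\<close> by (simp add: divide_simps)
  finally show "2 ^ (n + 2) * J_lower n < 3 / 4 + 1 / 2 ^ n" unfolding l by (simp add: t_def)
qed

lemma half_power_less: "\<exists>n. 1 / 2 ^ n < (y :: real)" if "0 < y"
  using real_arch_pow_inv[OF that, of "1/2"] unfolding power_one_over by simp

text \<open>
  The fundamental domain is \<open>[-1/2, 1/2]\<close>, with breakpoints descending to \<open>0\<close>. A piece and its mirror image
  are shifted in opposite directions.
\<close>

lemma wavelet_tile_translation:
  "AE x in lborel. \<exists>!n::int. x + of_int n \<in> wavelet_tile"
  unfolding wavelet_tile_def
proof (rule AE_ex1_orbit[where L=0 and u="interleave (1 / 2) J_upper J_lower"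
      and m="\<lambda>(b, i). (if b then - 1 else 1) * interleave 1 (\<lambda>n. 0) (\<lambda>n. 3 * 2 ^ n) i"])
  fix i
  show "interleave (1 / 2) J_upper J_lower (Suc i) < interleave (1 / 2) J_upper J_lower i"
    by (cases i rule: interleave_cases) (simp_all add: J_upper_0 J_lower_bounds)
  show "0 < interleave (1 / 2) J_upper J_lower i"
  proof (cases i rule: interleave_cases)
    case (odd n)
    then show ?thesis using J_lower_bounds(1,3)[of n] by simp
  qed (simp_all add: J_lower_bounds)
next
  fix y :: real assume "0 < y"
  then obtain n where "1 / 2 ^ n < y" using half_power_less by blast
  then have "J_lower n < y" using J_lower_bounds(2)[of n] by simp
  then show "\<exists>i. interleave (1 / 2) J_upper J_lower i < y"
    by (intro exI[of _ "Suc (Suc (2 * n))"]) simp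
next
  fix x :: real
  have "\<bar>x + of_int (- \<lfloor>x + 1 / 2\<rfloor>)\<bar> \<le> 1 / 2"
    using of_int_floor_le[of "x + 1 / 2"] real_of_int_floor_add_one_gt[of "x + 1 / 2"] by (simp only: abs_le_iff of_int_minus) linarith
  then show "\<exists>n::int. 0 \<le> \<bar>x + of_int n\<bar> \<and> \<bar>x + of_int n\<bar> \<le> interleave (1 / 2) J_upper J_lower 0"
    by (intro exI[of _ "- \<lfloor>x + 1 / 2\<rfloor>"]) simp
next
  fix x :: real and i :: int
  assume "\<bar>x\<bar> < interleave (1 / 2) J_upper J_lower 0" "\<bar>x + of_int i\<bar> \<le> interleave (1 / 2) J_upper J_lower 0"
  then have "\<bar>x\<bar> < 1 / 2" "\<bar>x + of_int i\<bar> \<le> 1 / 2" by simp_all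
  then have "\<bar>real_of_int i\<bar> < 1" unfolding abs_less_iff abs_le_iff by linarith
  then show "i = 0" by simp
next
  fix b i and y :: real
  let ?s = "interleave 1 (\<lambda>n. 0) (\<lambda>n. 3 * 2 ^ n) i :: int"
  have "signed b (y + of_int ((if b then - 1 else 1) * ?s)) = signed b y - of_int ?s"
    by (simp add: signed_def)
  moreover have "z \<in> piece i \<longleftrightarrow>
      z - of_int ?s \<in> {interleave (1 / 2) J_upper J_lower (Suc i)..interleave (1 / 2) J_upper J_lower i}" for z
    by (cases i rule: interleave_cases)
      (auto simp: piece_def I_set_Suc_translate J_set_eq I_set_def[of 0] J_upper_0)
  ultimately show "y \<in> signed_piece (b, i) \<longleftrightarrow>
      signed b (y + of_int (case (b, i) of (b, i) \<Rightarrow> (if b then - 1 else 1) * interleave 1 (\<lambda>n. 0) (\<lambda>n. 3 * 2 ^ n) i))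
        \<in> {interleave (1 / 2) J_upper J_lower (Suc i)..interleave (1 / 2) J_upper J_lower i}"
    by (simp add: signed_piece_def)
qed simp_all

abbreviation "dilation_breaks \<equiv>
  interleave (3 / 2) (\<lambda>n. 2 ^ (n + 2) * J_upper n) (\<lambda>n. 2 ^ (n + 2) * J_lower n)"

lemma piece_dilate:
  "z \<in> piece i \<longleftrightarrow> 2 powi interleave 0 (\<lambda>n. int (n + 2)) (\<lambda>n. - int (n + 2)) i * z
      \<in> {dilation_breaks (Suc i)..dilation_breaks i}"
proof (cases i rule: interleave_cases)
  case first
  then show ?thesis by (simp add: piece_def I_set_def J_upper_0)
next
  case (odd n)
  show ?thesis
    unfolding odd piece_def interleave_simps J_set_eq power_int_of_nat by simp
next
  case (even n)
  have a: "2 powi (- int (n + 2)) = (1 / 2 ^ (n + 2) :: real)"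
    unfolding power_int_minus power_int_of_nat inverse_eq_divide ..
  have p: "(2::real) ^ (2 * n + 4) = 2 ^ (n + 2) * 2 ^ (n + 2)" "(2::real) ^ (2 * n + 5) = 2 ^ (n + 2) * 2 ^ (Suc n + 2)"
    unfolding power_add[symmetric] by (rule arg_cong[where f="power 2"], simp)+
  have q: "c * d \<le> z \<longleftrightarrow> d \<le> 1 / c * z" "z \<le> c * d \<longleftrightarrow> 1 / c * z \<le> d" if "c > 0" for c d :: real
    using that by (simp_all add: field_simps)
  have "z \<in> piece i \<longleftrightarrow> 2 ^ (n + 2) * (2 ^ (Suc n + 2) * J_upper (Suc n)) \<le> z \<and> z \<le> 2 ^ (n + 2) * (2 ^ (n + 2) * J_lower n)"
    unfolding even piece_def interleave_simps I_set_Suc_translate shifted_J_lower_eq shifted_J_upper_eq p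
    by (simp only: atLeastAtMost_iff mult.assoc)
  also have "\<dots> \<longleftrightarrow> 1 / 2 ^ (n + 2) * z \<in> {2 ^ (Suc n + 2) * J_upper (Suc n)..2 ^ (n + 2) * J_lower n}"
    using q[of "2 ^ (n + 2)"] by (simp only: atLeastAtMost_iff zero_less_power zero_less_numeral)
  finally show ?thesis
    unfolding even interleave_simps a .
qed

text \<open>
  The fundamental domain consists of the points of absolute value between \<open>3/4\<close> and \<open>3/2\<close>.
\<close>

lemma wavelet_tile_dilation:
  "AE x in lborel. \<exists>!j::int. 2 powi j * x \<in> wavelet_tile"
  unfolding wavelet_tile_def
proof (rule AE_ex1_orbit[where L="3 / 4" and u=dilation_breaks
      and m="\<lambda>(b, i). interleave 0 (\<lambda>n. int (n + 2)) (\<lambda>n. - int (n + 2)) i"])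
  show "2 powi 0 * x = x" for x :: real by simp
  show "2 powi (i + j) * x = 2 powi i * (2 powi j * x)" for i j and x :: real
    by (simp add: power_int_add)
  fix i
  show "dilation_breaks (Suc i) < dilation_breaks i"
  proof (cases i rule: interleave_cases)
    case first
    then show ?thesis by (simp add: J_upper_0)
  next
    case (odd n)
    then show ?thesis using dilated_bounds(3)[of n] by (simp only: odd interleave_simps)
  next
    case (even n)
    then show ?thesis using dilated_bounds(4)[of n] by (simp only: even interleave_simps)
  qed
  show "3 / 4 < dilation_breaks i"
  proof (cases i rule: interleave_cases)
    case (odd n)
    have "3 / 4 < 2 ^ (n + 2) * J_upper n" using dilated_bounds(1,3)[of n] by (rule less_trans)
    then show ?thesis by (simp only: odd interleave_simps)
  next
    case (even n)
    show ?thesis unfolding even interleave_simps by (rule dilated_bounds)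
  qed simp
next
  fix y :: real assume "3 / 4 < y"
  then obtain n where "1 / 2 ^ n < y - 3 / 4" using half_power_less[of "y - 3 / 4"] by auto
  then have "2 ^ (n + 2) * J_lower n < y" using dilated_bounds(2)[of n] by linarith
  then show "\<exists>i. dilation_breaks i < y"
    by (intro exI[of _ "Suc (Suc (2 * n))"]) (simp only: interleave_simps)
next
  fix x :: real assume x: "x \<noteq> 0"
  \<comment> \<open>the power of \<open>2\<close> that brings \<open>\<bar>x\<bar>\<close> into \<open>[3/4, 3/2)\<close>\<close>
  define k where "k = - \<lfloor>log 2 (\<bar>x\<bar> / (3 / 4))\<rfloor>"
  let ?l = "log 2 (\<bar>x\<bar> / (3 / 4))"
  have l: "2 powr ?l = \<bar>x\<bar> / (3 / 4)" using x by (subst powr_log_cancel) auto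
  have "2 powi k * \<bar>x\<bar> = 3 / 4 * (2 powr real_of_int k * 2 powr ?l)"
    unfolding l by (simp add: powr_real_of_int')
  also have "\<dots> = 3 / 4 * 2 powr (?l + real_of_int k)" by (simp add: powr_add)
  finally have eq: "\<bar>2 powi k * x\<bar> = 3 / 4 * 2 powr (?l + real_of_int k)"
    by (simp add: abs_mult)
  have "0 \<le> ?l + real_of_int k" "?l + real_of_int k \<le> 1"
    unfolding k_def using of_int_floor_le[of ?l] real_of_int_floor_add_one_gt[of ?l]
    unfolding of_int_minus by linarith+
  then have "2 powr 0 \<le> 2 powr (?l + real_of_int k)" "2 powr (?l + real_of_int k) \<le> 2 powr 1"
    by (simp_all only: powr_le_cancel_iff one_less_numeral_iff semiring_norm)
  then show "\<exists>n::int. 3 / 4 \<le> \<bar>2 powi n * x\<bar> \<and> \<bar>2 powi n * x\<bar> \<le> dilation_breaks 0"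
    by (intro exI[of _ k]) (simp add: eq)
next
  fix x :: real and i :: int
  assume x: "3 / 4 < \<bar>x\<bar>" "\<bar>x\<bar> < dilation_breaks 0"
    and ix: "3 / 4 < \<bar>2 powi i * x\<bar>" "\<bar>2 powi i * x\<bar> \<le> dilation_breaks 0"
  have e: "\<bar>2 powi i * x\<bar> = 2 powi i * \<bar>x\<bar>" by (simp add: abs_mult)
  show "i = 0"
  proof (rule ccontr)
    assume "i \<noteq> 0"
    then consider "i \<ge> 1" | "i \<le> - 1" by linarith
    then show False
    proof cases
      case 1
      then have "(2::real) powi 1 \<le> 2 powi i" by (intro power_int_increasing) auto
      then have "2 * \<bar>x\<bar> \<le> 2 powi i * \<bar>x\<bar>" by (intro mult_right_mono) auto
      then show False using x ix unfolding e by simp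
    next
      case 2
      then have "(2::real) powi i \<le> 2 powi (- 1)" by (intro power_int_increasing) auto
      then have "2 powi i * \<bar>x\<bar> \<le> (1 / 2) * \<bar>x\<bar>" by (intro mult_right_mono) (auto simp: power_int_minus)
      then show False using x ix unfolding e by simp
    qed
  qed
next
  fix b i and y :: real
  have "signed b (c * y) = c * signed b y" for c by (simp add: signed_def)
  then show "y \<in> signed_piece (b, i) \<longleftrightarrow>
      signed b (2 powi (case (b, i) of (b, i) \<Rightarrow> interleave 0 (\<lambda>n. int (n + 2)) (\<lambda>n. - int (n + 2)) i) * y)
        \<in> {dilation_breaks (Suc i)..dilation_breaks i}"
    by (simp only: signed_piece_def case_prod_conv mem_Collect_eq piece_dilate)
qed simp_all

lemma tiling_set_wavelet_tile: "tiling_set wavelet_tile"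
proof
  have "I_set n \<in> sets borel" "J_set n \<in> sets borel" for n
    by (simp_all add: I_set_def J_set_eq)
  then have 1: "(\<Union>n. I_set n) \<union> (\<Union>n. J_set n) \<in> sets borel" (is "?S \<in> _") by blast
  have "uminus ` ?S = uminus -` ?S \<inter> space borel" by (force simp: image_iff)
  moreover have "uminus -` ?S \<inter> space borel \<in> sets borel"
    using 1 by (intro measurable_sets[of _ borel borel]) auto
  ultimately have "uminus ` ?S \<in> sets borel" by (simp only:)
  with 1 show "wavelet_tile \<in> sets borel"
    unfolding wavelet_tile_eq by (rule sets.Un)
qed (rule wavelet_tile_translation wavelet_tile_dilation)+

text \<open>
  The predicate need not be measurable, so a Borel null set around its exceptional set is reflected
  instead.
\<close>

lemma AE_lebesgue_reflect:
  assumes "AE x in lebesgue. P (x :: real)"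
  shows "AE x in lebesgue. P (- x)"
proof -
  have "AE x in lborel. P x" using assms by (simp add: AE_completion_iff)
  then obtain N where N: "\<And>x. x \<in> space lborel - N \<Longrightarrow> P x" "N \<in> null_sets lborel"
    by (rule AE_E3) blast
  have [measurable]: "N \<in> sets borel" using null_setsD2[OF N(2)] by simp
  have "AE x in lborel. 0 + (-1) * x \<notin> N"
    by (rule AE_borel_affine[OF _ _ AE_not_in[OF N(2)]]) (simp, measurable)
  then have "AE x in lborel. P (- x)"
  proof eventually_elim
    case (elim x)
    then show "P (- x)" by (intro N(1)) simp
  qed
  then show ?thesis by (rule AE_completion)
qed

lemma I_J_sets_positive:
  assumes "x \<in> (\<Union>n. I_set n) \<union> (\<Union>n. J_set n)"
  shows "x > 0"
proof -
  consider n where "x \<in> I_set n" | n where "x \<in> J_set n" using assms by auto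
  then show ?thesis
  proof cases
    case (1 n)
    have "(0::real) < 2 ^ n" by simp
    also have "\<dots> \<le> x" using 1 I_set_bounds[of n] by auto
    finally show ?thesis .
  next
    case (2 n)
    have "0 < J_lower n" by (rule J_lower_bounds)
    also have "\<dots> \<le> x" using 2 by (simp add: J_set_eq)
    finally show ?thesis .
  qed
qed

theorem proposition17:
  fixes K :: "real set"
  assumes "symmetric_set K"
    and "ae_eq_set (K \<inter> {0..}) ((\<Union>n. I_set n) \<union> (\<Union>n. J_set n))"
  shows "wavelet_set K \<and> symmetric_set K \<and> 0 islimpt K"
proof (intro conjI)
  let ?S = "(\<Union>n. I_set n) \<union> (\<Union>n. J_set n)"
  have pos: "AE x in lebesgue. x \<in> K \<inter> {0..} \<longleftrightarrow> x \<in> ?S"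
    using assms(2) by (simp only: ae_eq_set_def)
  have sym: "AE x in lebesgue. x \<in> K \<inter> {..0} \<longleftrightarrow> x \<in> uminus ` (K \<inter> {0..})"
    using assms(1) by (simp only: symmetric_set_def ae_eq_set_def)
  have neg: "AE x in lebesgue. - x \<in> K \<inter> {0..} \<longleftrightarrow> - x \<in> ?S"
    using pos by (rule AE_lebesgue_reflect)
  have reflected: "x \<in> uminus ` T \<longleftrightarrow> - x \<in> T" for x :: real and T by (force simp: image_iff)
  have "AE x in lebesgue. x \<noteq> (0::real)" by (intro AE_completion AE_lborel_singleton)
  then have "AE x in lebesgue. x \<in> K \<longleftrightarrow> x \<in> wavelet_tile"
    using pos sym neg
  proof eventually_elim
    case (elim x)
    have p: "y \<in> ?S \<Longrightarrow> y > 0" for y by (rule I_J_sets_positive)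
    have tile: "x \<in> wavelet_tile \<longleftrightarrow> x \<in> ?S \<or> - x \<in> ?S"
      unfolding wavelet_tile_eq Un_iff[of x ?S] reflected ..
    show ?case
    proof (cases "x > 0")
      case True
      then show ?thesis using elim(2) p[of "- x"] tile by auto
    next
      case False
      then have "x < 0" using elim(1) by simp
      then show ?thesis using elim(3,4) p[of x] tile unfolding reflected by auto
    qed
  qed
  then show "wavelet_set K"
    using tiling_set.wavelet_set_if_ae_eq[OF tiling_set_wavelet_tile] by (simp only: ae_eq_set_def)
  show "symmetric_set K" by fact
  show "0 islimpt K"
    unfolding islimpt_approachable
  proof (intro allI impI)
    fix e :: real assume "e > 0"
    then obtain n where n: "1 / 2 ^ n < e" using half_power_less by blast
    \<comment> \<open>\<open>J\<^bsub>n+1\<^esub>\<close> has positive measure, lies within \<open>e\<close> of \<open>0\<close>, and is almost contained in \<open>K\<close>\<close>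
    have "J_lower (Suc n) < J_upper (Suc n)" by (rule J_lower_bounds)
    show "\<exists>x\<in>K. x \<noteq> 0 \<and> dist x 0 < e"
    proof (rule ccontr)
      assume none: "\<not> (\<exists>x\<in>K. x \<noteq> 0 \<and> dist x 0 < e)"
      have "AE x in lebesgue. x \<notin> {J_lower (Suc n)..J_upper (Suc n)}"
        using pos
      proof eventually_elim
        case (elim x)
        show ?case
        proof
          assume x: "x \<in> {J_lower (Suc n)..J_upper (Suc n)}"
          then have "x \<in> J_set (Suc n)" by (simp add: J_set_eq)
          then have "x \<in> K" using elim by blast
          moreover have "0 < x" "x < e"
            using x n J_lower_bounds(1)[of "Suc n"] J_lower_bounds(2,4)[of n] by auto
          ultimately show False using none by (auto simp: dist_real_def)
        qed
      qed
      then have "AE x in lborel. x \<notin> {J_lower (Suc n)..J_upper (Suc n)}"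
        by (simp only: AE_completion_iff)
      from emeasure_eq_0_AE[OF this]
      have "emeasure lborel {x \<in> space lborel. x \<in> {J_lower (Suc n)..J_upper (Suc n)}} = 0" .
      moreover have "{x \<in> space lborel. x \<in> {J_lower (Suc n)..J_upper (Suc n)}} = {J_lower (Suc n)..J_upper (Suc n)}"
        by auto
      ultimately have "emeasure lborel {J_lower (Suc n)..J_upper (Suc n)} = 0" by (simp only:)
      then show False using \<open>J_lower (Suc n) < J_upper (Suc n)\<close> by simp
    qed
  qed
qed

end
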